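(* The Fenchel dual problem corresponding to the minimization of $\mathcal F=F_0+G\circ A$ over $X_\varphi$ is $$\sup_{p\in K_\varphi}\Bigl\{-\tfrac12\|\operatorname{div}p\|_{L^2(\Omega)}^2-\int_\Omega f\,\operatorname{div}p\,dx-\int_\Omega\varphi^*(x,|p(x)|)\,dx\Bigr\},$$ where $$K_\varphi:=\Bigl\{p\in L^{\varphi^*}(\Omega;\mathbb R^N):\ \operatorname{div}p\in L^2(\Omega)\text{ and }\int_\Omega p\cdot\nabla u\,dx=-\int_\Omega(\operatorname{div}p)\,u\,dx\ \text{for all }u\in X_\varphi\Bigr\}$$ (that is, for $p\in L^{\varphi^*}(\Omega;\mathbb R^N)$ the dual objective $-F_0^*(-A^*p)-G^*(p)$ equals the expression in braces if $p\in K_\varphi$ and equals $-\infty$ otherwise). This problem admits a maximizer.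
   Context: $\Omega\subset\mathbb R^N$ is a bounded Lipschitz domain with Lebesgue measure, and $f\in L^2(\Omega)$. Standing assumptions on $\varphi:\Omega\times[0,\infty)\to[0,\infty)$: $x\mapsto\varphi(x,t)$ is measurable for every $t\ge0$; for a.e. $x\in\Omega$ the map $t\mapsto\varphi(x,t)$ is convex, increasing (in the non-strict sense), continuous, and $\varphi(x,0)=0$; $\varphi(\cdot,t)\in L^1(\Omega)$ for every $t\ge0$; there is a constant $C_\Delta$ with $\varphi(x,2t)\le C_\Delta\varphi(x,t)$ for a.e. $x\in\Omega$ and all $t\ge0$; and $\lim_{t\to\infty}\operatorname{ess\,inf}_{x\in\Omega}\varphi(x,t)/t=\infty$. Set $\varphi^*(x,s):=\sup_{t\ge0}\{st-\varphi(x,t)\}$ for $s\ge0$. For $\psi\in\{\varphi,\varphi^*\}$ and measurable $v:\Omega\to\mathbb R^N$ set $\rho_\psi(v):=\int_\Omega\psi(x,|v(x)|)\,dx$ and $L^\psi(\Omega;\mathbb R^N):=\{v\text{ measurable}:\rho_\psi(\lambda v)<\infty\text{ for some }\lambda>0\}$, with Luxemburg norm $\|v\|_\psi:=\inf\{\lambda>0:\rho_\psi(v/\lambda)\le1\}$. $X_\varphi:=\{u\in L^2(\Omega)\cap W^{1,1}(\Omega):\rho_\varphi(\nabla u)<\infty\}$ is the Banach space with norm $\|u\|_{L^2(\Omega)}+\|\nabla u\|_\varphi$; $Y:=L^\varphi(\Omega;\mathbb R^N)$; $A:X_\varphi\to Y$, $Au:=\nabla u$; $F_0:X_\varphi\to\mathbb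 R$, $F_0(u):=\frac12\|u-f\|_{L^2(\Omega)}^2$; $G:Y\to\mathbb R$, $G(v):=\rho_\varphi(v)$; $\mathcal F(u)=F_0(u)+G(Au)$. The Fenchel dual problem of $\inf_{u\in X_\varphi}(F_0(u)+G(Au))$ is $\sup_{p\in Y^*}(-F_0^*(-A^*p)-G^*(p))$, with Fenchel conjugates $F_0^*(x^* )=\sup_{u\in X_\varphi}(\langle x^*,u\rangle-F_0(u))$ on $X_\varphi^*$ and $G^*(p)=\sup_{v\in Y}(\langle p,v\rangle-G(v))$ on $Y^*$. The dual $Y^*$ is identified with $L^{\varphi^*}(\Omega;\mathbb R^N)$ through $\langle p,v\rangle=\int_\Omega p\cdot v\,dx$. The divergence $\operatorname{div}p$ is understood in the distributional sense; the integration-by-parts identity in $K_\varphi$ is the weak formulation of the homogeneous normal boundary condition $p\cdot\nu=0$ on $\partial\Omega$. *)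

theory Defs
  imports "HOL-Analysis.Analysis"
begin

text \<open>Functions on \<open>\<Omega>\<close> are total functions measurable with respect to \<^term>\<open>lebesgue_on \<Omega>\<close>;
  the function spaces below are sets of such functions, not of classes modulo null sets.\<close>

section \<open>The domain\<close>

text \<open>Near each boundary point, \<open>\<Omega>\<close> is the strict epigraph, in some direction \<open>e\<close>, of a
  Lipschitz function on the hyperplane orthogonal to \<open>e\<close>.\<close>

definition bounded_lipschitz_domain :: "'a::euclidean_space set \<Rightarrow> bool" where
  "bounded_lipschitz_domain \<Omega> \<longleftrightarrow>
     open \<Omega> \<and> connected \<Omega> \<and> \<Omega> \<noteq> {} \<and> bounded \<Omega> \<and>
     (\<forall>z\<in>frontier \<Omega>. \<exists>r>0. \<exists>e \<gamma> L. norm e = 1 \<and> L-lipschitz_on {y. y \<bullet> e = 0} \<gamma> \<and>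
        \<Omega> \<inter> ball z r = {y \<in> ball z r. \<gamma> (y - (y \<bullet> e) *\<^sub>R e) < y \<bullet> e})"


section \<open>Distributional derivatives\<close>

definition pderivative :: "'a::euclidean_space \<Rightarrow> ('a \<Rightarrow> real) \<Rightarrow> 'a \<Rightarrow> real" where
  "pderivative e f x = frechet_derivative f (at x) e"

definition gradient :: "('a::euclidean_space \<Rightarrow> real) \<Rightarrow> 'a \<Rightarrow> 'a" where
  "gradient f x = (\<Sum>e\<in>Basis. pderivative e f x *\<^sub>R e)"

primrec C_k :: "nat \<Rightarrow> ('a::euclidean_space \<Rightarrow> real) \<Rightarrow> bool" where
  "C_k 0 f \<longleftrightarrow> continuous_on UNIV f"
| "C_k (Suc k) f \<longleftrightarrow> (\<forall>x. f differentiable (at x)) \<and> (\<forall>e\<in>Basis. C_k k (pderivative e f))"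

definition test_functions :: "'a::euclidean_space set \<Rightarrow> ('a \<Rightarrow> real) set" where
  "test_functions \<Omega> = {\<zeta>. (\<forall>k. C_k k \<zeta>) \<and>
     compact (closure {x. \<zeta> x \<noteq> 0}) \<and> closure {x. \<zeta> x \<noteq> 0} \<subseteq> \<Omega>}"

definition has_weak_gradient ::
  "'a::euclidean_space set \<Rightarrow> ('a \<Rightarrow> real) \<Rightarrow> ('a \<Rightarrow> 'a) \<Rightarrow> bool" where
  "has_weak_gradient \<Omega> u g \<longleftrightarrow>
     integrable (lebesgue_on \<Omega>) u \<and> integrable (lebesgue_on \<Omega>) g \<and>
     (\<forall>\<zeta>\<in>test_functions \<Omega>. \<forall>e\<in>Basis.
        (LINT x|lebesgue_on \<Omega>. u x * pderivative e \<zeta> x) =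
        - (LINT x|lebesgue_on \<Omega>. (g x \<bullet> e) * \<zeta> x))"

definition W11 :: "'a::euclidean_space set \<Rightarrow> ('a \<Rightarrow> real) set" where
  "W11 \<Omega> = {u. \<exists>g. has_weak_gradient \<Omega> u g}"

text \<open>A representative; it is determined up to a null set.\<close>

definition weak_grad :: "'a::euclidean_space set \<Rightarrow> ('a \<Rightarrow> real) \<Rightarrow> 'a \<Rightarrow> 'a" where
  "weak_grad \<Omega> u = (SOME g. has_weak_gradient \<Omega> u g)"

definition L2 :: "'a::euclidean_space set \<Rightarrow> ('a \<Rightarrow> real) set" where
  "L2 \<Omega> = {u \<in> borel_measurable (lebesgue_on \<Omega>). integrable (lebesgue_on \<Omega>) (\<lambda>x. (u x)\<^sup>2)}"

definition L2_norm :: "'a::euclidean_space set \<Rightarrow> ('a \<Rightarrow> real) \<Rightarrow> real" where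
  "L2_norm \<Omega> u = sqrt (LINT x|lebesgue_on \<Omega>. (u x)\<^sup>2)"

text \<open>\<open>h\<close> is an \<open>L\<^sup>2\<close> function representing the distributional divergence of \<open>p\<close>. This is used
  only for \<open>p\<close> in the Musielak-Orlicz space of the conjugate function, which is contained in
  \<open>L\<^sup>1\<close>, so that the integral on the left is a genuine one.\<close>

definition has_L2_divergence ::
  "'a::euclidean_space set \<Rightarrow> ('a \<Rightarrow> 'a) \<Rightarrow> ('a \<Rightarrow> real) \<Rightarrow> bool" where
  "has_L2_divergence \<Omega> p h \<longleftrightarrow> h \<in> L2 \<Omega> \<and>
     (\<forall>\<zeta>\<in>test_functions \<Omega>.
        (LINT x|lebesgue_on \<Omega>. p x \<bullet> gradient \<zeta> x) = - (LINT x|lebesgue_on \<Omega>. h x * \<zeta> x))"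

definition divergence :: "'a::euclidean_space set \<Rightarrow> ('a \<Rightarrow> 'a) \<Rightarrow> 'a \<Rightarrow> real" where
  "divergence \<Omega> p = (SOME h. has_L2_divergence \<Omega> p h)"


section \<open>Musielak-Orlicz spaces\<close>

text \<open>Only the values \<open>\<phi> x t\<close> with \<open>x \<in> \<Omega>\<close> and \<open>t \<ge> 0\<close> matter. The essential infimum is
  the limes inferior along the almost-everywhere filter, dually to the library's \<open>esssup\<close>.\<close>

definition standing_assumptions :: "'a::euclidean_space set \<Rightarrow> ('a \<Rightarrow> real \<Rightarrow> real) \<Rightarrow> bool" where
  "standing_assumptions \<Omega> \<phi> \<longleftrightarrow>
     (\<forall>x\<in>\<Omega>. \<forall>t\<ge>0. 0 \<le> \<phi> x t) \<and>
     (\<forall>t\<ge>0. (\<lambda>x. \<phi> x t) \<in> borel_measurable (lebesgue_on \<Omega>)) \<and>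
     (AE x in lebesgue_on \<Omega>. convex_on {0..} (\<phi> x) \<and> mono_on {0..} (\<phi> x) \<and>
        continuous_on {0..} (\<phi> x) \<and> \<phi> x 0 = 0) \<and>
     (\<forall>t\<ge>0. integrable (lebesgue_on \<Omega>) (\<lambda>x. \<phi> x t)) \<and>
     (\<exists>C. AE x in lebesgue_on \<Omega>. \<forall>t\<ge>0. \<phi> x (2 * t) \<le> C * \<phi> x t) \<and>
     ((\<lambda>t. Liminf (ae_filter (lebesgue_on \<Omega>)) (\<lambda>x. ereal (\<phi> x t / t))) \<longlongrightarrow> \<infinity>) at_top"

definition conj_fun :: "('a \<Rightarrow> real \<Rightarrow> real) \<Rightarrow> 'a \<Rightarrow> real \<Rightarrow> ereal" where
  "conj_fun \<phi> x s = (SUP t\<in>{0..}. ereal (s * t - \<phi> x t))"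

text \<open>The integrands \<open>\<psi>\<close> are extended-real valued because the conjugate function may take the
  value \<open>\<infinity>\<close>. They are nonnegative at almost every \<open>x\<close>.\<close>

definition modular ::
  "'a::euclidean_space set \<Rightarrow> ('a \<Rightarrow> real \<Rightarrow> ereal) \<Rightarrow> ('a \<Rightarrow> 'a) \<Rightarrow> ennreal" where
  "modular \<Omega> \<psi> v = (\<integral>\<^sup>+x. e2ennreal (\<psi> x (norm (v x))) \<partial>lebesgue_on \<Omega>)"

definition MO_space ::
  "'a::euclidean_space set \<Rightarrow> ('a \<Rightarrow> real \<Rightarrow> ereal) \<Rightarrow> ('a \<Rightarrow> 'a) set" where
  "MO_space \<Omega> \<psi> = {v \<in> borel_measurable (lebesgue_on \<Omega>).
     \<exists>l>0. modular \<Omega> \<psi> (\<lambda>x. l *\<^sub>R v x) < \<infinity>}"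

definition luxemburg_norm ::
  "'a::euclidean_space set \<Rightarrow> ('a \<Rightarrow> real \<Rightarrow> ereal) \<Rightarrow> ('a \<Rightarrow> 'a) \<Rightarrow> real" where
  "luxemburg_norm \<Omega> \<psi> v = Inf {l. l > 0 \<and> modular \<Omega> \<psi> (\<lambda>x. v x /\<^sub>R l) \<le> 1}"

abbreviation Y_space :: "'a::euclidean_space set \<Rightarrow> ('a \<Rightarrow> real \<Rightarrow> real) \<Rightarrow> ('a \<Rightarrow> 'a) set" where
  "Y_space \<Omega> \<phi> \<equiv> MO_space \<Omega> (\<lambda>x t. ereal (\<phi> x t))"

definition X_space :: "'a::euclidean_space set \<Rightarrow> ('a \<Rightarrow> real \<Rightarrow> real) \<Rightarrow> ('a \<Rightarrow> real) set" where
  "X_space \<Omega> \<phi> =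
     {u \<in> L2 \<Omega> \<inter> W11 \<Omega>. modular \<Omega> (\<lambda>x t. ereal (\<phi> x t)) (weak_grad \<Omega> u) < \<infinity>}"

text \<open>The dual of \<^term>\<open>Y_space \<Omega> \<phi>\<close>: linear functionals bounded in the Luxemburg norm. Boundedness
  makes them insensitive to changes on null sets.\<close>

definition Y_dual :: "'a::euclidean_space set \<Rightarrow> ('a \<Rightarrow> real \<Rightarrow> real) \<Rightarrow> (('a \<Rightarrow> 'a) \<Rightarrow> real) set" where
  "Y_dual \<Omega> \<phi> = {l.
     (\<forall>v\<in>Y_space \<Omega> \<phi>. \<forall>w\<in>Y_space \<Omega> \<phi>. l (\<lambda>x. v x + w x) = l v + l w) \<and>
     (\<forall>c. \<forall>v\<in>Y_space \<Omega> \<phi>. l (\<lambda>x. c *\<^sub>R v x) = c * l v) \<and>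
     (\<exists>C. \<forall>v\<in>Y_space \<Omega> \<phi>. \<bar>l v\<bar> \<le> C * luxemburg_norm \<Omega> (\<lambda>x t. ereal (\<phi> x t)) v)}"

text \<open>The element of the dual with which \<open>p\<close> is identified.\<close>

definition pairing ::
  "'a::euclidean_space set \<Rightarrow> ('a \<Rightarrow> 'a) \<Rightarrow> ('a \<Rightarrow> 'a) \<Rightarrow> real" where
  "pairing \<Omega> p v = (LINT x|lebesgue_on \<Omega>. p x \<bullet> v x)"


section \<open>Fenchel duality\<close>

definition fenchel_conj :: "'u set \<Rightarrow> ('u \<Rightarrow> ereal) \<Rightarrow> ('u \<Rightarrow> real) \<Rightarrow> ereal" where
  "fenchel_conj S F l = (SUP u\<in>S. ereal (l u) - F u)"

definition fenchel_dual_objective ::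
  "'u set \<Rightarrow> 'v set \<Rightarrow> ('u \<Rightarrow> 'v) \<Rightarrow> ('u \<Rightarrow> ereal) \<Rightarrow> ('v \<Rightarrow> ereal) \<Rightarrow> ('v \<Rightarrow> real) \<Rightarrow> ereal" where
  "fenchel_dual_objective X Y A F G l =
     - fenchel_conj X F (\<lambda>u. - l (A u)) - fenchel_conj Y G l"

definition F0 :: "'a::euclidean_space set \<Rightarrow> ('a \<Rightarrow> real) \<Rightarrow> ('a \<Rightarrow> real) \<Rightarrow> ereal" where
  "F0 \<Omega> f u = ereal (1 / 2 * (L2_norm \<Omega> (\<lambda>x. u x - f x))\<^sup>2)"

definition G_fun :: "'a::euclidean_space set \<Rightarrow> ('a \<Rightarrow> real \<Rightarrow> real) \<Rightarrow> ('a \<Rightarrow> 'a) \<Rightarrow> ereal" where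
  "G_fun \<Omega> \<phi> v = enn2ereal (modular \<Omega> (\<lambda>x t. ereal (\<phi> x t)) v)"

definition K_set :: "'a::euclidean_space set \<Rightarrow> ('a \<Rightarrow> real \<Rightarrow> real) \<Rightarrow> ('a \<Rightarrow> 'a) set" where
  "K_set \<Omega> \<phi> = {p \<in> MO_space \<Omega> (conj_fun \<phi>).
     (\<exists>h. has_L2_divergence \<Omega> p h) \<and>
     (\<forall>u\<in>X_space \<Omega> \<phi>. (LINT x|lebesgue_on \<Omega>. p x \<bullet> weak_grad \<Omega> u x) =
        - (LINT x|lebesgue_on \<Omega>. divergence \<Omega> p x * u x))}"

definition dual_functional ::
  "'a::euclidean_space set \<Rightarrow> ('a \<Rightarrow> real \<Rightarrow> real) \<Rightarrow> ('a \<Rightarrow> real) \<Rightarrow> ('a \<Rightarrow> 'a) \<Rightarrow> ereal" where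
  "dual_functional \<Omega> \<phi> f p =
     ereal (- 1 / 2 * (L2_norm \<Omega> (divergence \<Omega> p))\<^sup>2
            - (LINT x|lebesgue_on \<Omega>. f x * divergence \<Omega> p x))
     - enn2ereal (modular \<Omega> (conj_fun \<phi>) p)"

end

theory Submission
  imports Defs
begin

text \<open>The conjugate of \<open>G\<close> is the modular of the conjugate function: a pointwise maximiser over finitely
  many dyadic numbers is measurable, and monotone convergence does the rest. The conjugate of
  \<open>F\<^sub>0\<close> at \<open>-A\<^sup>*p\<close> is finite iff \<open>u \<mapsto> \<integral> p \<bullet> \<nabla>u\<close> is bounded in \<open>L\<^sup>2\<close>, and then \<open>div p\<close> is its Riesz
  representative; density of \<open>X\<close> in \<open>L\<^sup>2\<close> gives the value.

  A maximizer is found by the direct method, without the duality theorem or weak compactness. Along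
  a maximizing sequence the divergences are Cauchy in \<open>L\<^sup>2\<close> by the parallelogram law. Among the almost
  maximizing \<open>p\<close> one takes those that almost minimise the strictly convex functional
  \<open>\<integral> sqrt (1 + |p|\<^sup>2)\<close>; these are Cauchy in measure, so that a subsequence converges almost
  everywhere. Fatou's lemma and Young's inequality, with the doubling condition, show that the limit
  is admissible and optimal.\<close>

subsection \<open>Square integrable functions\<close>

text \<open>The conjugate function need not satisfy a doubling condition: a bound on the modular of
  \<open>p\<close> says nothing about larger multiples of \<open>p\<close>, and convergence almost
  everywhere with bounded modulars does not give convergence in norm. It is enough, however, to pass
  to the limit in the pairing with one fixed field \<open>v\<close>. There the doubling of \<phi>
  helps: the modular of \<open>v / \<epsilon>\<close> is finite for every \<epsilon> > 0, so Young's
  inequality leaves an error of \<epsilon> times a bounded modular. The conjugate need not be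
  strictly convex either, so near-maximizers may oscillate among many fields, and nothing in the
  dual objective makes them converge pointwise. The auxiliary functional breaks the ties. It has
  linear growth, so that \<open>norm (p x) \<le> \<phi> x 1 + young_conj (\<phi> x) (norm (p
  x))\<close> makes it finite and uniformly bounded on the near-maximizers. Convexity and continuity
  of \<open>\<phi> x\<close> hold only for almost every x; completeness of the measure keeps all
  functions built from them measurable.\<close>

lemma complete_measure_lebesgue_on:
  assumes "\<Omega> \<in> sets lebesgue"
  shows "complete_measure (lebesgue_on \<Omega>)"
proof
  fix A B :: "'a set" assume "B \<subseteq> A" "A \<in> null_sets (lebesgue_on \<Omega>)"
  then have "A \<in> null_sets lebesgue" "A \<subseteq> \<Omega>"
    using null_sets_restrict_space[OF assms] by auto
  with \<open>B \<subseteq> A\<close> have "B \<in> null_sets lebesgue" "B \<subseteq> \<Omega>"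
    by (auto intro: completion.complete2)
  then show "B \<in> sets (lebesgue_on \<Omega>)"
    using assms by (auto simp: sets_restrict_space_iff null_setsD2)
qed

text \<open>The properties of \<open>\<phi> x\<close> hold almost everywhere, so functions built
  from \<phi> agree with limits of measurable functions only off a null set; completeness carries
  measurability across.\<close>

lemma (in complete_measure) borel_measurable_cong_AE:
  assumes f: "f \<in> borel_measurable M" and ae: "AE x in M. f x = g x"
  shows "g \<in> borel_measurable M"
proof (rule measurableI)
  fix A :: "'b set" assume A: "A \<in> sets borel"
  have "AE x in M. x \<in> f -` A \<inter> space M \<longleftrightarrow> x \<in> g -` A \<inter> space M"
    using ae by eventually_elim auto
  then show "g -` A \<inter> space M \<in> sets M"
    by (rule in_sets_AE) (use f A in \<open>auto intro: measurable_sets\<close>)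
qed auto

section \<open>Convergence in measure and convergence almost everywhere\<close>

lemma integrable_min_1_norm:
  assumes "finite_measure M" "(u :: 'a \<Rightarrow> 'b::{banach, second_countable_topology}) \<in> borel_measurable M"
  shows "integrable M (\<lambda>x. min 1 (norm (u x)))"
proof -
  interpret finite_measure M by fact
  show ?thesis using assms(2) by (intro integrable_const_bound[where B=1]) auto
qed

text \<open>The integral of \<open>min 1 (norm (u - v))\<close> metrizes convergence in measure.
  Along a subsequence whose increments are below \<open>(1/2)^k\<close> the sum of the truncated
  increments has finite integral, hence is finite almost everywhere, and the subsequence telescopes
  into an absolutely convergent series.\<close>

lemma AE_convergent_subsequence:
  fixes u :: "nat \<Rightarrow> 'a \<Rightarrow> 'b::{banach, second_countable_topology}"
  assumes fin: "finite_measure M" and u[measurable]: "\<And>n. u n \<in> borel_measurable M"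
    and Cau: "\<And>e. e > 0 \<Longrightarrow> \<exists>N. \<forall>n\<ge>N. \<forall>m\<ge>N. (LINT x|M. min 1 (norm (u n x - u m x))) < e"
  obtains r w where "strict_mono r" "w \<in> borel_measurable M"
    "AE x in M. (\<lambda>n. u (r n) x) \<longlonglongrightarrow> w x"
proof -
  have "\<exists>N. \<forall>k. \<forall>n\<ge>N k. \<forall>m\<ge>N k. (LINT x|M. min 1 (norm (u n x - u m x))) < (1/2)^k"
    by (intro choice allI Cau) auto
  then obtain N where N: "\<And>k n m. n \<ge> N k \<Longrightarrow> m \<ge> N k \<Longrightarrow>
      (LINT x|M. min 1 (norm (u n x - u m x))) < (1/2)^k" by blast
  \<comment> \<open>The sum dominates \<open>N k\<close>; the summand \<open>k\<close> makes
    \<open>r\<close> strictly increasing.\<close>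
  define r where "r k = k + (\<Sum>i\<le>k. N i)" for k
  have r: "strict_mono r"
    by (rule strict_monoI_Suc) (simp add: r_def)
  have rN: "N k \<le> r k" for k
  proof -
    have "N k \<le> (\<Sum>i\<le>k. N i)" by (rule member_le_sum) auto
    then show ?thesis by (simp add: r_def)
  qed
  define d where "d k x = min 1 (norm (u (r (Suc k)) x - u (r k) x))" for k x
  have [measurable]: "d k \<in> borel_measurable M" for k unfolding d_def by measurable
  have d0: "d k x \<ge> 0" for k x by (simp add: d_def)
  have dint: "(\<integral>\<^sup>+x. ennreal (d k x) \<partial>M) \<le> ennreal ((1/2)^k)" for k
  proof -
    have "integrable M (d k)"
      unfolding d_def by (intro integrable_min_1_norm fin) simp
    moreover have "(LINT x|M. d k x) < (1/2)^k"
      unfolding d_def using rN[of k] r by (intro N) (auto simp: strict_mono_Suc_iff intro: order_trans less_imp_le)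
    ultimately show ?thesis
      using d0 by (subst nn_integral_eq_integral) (auto intro!: ennreal_leI)
  qed
  have "(\<integral>\<^sup>+x. (\<Sum>k. ennreal (d k x)) \<partial>M) = (\<Sum>k. \<integral>\<^sup>+x. ennreal (d k x) \<partial>M)"
    by (rule nn_integral_suminf) simp
  also have "\<dots> \<le> (\<Sum>k. ennreal ((1/2)^k))"
    by (intro suminf_le dint) auto
  also have "\<dots> = ennreal (\<Sum>k. (1/2)^k)"
    by (rule suminf_ennreal2) auto
  also have "\<dots> < \<infinity>" by simp
  finally have "AE x in M. (\<Sum>k. ennreal (d k x)) \<noteq> \<infinity>"
    by (intro nn_integral_PInf_AE) auto
  then have conv: "AE x in M. convergent (\<lambda>n. u (r n) x)"
  proof eventually_elim
    case (elim x)
    then have s: "summable (\<lambda>k. d k x)"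
      using d0 by (intro summable_suminf_not_top) auto
    then have "(\<lambda>k. d k x) \<longlonglongrightarrow> 0" by (rule summable_LIMSEQ_zero)
    \<comment> \<open>Below 1 the truncation in \<open>d\<close> is inactive, so \<open>d\<close>
      controls the true increments.\<close>
    then have "\<forall>\<^sub>F k in sequentially. d k x < 1" by (rule order_tendstoD) simp
    then have ev: "\<forall>\<^sub>F k in sequentially. norm (u (r (Suc k)) x - u (r k) x) \<le> d k x"
      by eventually_elim (auto simp: d_def min_def split: if_splits)
    have "summable (\<lambda>k. u (r (Suc k)) x - u (r k) x)"
      by (rule summable_comparison_test_ev[OF ev s])
    then have "convergent (\<lambda>n. \<Sum>k<n. u (r (Suc k)) x - u (r k) x)"
      by (simp add: summable_iff_convergent)
    then have "convergent (\<lambda>n. u (r n) x - u (r 0) x)"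
      by (simp add: sum_lessThan_telescope[of "\<lambda>k. u (r k) x"])
    then obtain l where "(\<lambda>n. u (r n) x - u (r 0) x) \<longlonglongrightarrow> l" by (auto simp: convergent_def)
    from tendsto_add[OF this tendsto_const[of "u (r 0) x"]] show ?case
      by (auto simp: convergent_def)
  qed
  show thesis
  proof
    show "(\<lambda>x. lim (\<lambda>n. u (r n) x)) \<in> borel_measurable M" by measurable
    show "AE x in M. (\<lambda>n. u (r n) x) \<longlonglongrightarrow> lim (\<lambda>n. u (r n) x)"
      using conv by eventually_elim (simp add: convergent_LIMSEQ_iff)
  qed fact
qed

section \<open>Completeness and Riesz representation for square integrable functions\<close>

definition sqint :: "'a measure \<Rightarrow> ('a \<Rightarrow> real) set" where
  "sqint M = {u \<in> borel_measurable M. integrable M (\<lambda>x. (u x)\<^sup>2)}"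

lemma L2_eq_sqint: "L2 \<Omega> = sqint (lebesgue_on \<Omega>)"
  by (simp add: L2_def sqint_def)

lemma sqint_measurable[measurable_dest]: "u \<in> sqint M \<Longrightarrow> u \<in> borel_measurable M"
  and sqint_integrable: "u \<in> sqint M \<Longrightarrow> integrable M (\<lambda>x. (u x)\<^sup>2)"
  by (auto simp: sqint_def)

lemma sqint_mult_integrable:
  assumes "u \<in> sqint M" "v \<in> sqint M"
  shows "integrable M (\<lambda>x. u x * v x)"
proof (rule Bochner_Integration.integrable_bound)
  show "integrable M (\<lambda>x. (u x)\<^sup>2 + (v x)\<^sup>2)"
    using assms by (intro Bochner_Integration.integrable_add sqint_integrable)
  show "(\<lambda>x. u x * v x) \<in> borel_measurable M"
    using assms by (auto dest!: sqint_measurable)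
  have "\<bar>a * b\<bar> \<le> a\<^sup>2 + b\<^sup>2" for a b :: real
  proof -
    have "2 * (\<bar>a\<bar> * \<bar>b\<bar>) \<le> a\<^sup>2 + b\<^sup>2"
      using sum_squares_bound[of "\<bar>a\<bar>" "\<bar>b\<bar>"] by simp
    moreover have "0 \<le> \<bar>a\<bar> * \<bar>b\<bar>" by simp
    ultimately show ?thesis unfolding abs_mult by linarith
  qed
  then show "AE x in M. norm (u x * v x) \<le> norm ((u x)\<^sup>2 + (v x)\<^sup>2)" by simp
qed

lemma sqint_add_scale:
  assumes "u \<in> sqint M" "v \<in> sqint M"
  shows "(\<lambda>x. u x + c * v x) \<in> sqint M"
proof -
  have "(\<lambda>x. (u x + c * v x)\<^sup>2) = (\<lambda>x. (u x)\<^sup>2 + 2 * c * (u x * v x) + c\<^sup>2 * (v x)\<^sup>2)"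
    by (auto simp: power2_eq_square algebra_simps)
  then show ?thesis
    using assms sqint_mult_integrable[OF assms] by (auto simp: sqint_def)
qed

lemma sqint_0: "(\<lambda>_. 0) \<in> sqint M"
  by (simp add: sqint_def)

lemma sqint_scale: "v \<in> sqint M \<Longrightarrow> (\<lambda>x. c * v x) \<in> sqint M"
  using sqint_add_scale[OF sqint_0] by simp

lemma sqint_add: "u \<in> sqint M \<Longrightarrow> v \<in> sqint M \<Longrightarrow> (\<lambda>x. u x + v x) \<in> sqint M"
  using sqint_add_scale[of u M v 1] by simp

lemma sqint_diff: "u \<in> sqint M \<Longrightarrow> v \<in> sqint M \<Longrightarrow> (\<lambda>x. u x - v x) \<in> sqint M"
  using sqint_add_scale[of u M v "-1"] by simp

lemma sqint_imp_integrable: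
  assumes "finite_measure M" "u \<in> sqint M" shows "integrable M u"
proof -
  interpret finite_measure M by fact
  have "(\<lambda>_. 1) \<in> sqint M" by (simp add: sqint_def)
  from sqint_mult_integrable[OF assms(2) this] show ?thesis by simp
qed

lemma integral_square_add_scale:
  assumes "u \<in> sqint M" "v \<in> sqint M"
  shows "(LINT x|M. (u x + c * v x)\<^sup>2) =
    (LINT x|M. (u x)\<^sup>2) + 2 * c * (LINT x|M. u x * v x) + c\<^sup>2 * (LINT x|M. (v x)\<^sup>2)"
proof -
  have "(\<lambda>x. (u x + c * v x)\<^sup>2) = (\<lambda>x. (u x)\<^sup>2 + 2 * c * (u x * v x) + c\<^sup>2 * (v x)\<^sup>2)"
    by (auto simp: power2_eq_square algebra_simps)
  then show ?thesis
    using assms sqint_mult_integrable[OF assms] by (simp add: sqint_integrable)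
qed

lemma integral_Cauchy_Schwarz:
  assumes "u \<in> sqint M" "v \<in> sqint M"
  shows "\<bar>LINT x|M. u x * v x\<bar> \<le> sqrt (LINT x|M. (u x)\<^sup>2) * sqrt (LINT x|M. (v x)\<^sup>2)"
proof -
  define A B C where "A = (LINT x|M. (v x)\<^sup>2)" and "B = (LINT x|M. u x * v x)"
    and "C = (LINT x|M. (u x)\<^sup>2)"
  have q: "C + 2 * c * B + c\<^sup>2 * A \<ge> 0" for c
    unfolding A_def B_def C_def integral_square_add_scale[OF assms, symmetric]
    by simp
  have A: "A \<ge> 0" by (simp add: A_def)
  have "B\<^sup>2 \<le> C * A"
  proof (cases "A = 0")
    case True
    have "B = 0"
    proof (rule ccontr)
      assume "B \<noteq> 0"
      \<comment> \<open>For A = 0 the quadratic is linear in c, and this c gives it the value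
        -1.\<close>
      then show False using q[of "- (C + 1) / (2 * B)"] True by (simp add: field_simps)
    qed
    then show ?thesis using True by simp
  next
    case False
    \<comment> \<open>The minimiser of the quadratic.\<close>
    then show ?thesis using q[of "- B / A"] A
      by (simp add: field_simps power2_eq_square)
  qed
  then have "sqrt (B\<^sup>2) \<le> sqrt (C * A)" by (rule real_sqrt_le_mono)
  then show ?thesis by (simp add: A_def B_def C_def real_sqrt_mult)
qed

text \<open>By Cauchy-Schwarz against the constant 1 the sequence is Cauchy in measure, so a
  subsequence has an almost everywhere limit \<open>w\<close>. Fatou's lemma in one of the two
  indices of the Cauchy condition then shows that the whole sequence tends to \<open>w\<close> in
  mean square.\<close>

lemma sqint_complete:
  fixes u :: "nat \<Rightarrow> 'a \<Rightarrow> real"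
  assumes fin: "finite_measure M" and u: "\<And>n. u n \<in> sqint M"
    and Cau: "\<And>e. e > 0 \<Longrightarrow> \<exists>N. \<forall>n\<ge>N. \<forall>m\<ge>N. (LINT x|M. (u n x - u m x)\<^sup>2) < e"
  obtains w where "w \<in> sqint M" "(\<lambda>n. LINT x|M. (u n x - w x)\<^sup>2) \<longlonglongrightarrow> 0"
proof -
  interpret finite_measure M by fact
  have um[measurable]: "u n \<in> borel_measurable M" for n using u by measurable
  have "\<exists>N. \<forall>n\<ge>N. \<forall>m\<ge>N. (LINT x|M. min 1 (norm (u n x - u m x))) < e" if "e > 0" for e
  proof -
    \<comment> \<open>The summand 1 keeps the divisor positive when the whole space is null.\<close>
    define \<mu> where "\<mu> = measure M (space M) + 1"
    have \<mu>: "\<mu> > 0" by (simp add: \<mu>_def add_nonneg_pos)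
    have "e\<^sup>2 / \<mu> > 0" using that \<mu> by simp
    from Cau[OF this] obtain N where N: "\<And>n m. n \<ge> N \<Longrightarrow> m \<ge> N \<Longrightarrow>
        (LINT x|M. (u n x - u m x)\<^sup>2) < e\<^sup>2 / \<mu>" by blast
    show ?thesis
    proof (intro exI allI impI)
      fix n m assume nm: "N \<le> n" "N \<le> m"
      define g where "g = (\<lambda>x. u n x - u m x)"
      have g: "g \<in> sqint M"
        unfolding g_def by (intro sqint_diff u)
      then have g': "(\<lambda>x. \<bar>g x\<bar>) \<in> sqint M"
 by (auto simp: sqint_def intro: borel_measurable_abs)
      have 1: "(\<lambda>_. 1) \<in> sqint M" by (simp add: sqint_def)
      have "(LINT x|M. min 1 (norm (g x))) \<le> (LINT x|M. \<bar>g x\<bar> * 1)"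
        using g g' by (intro integral_mono integrable_min_1_norm fin sqint_mult_integrable[OF _ 1])
          (auto dest: sqint_measurable)
      also have "\<dots> \<le> sqrt (LINT x|M. (\<bar>g x\<bar>)\<^sup>2) * sqrt (LINT x|M. 1\<^sup>2)"
        using integral_Cauchy_Schwarz[OF g' 1] by linarith
      also have "\<dots> = sqrt ((LINT x|M. (g x)\<^sup>2) * measure M (space M))"
        by (simp add: real_sqrt_mult)
      also have "\<dots> < sqrt (e\<^sup>2)"
      proof (rule real_sqrt_less_mono)
        have "(LINT x|M. (g x)\<^sup>2) * measure M (space M) \<le> (LINT x|M. (g x)\<^sup>2) * \<mu>"
          by (intro mult_left_mono) (auto simp: \<mu>_def)
        also have "\<dots> < e\<^sup>2 / \<mu> * \<mu>"
          using N[OF nm] \<mu> unfolding g_def by (intro mult_strict_right_mono)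
        finally show "(LINT x|M. (g x)\<^sup>2) * measure M (space M) < e\<^sup>2" using \<mu> by simp
      qed
      finally show "(LINT x|M. min 1 (norm (u n x - u m x))) < e"
        using that by (simp add: g_def)
    qed
  qed
  then obtain r w where r: "strict_mono r" and w[measurable]: "w \<in> borel_measurable M"
    and lim: "AE x in M. (\<lambda>n. u (r n) x) \<longlonglongrightarrow> w x"
    using AE_convergent_subsequence[where u=u, OF fin um] by blast
  have tail: "\<exists>N. \<forall>n\<ge>N. (\<integral>\<^sup>+x. ennreal ((u n x - w x)\<^sup>2) \<partial>M) \<le> ennreal e" if e: "e > 0" for e
  proof -
    from Cau[OF e] obtain N where N: "\<And>n m. n \<ge> N \<Longrightarrow> m \<ge> N \<Longrightarrow>
        (LINT x|M. (u n x - u m x)\<^sup>2) < e" by blast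
    have "(\<integral>\<^sup>+x. ennreal ((u n x - w x)\<^sup>2) \<partial>M) \<le> ennreal e" if n: "n \<ge> N" for n
    proof -
      have "(\<integral>\<^sup>+x. ennreal ((u n x - w x)\<^sup>2) \<partial>M) =
          (\<integral>\<^sup>+x. liminf (\<lambda>k. ennreal ((u n x - u (r k) x)\<^sup>2)) \<partial>M)"
      proof (rule nn_integral_cong_AE, use lim in eventually_elim)
        case (elim x)
        then have "(\<lambda>k. ennreal ((u n x - u (r k) x)\<^sup>2)) \<longlonglongrightarrow> ennreal ((u n x - w x)\<^sup>2)"
          by (intro tendsto_intros)
        then show ?case by (intro lim_imp_Liminf[symmetric]) auto
      qed
      also have "\<dots> \<le> liminf (\<lambda>k. \<integral>\<^sup>+x. ennreal ((u n x - u (r k) x)\<^sup>2) \<partial>M)"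
        by (rule nn_integral_liminf) measurable
      also have "\<dots> \<le> ennreal e"
      proof (rule Liminf_le)
        have "\<forall>\<^sub>F k in sequentially. k \<ge> N" by (rule eventually_ge_at_top)
        then show "\<forall>\<^sub>F k in sequentially. (\<integral>\<^sup>+x. ennreal ((u n x - u (r k) x)\<^sup>2) \<partial>M) \<le> ennreal e"
        proof eventually_elim
          case (elim k)
          then have "r k \<ge> N" using seq_suble[OF r, of k] by linarith
          then show ?case
            using N[OF n, of "r k"] sqint_integrable[OF sqint_diff[OF u[of n] u[of "r k"]]]
            by (subst nn_integral_eq_integral) (auto intro!: ennreal_leI)
        qed
      qed simp
      finally show ?thesis .
    qed
    then show ?thesis by blast
  qed
  from tail[of 1] obtain n where n: "(\<integral>\<^sup>+x. ennreal ((u n x - w x)\<^sup>2) \<partial>M) \<le> ennreal 1" by auto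
  have "(\<lambda>x. u n x - w x) \<in> sqint M"
  proof -
    have "(\<integral>\<^sup>+x. ennreal ((u n x - w x)\<^sup>2) \<partial>M) < \<infinity>"
      using n by (rule le_less_trans) simp
    then show ?thesis unfolding sqint_def
      by (auto intro!: integrableI_nonneg)
  qed
  from sqint_diff[OF u[of n] this] have ws: "w \<in> sqint M" by simp
  show thesis
  proof (rule that[OF ws], rule LIMSEQ_I)
    fix e :: real assume "e > 0"
    then obtain N where N: "\<And>n. n \<ge> N \<Longrightarrow> (\<integral>\<^sup>+x. ennreal ((u n x - w x)\<^sup>2) \<partial>M) \<le> ennreal (e/2)"
      using tail[of "e/2"] by auto
    show "\<exists>N. \<forall>n\<ge>N. norm ((LINT x|M. (u n x - w x)\<^sup>2) - 0) < e"
    proof (intro exI allI impI)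
      fix n assume "n \<ge> N"
      from N[OF this] have "ennreal (LINT x|M. (u n x - w x)\<^sup>2) \<le> ennreal (e/2)"
        using sqint_integrable[OF sqint_diff[OF u[of n] ws]]
        by (subst (asm) nn_integral_eq_integral) auto
      then show "norm ((LINT x|M. (u n x - w x)\<^sup>2) - 0) < e"
        using \<open>e > 0\<close> by simp
    qed
  qed
qed

lemma tendsto_integral_mult_sqint:
  assumes u: "\<And>n. u n \<in> sqint M" and w: "w \<in> sqint M" and v: "v \<in> sqint M"
    and lim: "(\<lambda>n. LINT x|M. (u n x - w x)\<^sup>2) \<longlonglongrightarrow> 0"
  shows "(\<lambda>n. LINT x|M. u n x * v x) \<longlonglongrightarrow> (LINT x|M. w x * v x)"
proof -
  have "(\<lambda>n. (LINT x|M. u n x * v x) - (LINT x|M. w x * v x)) \<longlonglongrightarrow> 0"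
  proof (rule Lim_null_comparison)
    have "(LINT x|M. u n x * v x) - (LINT x|M. w x * v x) = (LINT x|M. (u n x - w x) * v x)" for n
      using sqint_mult_integrable[OF u[of n] v] sqint_mult_integrable[OF w v]
      by (simp add: left_diff_distrib)
    then show "\<forall>\<^sub>F n in sequentially. norm ((LINT x|M. u n x * v x) - (LINT x|M. w x * v x)) \<le>
        sqrt (LINT x|M. (u n x - w x)\<^sup>2) * sqrt (LINT x|M. (v x)\<^sup>2)"
      using integral_Cauchy_Schwarz[OF sqint_diff[OF u w] v] by simp
    show "(\<lambda>n. sqrt (LINT x|M. (u n x - w x)\<^sup>2) * sqrt (LINT x|M. (v x)\<^sup>2)) \<longlonglongrightarrow> 0"
      using tendsto_mult_left_zero[OF tendsto_real_sqrt[OF lim, simplified]] by simp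
  qed
  then show ?thesis by (simp add: LIM_zero_iff)
qed

lemma tendsto_integral_square:
  assumes u: "\<And>n. u n \<in> sqint M" and w: "w \<in> sqint M"
    and lim: "(\<lambda>n. LINT x|M. (u n x - w x)\<^sup>2) \<longlonglongrightarrow> 0"
  shows "(\<lambda>n. LINT x|M. (u n x)\<^sup>2) \<longlonglongrightarrow> (LINT x|M. (w x)\<^sup>2)"
proof -
  have eq: "(LINT x|M. (u n x)\<^sup>2) = (LINT x|M. (u n x - w x)\<^sup>2) + 2 * (LINT x|M. u n x * w x) - (LINT x|M. (w x)\<^sup>2)" for n
    using integral_square_add_scale[OF u[of n] w, of "-1"] by simp
  have "(\<lambda>n. (LINT x|M. (u n x - w x)\<^sup>2) + 2 * (LINT x|M. u n x * w x) - (LINT x|M. (w x)\<^sup>2))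
      \<longlonglongrightarrow> 0 + 2 * (LINT x|M. w x * w x) - (LINT x|M. (w x)\<^sup>2)"
    by (intro tendsto_intros lim tendsto_integral_mult_sqint u w)
  then show ?thesis unfolding eq by (simp add: power2_eq_square)
qed

text \<open>The energy \<open>E\<close> is minimised over a subspace that need not be closed, so the
  limit \<open>h\<close> of a minimising sequence may lie outside \<open>S\<close>. The one-sided
  bound \<open>bdd\<close> takes the place of continuity of \<open>L\<close>. The sequence is
  returned as well, since \<open>X_dense\<close> derives density from it.\<close>

lemma riesz_on_subspace:
  fixes L :: "('a \<Rightarrow> real) \<Rightarrow> real"
  assumes fin: "finite_measure M" and S: "S \<subseteq> sqint M" "S \<noteq> {}"
    and sub: "\<And>u v c. u \<in> S \<Longrightarrow> v \<in> S \<Longrightarrow> (\<lambda>x. u x + c * v x) \<in> S"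
    and lin: "\<And>u v c. u \<in> S \<Longrightarrow> v \<in> S \<Longrightarrow> L (\<lambda>x. u x + c * v x) = L u + c * L v"
    and bdd: "\<And>u. u \<in> S \<Longrightarrow> L u - 1/2 * (LINT x|M. (u x)\<^sup>2) \<le> B"
  obtains h u where "h \<in> sqint M" "\<And>n. u n \<in> S" "(\<lambda>n. LINT x|M. (u n x - h x)\<^sup>2) \<longlonglongrightarrow> 0"
    "\<And>v. v \<in> S \<Longrightarrow> L v = (LINT x|M. h x * v x)"
proof -
  define E where "E u = 1/2 * (LINT x|M. (u x)\<^sup>2) - L u" for u
  define m where "m = Inf (E ` S)"
  have below: "bdd_below (E ` S)"
    using bdd by (intro bdd_belowI2[of _ "-B"]) (fastforce simp: E_def)
  have m: "m \<le> E v" if "v \<in> S" for v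
    unfolding m_def using below that by (rule cINF_lower)
  have "\<exists>v\<in>S. E v < m + 1 / real (Suc n)" for n
  proof -
    have "Inf (E ` S) < m + 1 / real (Suc n)" by (simp add: m_def)
    then show ?thesis using S(2) below by (subst (asm) cInf_less_iff) auto
  qed
  then obtain u where u: "\<And>n. u n \<in> S" and uE: "\<And>n. E (u n) < m + 1 / real (Suc n)" by metis
  have us: "u n \<in> sqint M" for n using u S by blast
  have exp: "E (\<lambda>x. w x + c * v x) = E w + c * ((LINT x|M. w x * v x) - L v) + c\<^sup>2/2 * (LINT x|M. (v x)\<^sup>2)"
    if "w \<in> S" "v \<in> S" for w v c
    using that S unfolding E_def by (subst integral_square_add_scale) (auto simp: lin algebra_simps)
  \<comment> \<open>The midpoint of \<open>w\<close> and \<open>v\<close> still has energy at least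
    \<open>m\<close>. It is written as \<open>v\<close> plus half of \<open>w - v\<close>, so that
    the expansion \<open>exp\<close> along a line serves twice: with c = 1/2 for the midpoint and
    with c = 1 for the endpoint \<open>w\<close>.\<close>
  have gap: "(LINT x|M. (w x - v x)\<^sup>2) \<le> 4 * (E w - m) + 4 * (E v - m)" if wv: "w \<in> S" "v \<in> S" for w v
  proof -
    define I where "I = (LINT x|M. (w x + (-1) * v x)\<^sup>2)"
    have d: "(\<lambda>x. w x + (-1) * v x) \<in> S" using wv by (rule sub)
    have "m \<le> E (\<lambda>x. v x + (1/2) * (w x + (-1) * v x))" using wv d by (intro m sub)
    also have "\<dots> = E v + 1/2 * ((LINT x|M. v x * (w x + (-1) * v x)) - L (\<lambda>x. w x + (-1) * v x))
        + 1/8 * (LINT x|M. (w x + (-1) * v x)\<^sup>2)"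
      using exp[OF wv(2) d, of "1/2"] by (simp add: power2_eq_square)
    also have "(LINT x|M. v x * (w x + (-1) * v x)) - L (\<lambda>x. w x + (-1) * v x) =
       E w - E v - 1/2 * (LINT x|M. (w x + (-1) * v x)\<^sup>2)"
    proof -
      have "E (\<lambda>x. v x + 1 * (w x + (-1) * v x)) = E v + ((LINT x|M. v x * (w x + (-1) * v x)) - L (\<lambda>x. w x + (-1) * v x)) + 1/2 * (LINT x|M. (w x + (-1) * v x)\<^sup>2)"
        using exp[OF wv(2) d, of 1] by simp
      then show ?thesis by simp
    qed
    finally have "m \<le> E v + 1/2 * (E w - E v - 1/2 * I) + 1/8 * I"
      unfolding I_def by simp
    then have "I \<le> 4 * (E w - m) + 4 * (E v - m)" by argo
    then show ?thesis by (simp add: I_def)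
  qed
  have small: "\<exists>N. \<forall>n\<ge>N. \<forall>k\<ge>N. (LINT x|M. (u n x - u k x)\<^sup>2) < e" if "e > 0" for e
  proof -
    obtain N where N: "1 / real (Suc N) < e / 8" using \<open>e > 0\<close> nat_approx_posE[of "e/8"] by auto
    have tail: "E (u n) - m < e / 8" if "n \<ge> N" for n
    proof -
      have "1 / real (Suc n) \<le> 1 / real (Suc N)" using that by (simp add: frac_le)
      then show ?thesis using uE[of n] N by linarith
    qed
    show ?thesis
    proof (intro exI allI impI)
      fix n k assume nk: "N \<le> n" "N \<le> k"
      then show "(LINT x|M. (u n x - u k x)\<^sup>2) < e"
        using gap[OF u[of n] u[of k]] add_strict_mono[OF tail[OF nk(1)] tail[OF nk(2)]]
        by (simp add: algebra_simps)
    qed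
  qed
  obtain h where h: "h \<in> sqint M" and hlim: "(\<lambda>n. LINT x|M. (u n x - h x)\<^sup>2) \<longlonglongrightarrow> 0"
    using sqint_complete[OF fin us small] by blast
  show thesis
  proof (rule that[OF h u hlim])
    fix v assume v: "v \<in> S"
    then have vs: "v \<in> sqint M" using S by blast
    define a where "a = (LINT x|M. h x * v x) - L v"
    define b where "b = (LINT x|M. (v x)\<^sup>2)"
    \<comment> \<open>First-order optimality of \<open>h\<close>, as a limit of the inequalities
      \<open>m \<le> E (u n + c v)\<close> with \<open>E (u n)\<close> close to \<open>m\<close>.
      \<open>E h\<close> itself is no help, because nothing is known of \<open>L\<close> outside
      \<open>S\<close>.\<close>
    have pos: "c * a + c\<^sup>2/2 * b \<ge> 0" for c
    proof (rule LIMSEQ_le)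
      show "(\<lambda>n. - (1 / real (Suc n))) \<longlonglongrightarrow> 0"
        using tendsto_minus[OF LIMSEQ_inverse_real_of_nat] by (simp add: inverse_eq_divide)
      show "(\<lambda>n. c * ((LINT x|M. u n x * v x) - L v) + c\<^sup>2/2 * b) \<longlonglongrightarrow> c * a + c\<^sup>2/2 * b"
        unfolding a_def by (intro tendsto_intros tendsto_integral_mult_sqint us h vs hlim)
      have "- (1 / real (Suc n)) \<le> c * ((LINT x|M. u n x * v x) - L v) + c\<^sup>2/2 * b" for n
        using exp[OF u[of n] v, of c] m[OF sub[OF u[of n] v, of c]] uE[of n] unfolding b_def by linarith
      then show "\<exists>N. \<forall>n\<ge>N. - (1 / real (Suc n)) \<le> c * ((LINT x|M. u n x * v x) - L v) + c\<^sup>2/2 * b"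
        by blast
    qed
    have "a = 0"
    proof (rule ccontr)
      assume "a \<noteq> 0"
      have b: "b \<ge> 0" by (simp add: b_def)
      \<comment> \<open>The best c would be -a/b, but b may vanish; with b + 1 the value is still
        negative.\<close>
      have "(- a / (b + 1)) * a + (- a / (b + 1))\<^sup>2 / 2 * b = - a\<^sup>2 * (b + 2) / (2 * (b + 1)\<^sup>2)"
        using b by (simp add: divide_simps power2_eq_square) (simp add: algebra_simps)
      also have "\<dots> < 0" using b \<open>a \<noteq> 0\<close>
        by (intro divide_neg_pos mult_neg_pos) auto
      finally show False using pos[of "- a / (b + 1)"] by linarith
    qed
    then show "L v = (LINT x|M. h x * v x)" by (simp add: a_def)
  qed
qed

subsection \<open>Smooth functions\<close>

lemma pderivative_eq: "(f has_derivative D) (at x) \<Longrightarrow> pderivative e f x = D e"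
  unfolding pderivative_def by (simp add: frechet_derivative_at[symmetric])

lemma C_k_mono: "C_k (Suc k) f \<Longrightarrow> C_k k f"
proof (induction k arbitrary: f)
  case 0
  then show ?case
    by (auto intro!: continuous_at_imp_continuous_on differentiable_imp_continuous_within)
next
  case (Suc k)
  then show ?case by auto
qed

lemma C_k_add: "C_k k f \<Longrightarrow> C_k k g \<Longrightarrow> C_k k (\<lambda>x. f x + g x)"
proof (induction k arbitrary: f g)
  case 0
  then show ?case by (auto intro: continuous_intros)
next
  case (Suc k)
  have "pderivative e (\<lambda>x. f x + g x) = (\<lambda>x. pderivative e f x + pderivative e g x)" for e
  proof
    fix x
    have "(f has_derivative frechet_derivative f (at x)) (at x)"
      "(g has_derivative frechet_derivative g (at x)) (at x)"
      using Suc.prems by (auto simp: frechet_derivative_works[symmetric])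
    from pderivative_eq[OF has_derivative_add[OF this]]
    show "pderivative e (\<lambda>x. f x + g x) x = pderivative e f x + pderivative e g x"
      by (simp add: pderivative_def)
  qed
  then show ?case using Suc by (auto intro: differentiable_add)
qed

lemma pderivative_mult:
  assumes "f differentiable (at x)" "g differentiable (at x)"
  shows "pderivative e (\<lambda>x. f x * g x) x = pderivative e f x * g x + f x * pderivative e g x"
proof -
  have "(f has_derivative frechet_derivative f (at x)) (at x)"
    "(g has_derivative frechet_derivative g (at x)) (at x)"
    using assms by (auto simp: frechet_derivative_works[symmetric])
  from pderivative_eq[OF has_derivative_mult[OF this]]
  show ?thesis by (simp add: pderivative_def)
qed

lemma C_k_mult: "C_k k f \<Longrightarrow> C_k k g \<Longrightarrow> C_k k (\<lambda>x. f x * g x)"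
proof (induction k arbitrary: f g)
  case 0
  then show ?case by (auto intro: continuous_intros)
next
  case (Suc k)
  have "pderivative e (\<lambda>x. f x * g x) = (\<lambda>x. pderivative e f x * g x + f x * pderivative e g x)" for e
    using Suc.prems by (intro ext pderivative_mult) auto
  moreover have "C_k k (\<lambda>x. pderivative e f x * g x + f x * pderivative e g x)" if "e \<in> Basis" for e
    using Suc.prems that by (intro C_k_add Suc.IH C_k_mono[of k f] C_k_mono[of k g]) auto
  ultimately show ?case using Suc.prems by (auto intro: differentiable_mult)
qed

lemma C_k_const: "C_k k (\<lambda>_. c)"
proof (induction k arbitrary: c)
  case (Suc k)
  have "pderivative e (\<lambda>_. c) = (\<lambda>_. 0)" for e :: 'a
    by (rule ext, subst pderivative_eq[OF has_derivative_const]) simp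
  then show ?case using Suc by simp
qed simp

lemma C_k_prod:
  assumes "finite B" "\<And>b. b \<in> B \<Longrightarrow> C_k k (f b)"
  shows "C_k k (\<lambda>x. \<Prod>b\<in>B. f b x)"
  using assms by (induction B) (auto intro: C_k_const C_k_mult)

text \<open>The functions \<open>P(1/t) exp(-1/t)\<close>, extended by \<open>0\<close> to \<open>t \<le> 0\<close>, form a class that is closed
  under differentiation.\<close>

definition flat :: "real poly \<Rightarrow> real \<Rightarrow> real" where
  "flat P t = (if t > 0 then poly P (1/t) * exp (- (1/t)) else 0)"

text \<open>The factor \<open>y^k\<close> is for the induction: \<open>pCons\<close> multiplies the
  remaining polynomial by y, which raises k by one.\<close>

lemma power_poly_exp_tendsto_0:
  "((\<lambda>y. y^k * poly P y * exp (- y)) \<longlongrightarrow> (0::real)) at_top"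
proof (induction P arbitrary: k)
  case (pCons a P)
  have "((\<lambda>y. a * (y^k / exp y) + y^Suc k * poly P y * exp (- y)) \<longlongrightarrow> a * 0 + 0) at_top"
    by (intro tendsto_intros tendsto_power_div_exp_0 pCons.IH)
  then show ?case by (simp add: algebra_simps exp_minus divide_inverse)
qed simp

lemma flat_tendsto_0: "(flat P \<longlongrightarrow> 0) (at 0)"
proof (rule filterlim_split_at)
  show "(flat P \<longlongrightarrow> 0) (at_left 0)"
  proof (rule tendsto_eventually)
    show "\<forall>\<^sub>F t in at_left 0. flat P t = 0"
      by (auto simp: eventually_at_filter flat_def)
  qed
  have "((\<lambda>t. poly P (inverse t) * exp (- inverse t)) \<longlongrightarrow> 0) (at_right (0::real))"
    using filterlim_compose[OF power_poly_exp_tendsto_0[of 0 P] filterlim_inverse_at_top_right]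
    by simp
  then show "(flat P \<longlongrightarrow> 0) (at_right 0)"
    by (rule Lim_transform_eventually)
      (auto simp: eventually_at_filter flat_def inverse_eq_divide)
qed

text \<open>With y = 1/t one has dy/dt = -y^2, so the derivative of P(y) exp(-y) in t is y^2 (P(y) -
  P'(y)) exp(-y).\<close>

definition flat_deriv :: "real poly \<Rightarrow> real poly" where
  "flat_deriv P = [:0, 0, 1:] * (P - pderiv P)"

lemma flat_has_derivative: "(flat P has_real_derivative flat (flat_deriv P) t) (at t)"
proof (cases t "0 :: real" rule: linorder_cases)
  case less
  have "((\<lambda>_. 0) has_real_derivative 0) (at t)" by simp
  then have "(flat P has_real_derivative 0) (at t)"
    by (rule has_field_derivative_transform_within_open[of _ _ _ "{..<0}"])
      (use less in \<open>auto simp: flat_def\<close>)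
  then show ?thesis using less by (simp add: flat_def)
next
  case greater
  have "((\<lambda>t. poly P (1/t) * exp (- (1/t))) has_real_derivative flat (flat_deriv P) t) (at t)"
    using greater
    by (auto intro!: derivative_eq_intros DERIV_chain2[OF poly_DERIV] simp: flat_def flat_deriv_def power2_eq_square)
      (simp add: field_simps)
  then show ?thesis
    by (rule has_field_derivative_transform_within_open[of _ _ _ "{0<..}"])
      (use greater in \<open>auto simp: flat_def\<close>)
next
  case equal
  \<comment> \<open>The difference quotient at 0 is again a function of the class, with the
    polynomial multiplied by y = 1/h; hence it tends to 0.\<close>
  have "flat P h / h = flat (pCons 0 P) h" for h
    by (simp add: flat_def)
  then have "((\<lambda>h. (flat P (0 + h) - flat P 0) / h) \<longlongrightarrow> 0) (at 0)"
    using flat_tendsto_0[of "pCons 0 P"] by (simp add: flat_def[of P 0])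
  then show ?thesis
    using equal by (simp add: DERIV_def flat_def[of _ 0])
qed

lemma C_k_flat_affine: "C_k k (\<lambda>x::'a::euclidean_space. flat P (c * (x \<bullet> b) + d))"
proof (induction k arbitrary: P)
  case 0
  have "isCont (flat P) t" for t using flat_has_derivative by (rule DERIV_isCont)
  then have "continuous_on UNIV (flat P)" by (simp add: continuous_at_imp_continuous_on)
  then have "continuous_on UNIV (\<lambda>x. flat P (c * (x \<bullet> b) + d))"
    by (rule continuous_on_compose2) (auto intro!: continuous_intros)
  then show ?case by simp
next
  case (Suc k)
  have D: "((\<lambda>x. flat P (c * (x \<bullet> b) + d)) has_derivative
      (\<lambda>h. (c * (h \<bullet> b)) * flat (flat_deriv P) (c * (x \<bullet> b) + d))) (at x)" for x
    by (rule has_derivative_eq_rhs,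
        rule has_derivative_compose[of "\<lambda>x. c * (x \<bullet> b) + d" "\<lambda>h. c * (h \<bullet> b)" x UNIV "flat P",
          OF _ flat_has_derivative[unfolded has_field_derivative_def]])
      (auto intro!: derivative_eq_intros)
  have "pderivative e (\<lambda>x. flat P (c * (x \<bullet> b) + d)) =
      (\<lambda>x. (c * (e \<bullet> b)) * flat (flat_deriv P) (c * (x \<bullet> b) + d))" for e
    using pderivative_eq[OF D] by auto
  then show ?case
    using D by (auto intro: differentiableI C_k_mult C_k_const Suc)
qed

text \<open>The factors have arguments (n+1)(x_b - l_b) and (n+1)(u_b - x_b), written in the shape
  \<open>c * (x \<bullet> b) + d\<close> that \<open>C_k_flat_affine\<close> expects. The slope n+1
  drives the product to the indicator of the open box.\<close>

definition box_bump :: "'a::euclidean_space \<Rightarrow> 'a \<Rightarrow> nat \<Rightarrow> 'a \<Rightarrow> real" where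
  "box_bump l u n x = (\<Prod>b\<in>Basis. flat 1 (real (Suc n) * (x \<bullet> b) + - real (Suc n) * (l \<bullet> b)) *
     flat 1 (- real (Suc n) * (x \<bullet> b) + real (Suc n) * (u \<bullet> b)))"

lemma flat_1_bounds: "0 \<le> flat 1 t" "flat 1 t \<le> 1"
  by (auto simp: flat_def)

lemma box_bump_bounds: "0 \<le> box_bump l u n x" "box_bump l u n x \<le> 1"
  unfolding box_bump_def
  by (auto intro!: prod_nonneg prod_le_1 mult_nonneg_nonneg mult_le_one simp: flat_1_bounds)

lemma box_bump_nonzero_iff: "box_bump l u n x \<noteq> 0 \<longleftrightarrow> x \<in> box l u"
proof -
  have "flat 1 t \<noteq> 0 \<longleftrightarrow> t > 0" for t by (simp add: flat_def)
  moreover have "real (Suc n) * (x \<bullet> b) + - real (Suc n) * (l \<bullet> b) = real (Suc n) * (x \<bullet> b - l \<bullet> b)"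
    "- real (Suc n) * (x \<bullet> b) + real (Suc n) * (u \<bullet> b) = real (Suc n) * (u \<bullet> b - x \<bullet> b)" for b
    by (simp_all only: right_diff_distrib)
  moreover have "real (Suc n) * a > 0 \<longleftrightarrow> a > 0" for a
    by (simp only: zero_less_mult_iff) simp
  ultimately show ?thesis
    by (simp only: box_bump_def mem_box mult_eq_0_iff prod_zero_iff finite_Basis) auto
qed

lemma box_bump_test_function:
  assumes "cbox l u \<subseteq> \<Omega>"
  shows "box_bump l u n \<in> test_functions \<Omega>"
proof -
  have eq: "{x. box_bump l u n x \<noteq> 0} = box l u"
    by (auto simp: box_bump_nonzero_iff)
  have "closure (box l u) \<subseteq> cbox l u"
    by (rule closure_minimal[OF box_subset_cbox closed_cbox])
  moreover have "C_k k (box_bump l u n)" for k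
    unfolding box_bump_def[abs_def] by (intro C_k_prod C_k_mult C_k_flat_affine) auto
  ultimately show ?thesis
    using assms compact_closure[of "box l u"] bounded_box[of l u]
    unfolding test_functions_def mem_Collect_eq eq by auto
qed

lemma box_bump_tendsto: "(\<lambda>n. box_bump l u n x) \<longlonglongrightarrow> indicator (box l u) x"
proof (cases "x \<in> box l u")
  case True
  have lim: "(\<lambda>n. flat 1 (real (Suc n) * a)) \<longlonglongrightarrow> 1" if "a > 0" for a
  proof -
    have "(\<lambda>n. exp (- (inverse (real (Suc n)) * (1 / a)))) \<longlonglongrightarrow> exp (- (0 * (1 / a)))"
      by (intro tendsto_intros LIMSEQ_inverse_real_of_nat)
    moreover have "flat 1 (real (Suc n) * a) = exp (- (inverse (real (Suc n)) * (1 / a)))" for n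
      using that by (simp add: flat_def divide_simps)
    ultimately show ?thesis by simp
  qed
  have "box_bump l u n x = (\<Prod>b\<in>Basis. flat 1 (real (Suc n) * (x \<bullet> b - l \<bullet> b)) * flat 1 (real (Suc n) * (u \<bullet> b - x \<bullet> b)))" for n
    unfolding box_bump_def by (simp add: algebra_simps)
  moreover have "(\<lambda>n. \<Prod>b\<in>Basis. flat 1 (real (Suc n) * (x \<bullet> b - l \<bullet> b)) * flat 1 (real (Suc n) * (u \<bullet> b - x \<bullet> b)))
    \<longlonglongrightarrow> (\<Prod>b\<in>(Basis::'a set). 1 * 1)"
    using True by (intro tendsto_prod tendsto_mult lim) (auto simp: mem_box)
  ultimately show ?thesis using True by simp
next
  case False
  then have "box_bump l u n x = 0" for n using box_bump_nonzero_iff by blast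
  then show ?thesis using False by simp
qed

lemma test_function_continuous: "\<zeta> \<in> test_functions \<Omega> \<Longrightarrow> continuous_on UNIV \<zeta>"
  by (auto simp: test_functions_def dest: spec[of _ 0])

subsection \<open>The fundamental lemma of the calculus of variations\<close>

lemma integral_box_eq_0:
  fixes g :: "'a::euclidean_space \<Rightarrow> real"
  assumes g: "integrable (lebesgue_on \<Omega>) g"
    and test: "\<And>\<zeta>. \<zeta> \<in> test_functions \<Omega> \<Longrightarrow> (LINT x|lebesgue_on \<Omega>. g x * \<zeta> x) = 0"
    and sub: "cbox l u \<subseteq> \<Omega>"
  shows "(LINT x|lebesgue_on \<Omega>. g x * indicator (box l u) x) = 0"
proof -
  have [measurable]: "g \<in> borel_measurable (lebesgue_on \<Omega>)" using g by simp
  have [measurable]: "box_bump l u n \<in> borel_measurable (lebesgue_on \<Omega>)" for n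
  proof -
    have "continuous_on UNIV (box_bump l u n)"
      by (rule test_function_continuous[OF box_bump_test_function[OF sub]])
    then have "box_bump l u n \<in> borel_measurable borel" by (rule borel_measurable_continuous_onI)
    then show ?thesis by (intro measurable_restrict_space1 measurable_completion) simp
  qed
  have lim: "(\<lambda>n. LINT x|lebesgue_on \<Omega>. g x * box_bump l u n x) \<longlonglongrightarrow>
      (LINT x|lebesgue_on \<Omega>. g x * indicator (box l u) x)"
  proof (rule integral_dominated_convergence)
    show "integrable (lebesgue_on \<Omega>) (\<lambda>x. \<bar>g x\<bar>)" using g by simp
    show "(\<lambda>x. g x * indicator (box l u) x) \<in> borel_measurable (lebesgue_on \<Omega>)"
    proof (rule borel_measurable_times)
      show "indicator (box l u) \<in> borel_measurable (lebesgue_on \<Omega>)"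
        by (intro measurable_restrict_space1 measurable_completion borel_measurable_indicator) simp
    qed fact
    show "AE x in lebesgue_on \<Omega>. (\<lambda>n. g x * box_bump l u n x) \<longlonglongrightarrow> g x * indicator (box l u) x"
      by (intro AE_I2 tendsto_intros box_bump_tendsto)
    show "AE x in lebesgue_on \<Omega>. norm (g x * box_bump l u n x) \<le> \<bar>g x\<bar>" for n
      using box_bump_bounds[of l u n] by (auto intro!: AE_I2 mult_left_le simp: abs_mult)
  qed simp
  have "(LINT x|lebesgue_on \<Omega>. g x * box_bump l u n x) = 0" for n
    by (intro test box_bump_test_function[OF sub])
  with lim show ?thesis by (simp add: LIMSEQ_const_iff)
qed

text \<open>A pi-lambda argument. \<open>g\<close> is cut off to one box and extended by zero. Its
  integrals over open boxes vanish by approximation with bumps; boxes are stable under intersection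
  and generate the Borel sets, so its integrals over all Borel sets vanish.\<close>

lemma AE_zero_on_box:
  fixes g :: "'a::euclidean_space \<Rightarrow> real"
  assumes \<Omega>: "\<Omega> \<in> sets lebesgue" and g: "integrable (lebesgue_on \<Omega>) g"
    and test: "\<And>\<zeta>. \<zeta> \<in> test_functions \<Omega> \<Longrightarrow> (LINT x|lebesgue_on \<Omega>. g x * \<zeta> x) = 0"
    and sub: "cbox l u \<subseteq> \<Omega>"
  shows "AE x in lebesgue_on \<Omega>. x \<in> box l u \<longrightarrow> g x = 0"
proof -
  define G where "G x = indicator (box l u) x * g x" for x
  have int: "integrable lebesgue (\<lambda>x. indicator \<Omega> x * g x)"
    using g \<Omega> by (simp add: integrable_restrict_space)
  have inds: "indicator (box l u) x * (indicator \<Omega> x * g x) = G x" for x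
    using sub box_subset_cbox[of l u] by (auto simp: G_def indicator_def)
  have G: "integrable lebesgue G"
    using integrable_mult_indicator[OF _ int, of "box l u"] by (simp add: inds)
  then have "G \<in> borel_measurable lebesgue" by simp
  \<comment> \<open>Boxes generate the Borel sets and not the Lebesgue sets, so \<open>G\<close> is
    exchanged for a Borel function equal to it almost everywhere.\<close>
  from completion_ex_borel_measurable_real[OF this] obtain g' where
    g'[measurable]: "g' \<in> borel_measurable lborel" and eq: "AE x in lborel. G x = g' x" by blast
  have eqc: "AE x in lebesgue. G x = g' x" using eq by (rule AE_completion)
  have "integrable lebesgue g'"
    using G eqc by (subst integrable_cong_AE[symmetric]) (auto intro: measurable_completion)
  then have ig': "integrable lborel g'" by (simp add: integrable_completion)
  have P: "(LINT x|lborel. indicator A x * g' x) = (LINT x|lebesgue_on \<Omega>. g x * indicator (A \<inter> box l u) x)"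
    if A: "A \<in> sets borel" for A
  proof -
    have [measurable]: "A \<in> sets lborel" using A by simp
    have "(LINT x|lborel. indicator A x * g' x) = (LINT x|lebesgue. indicator A x * g' x)"
      by (rule integral_completion[symmetric]) measurable
    also have "\<dots> = (LINT x|lebesgue. indicator A x * G x)"
    proof (rule integral_cong_AE)
      show "(\<lambda>x. indicator A x * g' x) \<in> borel_measurable lebesgue"
        by (rule measurable_completion) measurable
      show "(\<lambda>x. indicator A x * G x) \<in> borel_measurable lebesgue"
        using G A by (intro borel_measurable_times borel_measurable_indicator) auto
      show "AE x in lebesgue. indicator A x * g' x = indicator A x * G x"
        using eqc by eventually_elim simp
    qed
    also have "\<dots> = (LINT x|lebesgue. indicator \<Omega> x * (g x * indicator (A \<inter> box l u) x))"
      using sub box_subset_cbox[of l u] by (intro Bochner_Integration.integral_cong refl) (auto simp: G_def indicator_def)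
    also have "\<dots> = (LINT x|lebesgue_on \<Omega>. g x * indicator (A \<inter> box l u) x)"
      using \<Omega> by (simp add: integral_restrict_space)
    finally show ?thesis .
  qed
  have boxes: "(LINT x|lborel. indicator (box a b) x * g' x) = 0" for a b
  proof (cases "box a b \<inter> box l u = {}")
    case True
    then show ?thesis by (simp add: P)
  next
    case False
    obtain a' b' where ab: "box a b \<inter> box l u = box a' b'" using box_Int_box by blast
    \<comment> \<open>Intersecting with the fixed box keeps the closure inside \<Omega>. The closure
      of a box is the closed box only if the box is nonempty, whence the case distinction.\<close>
    have "closure (box a' b') \<subseteq> cbox l u"
      using ab by (intro closure_minimal) (use box_subset_cbox[of l u] in auto)
    then have "cbox a' b' \<subseteq> \<Omega>" using False ab sub by (simp add: closure_box)
    from integral_box_eq_0[OF g test this] show ?thesis by (simp add: P ab)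
  qed
  have all: "(LINT x|lborel. indicator A x * g' x) = 0" if "A \<in> sets borel" for A
  proof -
    have "Int_stable (range (\<lambda>(a, b). box a b :: 'a set))"
    proof (rule Int_stableI)
      fix S T :: "'a set" assume "S \<in> range (\<lambda>(a, b). box a b)" "T \<in> range (\<lambda>(a, b). box a b)"
      then obtain a b c d where "S = box a b" "T = box c d" by auto
      then have "S \<inter> T = (\<lambda>(a, b). box a b)
          (\<Sum>i\<in>Basis. max (a \<bullet> i) (c \<bullet> i) *\<^sub>R i, \<Sum>i\<in>Basis. min (b \<bullet> i) (d \<bullet> i) *\<^sub>R i)"
        by (simp add: box_Int_box)
      then show "S \<inter> T \<in> range (\<lambda>(a, b). box a b)" by (rule range_eqI)
    qed
    moreover have "range (\<lambda>(a, b). box a b :: 'a set) \<subseteq> Pow UNIV" by simp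
    moreover have "A \<in> sigma_sets UNIV (range (\<lambda>(a, b). box a b))"
      using that by (subst (asm) borel_eq_box) simp
    ultimately show ?thesis
    proof (induction rule: sigma_sets_induct_disjoint)
      case (basic A)
      then show ?case using boxes by auto
    next
      case empty
      show ?case by simp
    next
      case (compl A)
      then have [measurable]: "A \<in> sets borel" by (subst borel_eq_box) simp
      have "integrable lborel (\<lambda>x. indicator A x * g' x)"
        using integrable_mult_indicator[OF _ ig', of A] by simp
      \<comment> \<open>Complements require the total integral, which is the integral over the fixed
        box itself.\<close>
      moreover have "(LINT x|lborel. g' x) = 0"
        using P[of UNIV] integral_box_eq_0[OF g test sub] by simp
      moreover have "indicator (UNIV - A) x * g' x = g' x - indicator A x * g' x" for x
        by (simp add: indicator_def)
      ultimately show ?case using compl ig' by simp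
    next
      case (union A)
      have [measurable]: "A i \<in> sets borel" for i using union(2) by (subst borel_eq_box) auto
      have "(LINT x:(\<Union>i. A i)|lborel. g' x) = (\<Sum>i. LINT x:A i|lborel. g' x)"
      proof (rule lebesgue_integral_countable_add)
        show "set_integrable lborel (\<Union>(range A)) g'"
          unfolding set_integrable_def using integrable_mult_indicator[OF _ ig'] by simp
      qed (use union(1) in \<open>auto simp: disjoint_family_on_def\<close>)
      then show ?case using union(3) by (simp add: set_lebesgue_integral_def)
    qed
  qed
  have "AE x in lborel. g' x = 0"
    using all by (intro sigma_finite_measure.density_zero[OF sigma_finite_lborel] ig') (simp add: set_lebesgue_integral_def)
  then have "AE x in lborel. G x = 0" using eq by eventually_elim simp
  then have "AE x in lebesgue. G x = 0" by (rule AE_completion)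
  then have "AE x in lebesgue. x \<in> \<Omega> \<longrightarrow> x \<in> box l u \<longrightarrow> g x = 0"
    by eventually_elim (auto simp: G_def)
  then show ?thesis using \<Omega> by (simp add: AE_restrict_space_iff)
qed

text \<open>The exceptional null set depends on the box; Lindelof's theorem leaves only countably
  many boxes to cover \<Omega>.\<close>

theorem AE_zero_if_test_integrals_zero:
  fixes g :: "'a::euclidean_space \<Rightarrow> real"
  assumes \<Omega>: "open \<Omega>" and g: "integrable (lebesgue_on \<Omega>) g"
    and test: "\<And>\<zeta>. \<zeta> \<in> test_functions \<Omega> \<Longrightarrow> (LINT x|lebesgue_on \<Omega>. g x * \<zeta> x) = 0"
  shows "AE x in lebesgue_on \<Omega>. g x = 0"
proof -
  have \<Omega>s: "\<Omega> \<in> sets lebesgue" using \<Omega> by simp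
  define F where "F = {box l u |l u :: 'a. cbox l u \<subseteq> \<Omega>}"
  have "open S" if "S \<in> F" for S using that by (auto simp: F_def)
  from Lindelof[OF this] obtain F' where F': "F' \<subseteq> F" "countable F'" "\<Union>F' = \<Union>F" by blast
  have cov: "\<Omega> \<subseteq> \<Union>F"
  proof (rule subsetI)
    fix x assume "x \<in> \<Omega>"
    from open_contains_cbox[OF \<Omega> this] obtain l u where "cbox l u \<subseteq> \<Omega>" "x \<in> box l u" by metis
    then show "x \<in> \<Union>F" unfolding F_def by blast
  qed
  have "AE x in lebesgue_on \<Omega>. \<forall>S\<in>F'. x \<in> S \<longrightarrow> g x = 0"
  proof (rule AE_ball_countable')
    fix S assume "S \<in> F'"
    then obtain l u where "S = box l u" "cbox l u \<subseteq> \<Omega>" using F' by (auto simp: F_def)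
    then show "AE x in lebesgue_on \<Omega>. x \<in> S \<longrightarrow> g x = 0"
      using AE_zero_on_box[OF \<Omega>s g test] by simp
  qed fact
  then show ?thesis
    using AE_space
  proof eventually_elim
    case (elim x)
    then have "x \<in> \<Union>F'" using cov F'(3) by auto
    then show ?case using elim(1) by blast
  qed
qed

subsection \<open>Integration by parts for test functions\<close>

text \<open>Difference quotients of \<open>w\<close> integrate to zero by translation invariance.
  The mean value theorem bounds them by the derivative on a fixed ball, so dominated convergence
  applies.\<close>

lemma integral_pderivative_eq_0:
  fixes w :: "'a::euclidean_space \<Rightarrow> real"
  assumes w: "\<And>x. w differentiable (at x)" and cont: "continuous_on UNIV (pderivative e w)"
    and supp: "bounded {x. w x \<noteq> 0}"
  shows "(LINT x|lborel. pderivative e w x) = 0"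
proof -
  have wc: "continuous_on UNIV w"
    using w by (auto intro!: continuous_at_imp_continuous_on differentiable_imp_continuous_within)
  have [measurable]: "w \<in> borel_measurable borel" "pderivative e w \<in> borel_measurable borel"
    using wc cont by (auto intro: borel_measurable_continuous_onI)
  obtain R where R: "R > 0" "\<And>x. w x \<noteq> 0 \<Longrightarrow> norm x \<le> R"
    using supp by (auto simp: bounded_pos)
  have line: "((\<lambda>t. w (x + t *\<^sub>R e)) has_real_derivative pderivative e w (x + t *\<^sub>R e)) (at t)" for x t
  proof -
    have D: "(w has_derivative frechet_derivative w (at (x + t *\<^sub>R e))) (at (x + t *\<^sub>R e))"
      using w by (simp add: frechet_derivative_works[symmetric])
    have "((\<lambda>t. x + t *\<^sub>R e) has_derivative (\<lambda>h. h *\<^sub>R e)) (at t)"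
      by (auto intro!: derivative_eq_intros)
    from has_derivative_compose[OF this D]
    have "((\<lambda>t. w (x + t *\<^sub>R e)) has_derivative (\<lambda>h. frechet_derivative w (at (x + t *\<^sub>R e)) (h *\<^sub>R e))) (at t)" .
    moreover have "frechet_derivative w (at y) (h *\<^sub>R e) = h * pderivative e w y" for y h
      using linear_scale[OF linear_frechet_derivative[OF w]] by (simp add: pderivative_def)
    ultimately show ?thesis
      by (simp add: has_field_derivative_def mult.commute[of _ "pderivative e w _"])
  qed
  \<comment> \<open>For a step h in (0,1] the quotient vanishes unless
    \<open>norm x \<le> R + norm e\<close>; the intermediate point of the mean value theorem is then
    within \<open>R + 2 * norm e\<close> of the origin.\<close>
  define K where "K = cball (0::'a) (R + 2 * norm e + 1)"
  have "compact (pderivative e w ` K)"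
    unfolding K_def by (intro compact_continuous_image continuous_on_subset[OF cont]) auto
  then have "bounded (pderivative e w ` K)" by (rule compact_imp_bounded)
  then obtain B where B: "B > 0" "\<And>x. x \<in> K \<Longrightarrow> \<bar>pderivative e w x\<bar> \<le> B"
    by (auto simp: bounded_pos)
  define q where "q n x = (w (x + inverse (real (Suc n)) *\<^sub>R e) - w x) / inverse (real (Suc n))" for n x
  have wint: "integrable lborel w"
  proof -
    have "compact (w ` cball 0 R)"
      by (intro compact_continuous_image continuous_on_subset[OF wc]) auto
    then have "integrable lborel (\<lambda>x. indicator (cball 0 R) x *\<^sub>R w x)"
      using borel_integrable_compact[of "cball 0 R" w] continuous_on_subset[OF wc]
      by (simp add: indicator_def mult.commute if_distrib cong: if_cong)
    moreover have "(\<lambda>x. indicator (cball 0 R) x *\<^sub>R w x) = w"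
      using R(2) by (fastforce simp: indicator_def)
    ultimately show ?thesis by simp
  qed
  have shift: "integrable lborel (\<lambda>x. w (x + c)) \<and> (LINT x|lborel. w (x + c)) = (LINT x|lborel. w x)" for c
  proof -
    have "integrable (distr lborel borel ((+) c)) w" using wint by (simp add: lborel_distr_plus)
    then have "integrable lborel (\<lambda>x. w (c + x))" by (subst (asm) integrable_distr_eq) auto
    moreover have "(LINT x|distr lborel borel ((+) c). w x) = (LINT x|lborel. w (c + x))"
      by (rule integral_distr) auto
    ultimately show ?thesis by (simp add: lborel_distr_plus add.commute)
  qed
  have q0: "(LINT x|lborel. q n x) = 0" for n
    unfolding q_def using shift[of "inverse (real (Suc n)) *\<^sub>R e"] wint by simp
  have "(\<lambda>n. LINT x|lborel. q n x) \<longlonglongrightarrow> (LINT x|lborel. pderivative e w x)"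
  proof (rule integral_dominated_convergence)
    show "integrable lborel (\<lambda>x. indicator K x * B)"
      by (intro integrable_mult_left integrable_real_indicator) (auto simp: K_def intro: emeasure_lborel_cball_finite[unfolded infinity_ennreal_def])
    show "AE x in lborel. (\<lambda>n. q n x) \<longlonglongrightarrow> pderivative e w x"
    proof (rule AE_I2)
      fix x
      have "((\<lambda>h. (w (x + h *\<^sub>R e) - w x) / h) \<longlongrightarrow> pderivative e w x) (at 0)"
        using line[of x 0] by (simp add: DERIV_def)
      moreover have "filterlim (\<lambda>n. inverse (real (Suc n))) (at 0) sequentially"
        using LIMSEQ_inverse_real_of_nat by (simp add: filterlim_at)
      ultimately show "(\<lambda>n. q n x) \<longlonglongrightarrow> pderivative e w x"
        unfolding q_def by (rule filterlim_compose)
    qed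
    show "AE x in lborel. norm (q n x) \<le> indicator K x * B" for n
    proof (rule AE_I2)
      fix x
      define h where "h = inverse (real (Suc n))"
      have h: "0 < h" "h \<le> 1" by (auto simp: h_def inverse_le_1_iff)
      obtain z where z: "0 < z" "z < h" "w (x + h *\<^sub>R e) - w (x + 0 *\<^sub>R e) = (h - 0) * pderivative e w (x + z *\<^sub>R e)"
        using MVT2[OF h(1) line, of x] by auto
      then have qz: "q n x = pderivative e w (x + z *\<^sub>R e)"
        unfolding q_def h_def[symmetric] using h by simp
      show "norm (q n x) \<le> indicator K x * B"
      proof (cases "norm x \<le> R + norm e")
        case True
        have "norm (x + z *\<^sub>R e) \<le> norm x + z * norm e"
          using norm_triangle_ineq[of x "z *\<^sub>R e"] z by simp
        also have "\<dots> \<le> norm x + 1 * norm e" using z h by (intro add_left_mono mult_right_mono) auto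
        finally have "x + z *\<^sub>R e \<in> K" using True by (simp add: K_def)
        moreover have "x \<in> K" using True by (simp add: K_def) (smt (verit) norm_ge_zero)
        ultimately show ?thesis using B(2) by (simp add: qz)
      next
        case False
        then have "w x = 0" using R(2)[of x] norm_ge_zero[of e] by fastforce
        moreover have "w (x + h *\<^sub>R e) = 0"
        proof (rule ccontr)
          assume "w (x + h *\<^sub>R e) \<noteq> 0"
          then have "norm (x + h *\<^sub>R e) \<le> R" by (rule R)
          moreover have "norm x \<le> norm (x + h *\<^sub>R e) + norm (h *\<^sub>R e)"
            using norm_triangle_ineq4[of "x + h *\<^sub>R e" "h *\<^sub>R e"] by simp
          moreover have "norm (h *\<^sub>R e) \<le> 1 * norm e" using h by (auto intro: mult_left_le_one_le)
          ultimately show False using False by simp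
        qed
        ultimately have "q n x = 0" unfolding q_def h_def by simp
        then show ?thesis using B by simp
      qed
    qed
  qed (auto simp: q_def)
  then show ?thesis by (simp add: q0 LIMSEQ_const_iff)
qed

lemma pderivative_zero_outside_closure:
  assumes "x \<notin> closure {x. w x \<noteq> 0}"
  shows "pderivative e w x = (0::real)"
proof -
  have "((\<lambda>_. 0) has_derivative (\<lambda>_. 0)) (at x)" by simp
  then have "(w has_derivative (\<lambda>_. 0)) (at x)"
    by (rule has_derivative_transform_within_open[of _ _ _ _ "- closure {x. w x \<noteq> 0}"])
      (use assms closure_subset[of "{x. w x \<noteq> 0}"] in auto)
  then show ?thesis by (rule pderivative_eq)
qed

lemma test_functionD:
  assumes "\<zeta> \<in> test_functions \<Omega>"
  shows "\<zeta> differentiable (at x)" "continuous_on UNIV \<zeta>" "bounded {x. \<zeta> x \<noteq> 0}"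
    "e \<in> Basis \<Longrightarrow> continuous_on UNIV (pderivative e \<zeta>)"
    "x \<notin> \<Omega> \<Longrightarrow> \<zeta> x = 0" "x \<notin> \<Omega> \<Longrightarrow> pderivative e \<zeta> x = 0"
proof -
  from assms have C: "C_k (Suc 0) \<zeta>" and cl: "compact (closure {x. \<zeta> x \<noteq> 0})" "closure {x. \<zeta> x \<noteq> 0} \<subseteq> \<Omega>"
    by (auto simp: test_functions_def)
  show "\<zeta> differentiable (at x)" "e \<in> Basis \<Longrightarrow> continuous_on UNIV (pderivative e \<zeta>)"
    using C by auto
  show "continuous_on UNIV \<zeta>" using assms by (rule test_function_continuous)
  show "bounded {x. \<zeta> x \<noteq> 0}"
    using compact_imp_bounded[OF cl(1)] closure_subset by (rule bounded_subset)
  show "x \<notin> \<Omega> \<Longrightarrow> \<zeta> x = 0" "x \<notin> \<Omega> \<Longrightarrow> pderivative e \<zeta> x = 0"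
    using cl(2) closure_subset[of "{x. \<zeta> x \<noteq> 0}"] pderivative_zero_outside_closure[of x \<zeta> e] by auto
qed

lemma bounded_range_continuous_vanishing_outside:
  fixes g :: "'a::euclidean_space \<Rightarrow> real"
  assumes "continuous_on UNIV g" "bounded \<Omega>" "\<And>x. x \<notin> \<Omega> \<Longrightarrow> g x = 0"
  obtains B where "\<And>x. \<bar>g x\<bar> \<le> B"
proof -
  have "bounded (g ` closure \<Omega>)"
    using assms by (intro compact_imp_bounded compact_continuous_image continuous_on_subset[OF assms(1)]) auto
  then obtain B where B: "B > 0" "\<And>x. x \<in> closure \<Omega> \<Longrightarrow> \<bar>g x\<bar> \<le> B" by (auto simp: bounded_pos)
  have "\<bar>g x\<bar> \<le> B" for x
    using B assms(3)[of x] closure_subset[of \<Omega>] by (cases "x \<in> \<Omega>") auto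
  then show thesis by (rule that)
qed

lemma continuous_imp_borel_measurable_lebesgue_on:
  "continuous_on UNIV g \<Longrightarrow> (g :: 'a::euclidean_space \<Rightarrow> 'b::euclidean_space) \<in> borel_measurable (lebesgue_on \<Omega>)"
  by (intro measurable_restrict_space1 measurable_completion) (simp add: borel_measurable_continuous_onI)

text \<open>The derivative of the product of the two functions has integral zero. This identifies
  the classical gradient of a test function as its weak gradient.\<close>

lemma integral_by_parts_test_functions:
  assumes \<Omega>: "open \<Omega>" "bounded \<Omega>" and \<zeta>: "\<zeta> \<in> test_functions \<Omega>" and \<eta>: "\<eta> \<in> test_functions \<Omega>"
    and e: "e \<in> Basis"
  shows "(LINT x|lebesgue_on \<Omega>. \<zeta> x * pderivative e \<eta> x) = - (LINT x|lebesgue_on \<Omega>. pderivative e \<zeta> x * \<eta> x)"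
proof -
  have fin: "finite_measure (lebesgue_on \<Omega>)"
    using \<Omega> by (intro finite_measure_lebesgue_on) (simp add: bounded_set_imp_lmeasurable)
  define w where "w x = \<zeta> x * \<eta> x" for x
  have pd: "pderivative e w x = pderivative e \<zeta> x * \<eta> x + \<zeta> x * pderivative e \<eta> x" for x
    unfolding w_def by (intro pderivative_mult test_functionD[OF \<zeta>] test_functionD[OF \<eta>])
  have cont: "continuous_on UNIV (pderivative e w)"
    unfolding pd[abs_def]
    by (intro continuous_intros test_functionD[OF \<zeta>] test_functionD[OF \<eta>] e)
  have "(LINT x|lborel. pderivative e w x) = 0"
  proof (rule integral_pderivative_eq_0[OF _ cont])
    show "w differentiable at x" for x
      unfolding w_def[abs_def] by (intro differentiable_mult test_functionD[OF \<zeta>] test_functionD[OF \<eta>])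
    show "bounded {x. w x \<noteq> 0}"
      by (rule bounded_subset[OF test_functionD(3)[OF \<zeta>]]) (auto simp: w_def)
  qed
  also have "(LINT x|lborel. pderivative e w x) = (LINT x|lebesgue. pderivative e w x)"
    using cont by (intro integral_completion[symmetric]) (simp add: borel_measurable_continuous_onI)
  also have "\<dots> = (LINT x|lebesgue. indicator \<Omega> x *\<^sub>R pderivative e w x)"
    using test_functionD(5,6)[OF \<zeta>] by (intro Bochner_Integration.integral_cong refl) (auto simp: indicator_def pd)
  also have "\<dots> = (LINT x|lebesgue_on \<Omega>. pderivative e \<zeta> x * \<eta> x + \<zeta> x * pderivative e \<eta> x)"
    using \<Omega> by (simp add: integral_restrict_space pd)
  also have "\<dots> = (LINT x|lebesgue_on \<Omega>. pderivative e \<zeta> x * \<eta> x) + (LINT x|lebesgue_on \<Omega>. \<zeta> x * pderivative e \<eta> x)"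
  proof (rule Bochner_Integration.integral_add)
    have "integrable (lebesgue_on \<Omega>) g" if c: "continuous_on UNIV g" and z: "\<And>x. x \<notin> \<Omega> \<Longrightarrow> g x = 0" for g :: "'a \<Rightarrow> real"
    proof -
      obtain B where "\<And>x. \<bar>g x\<bar> \<le> B" using bounded_range_continuous_vanishing_outside[OF c \<Omega>(2) z] by blast
      then show ?thesis
        using c by (intro finite_measure.integrable_const_bound[OF fin, of g B] continuous_imp_borel_measurable_lebesgue_on) auto
    qed
    then show "integrable (lebesgue_on \<Omega>) (\<lambda>x. pderivative e \<zeta> x * \<eta> x)" "integrable (lebesgue_on \<Omega>) (\<lambda>x. \<zeta> x * pderivative e \<eta> x)"
      using test_functionD(2,4-6)[OF \<zeta>] test_functionD(2,4-6)[OF \<eta>] e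
      by (simp_all add: continuous_on_mult)
  qed
  finally show ?thesis by linarith
qed

lemma gradient_inner_Basis: "e \<in> Basis \<Longrightarrow> gradient \<zeta> x \<bullet> e = pderivative e \<zeta> x"
  by (simp add: gradient_def inner_sum_left inner_Basis if_distrib cong: if_cong)

subsection \<open>Young functions and their conjugates\<close>

text \<open>The last condition encodes superlinear growth. One point t for each slope suffices,
  because convexity and \<open>c 0 = 0\<close> make \<open>c t / t\<close> nondecreasing; and being
  a countable family of conditions, it survives the passage to almost every x.\<close>

definition young :: "(real \<Rightarrow> real) \<Rightarrow> bool" where
  "young c \<longleftrightarrow> convex_on {0..} c \<and> mono_on {0..} c \<and> continuous_on {0..} c \<and> c 0 = 0 \<and>
     (\<forall>k::nat. \<exists>t>0. real k * t \<le> c t)"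

text \<open>The real-valued form of \<open>conj_fun\<close>. For Young functions the supremum is
  finite, so the default value of \<open>real_of_ereal\<close> at infinity does not occur.\<close>

definition young_conj :: "(real \<Rightarrow> real) \<Rightarrow> real \<Rightarrow> real" where
  "young_conj c s = real_of_ereal (SUP t\<in>{0..}. ereal (s * t - c t))"

text \<open>An enumeration, with repetitions, of the nonnegative dyadic numbers. By continuity the
  supremum in the conjugate may be restricted to them, which makes it a countable one and gives
  measurability in x.\<close>

definition dyadic :: "nat \<Rightarrow> real" where
  "dyadic m = (case prod_decode m of (k, n) \<Rightarrow> real k / 2 ^ n)"

definition dyadic_floor :: "nat \<Rightarrow> real \<Rightarrow> real" where
  "dyadic_floor n t = real (nat \<lfloor>2 ^ n * t\<rfloor>) / 2 ^ n"

lemma dyadic_nonneg: "dyadic m \<ge> 0"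
  by (simp add: dyadic_def split: prod.split)

lemma dyadic_floor_eq: "dyadic_floor n t = dyadic (prod_encode (nat \<lfloor>2 ^ n * t\<rfloor>, n))"
  by (simp add: dyadic_floor_def dyadic_def)

lemma dyadic_floor_nonneg: "dyadic_floor n t \<ge> 0"
  by (simp add: dyadic_floor_eq dyadic_nonneg)

lemma dyadic_floor_tendsto:
  assumes "t \<ge> 0" shows "(\<lambda>n. dyadic_floor n t) \<longlonglongrightarrow> t"
proof (rule tendsto_sandwich)
  have eq: "dyadic_floor n t = of_int \<lfloor>2 ^ n * t\<rfloor> / 2 ^ n" for n
    using assms by (simp add: dyadic_floor_def)
  show "\<forall>\<^sub>F n in sequentially. t - (1/2) ^ n \<le> dyadic_floor n t"
  proof (rule always_eventually, rule allI)
    fix n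
    have "2 ^ n * t - 1 \<le> of_int \<lfloor>2 ^ n * t\<rfloor>" by linarith
    then have "(2 ^ n * t - 1) / 2 ^ n \<le> dyadic_floor n t"
      unfolding eq by (intro divide_right_mono) auto
    then show "t - (1/2) ^ n \<le> dyadic_floor n t" by (simp add: diff_divide_distrib power_one_over)
  qed
  show "\<forall>\<^sub>F n in sequentially. dyadic_floor n t \<le> t"
  proof (rule always_eventually, rule allI)
    fix n
    have "of_int \<lfloor>2 ^ n * t\<rfloor> \<le> 2 ^ n * t" by linarith
    then have "dyadic_floor n t \<le> (2 ^ n * t) / 2 ^ n"
      unfolding eq by (intro divide_right_mono) auto
    then show "dyadic_floor n t \<le> t" by simp
  qed
  have "(\<lambda>n. t - (1/2::real) ^ n) \<longlonglongrightarrow> t - 0"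
    by (intro tendsto_intros LIMSEQ_power_zero) auto
  then show "(\<lambda>n. t - (1/2) ^ n) \<longlonglongrightarrow> t" by simp
qed simp

context
  fixes c :: "real \<Rightarrow> real" assumes c: "young c"
begin

lemma young_0: "c 0 = 0" using c by (simp add: young_def)

lemma young_mono: "0 \<le> s \<Longrightarrow> s \<le> t \<Longrightarrow> c s \<le> c t"
  using c by (auto simp: young_def mono_on_def)

lemma young_nonneg: "0 \<le> t \<Longrightarrow> 0 \<le> c t"
  using young_mono[of 0 t] young_0 by simp

lemma young_scale: "0 \<le> \<theta> \<Longrightarrow> \<theta> \<le> 1 \<Longrightarrow> 0 \<le> t \<Longrightarrow> c (\<theta> * t) \<le> \<theta> * c t"
  using convex_onD[of "{0..}" c \<theta> 0 t] c by (simp add: young_def)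

lemma young_tendsto:
  assumes "f \<longlonglongrightarrow> t" "\<And>n. f n \<ge> 0" "t \<ge> 0" shows "(\<lambda>n. c (f n)) \<longlonglongrightarrow> c t"
proof -
  have "continuous_on {0..} c" using c by (simp add: young_def)
  from continuous_on_tendsto_compose[OF this assms(1)] assms show ?thesis by auto
qed

text \<open>Choose a slope k above \<open>\<bar>s\<bar>\<close> and t0 with
  \<open>k * t0 \<le> c t0\<close>. Since \<open>c t / t\<close> is nondecreasing, the difference is
  at most 0 beyond t0; up to t0 it is at most \<open>\<bar>s\<bar> * t0\<close>.\<close>

lemma young_conj_bounded: "\<exists>B. \<forall>t\<ge>0. s * t - c t \<le> B"
proof -
  obtain k :: nat where k: "\<bar>s\<bar> \<le> real k" using real_arch_simple by blast
  obtain t0 where t0: "t0 > 0" "real k * t0 \<le> c t0" using c unfolding young_def by blast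
  have "s * t - c t \<le> \<bar>s\<bar> * t0" if t: "t \<ge> 0" for t
  proof (cases "t \<le> t0")
    case True
    have "s * t \<le> \<bar>s\<bar> * t0" using True t by (intro mult_mono) auto
    then show ?thesis using young_nonneg[OF t] by simp
  next
    case False
    then have tp: "t > 0" using t0 by simp
    have "c (t0 / t * t) \<le> t0 / t * c t"
      using False t0 tp by (intro young_scale) auto
    then have "real k * t0 \<le> t0 / t * c t" using t0 tp by simp
    then have "real k * t \<le> c t" using t0 tp by (simp add: field_simps)
    moreover have "s * t \<le> real k * t" using k t by (intro mult_right_mono) auto
    moreover have "0 \<le> \<bar>s\<bar> * t0" using t0 by simp
    ultimately show ?thesis by linarith
  qed
  then show ?thesis by blast
qed

lemma ereal_young_conj: "(SUP t\<in>{0..}. ereal (s * t - c t)) = ereal (young_conj c s)"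
proof -
  obtain B where B: "\<And>t. t \<ge> 0 \<Longrightarrow> s * t - c t \<le> B" using young_conj_bounded by blast
  have "(SUP t\<in>{0..}. ereal (s * t - c t)) \<le> ereal B" by (rule SUP_least) (use B in auto)
  moreover have "ereal (s * 0 - c 0) \<le> (SUP t\<in>{0..}. ereal (s * t - c t))" by (rule SUP_upper) simp
  ultimately show ?thesis unfolding young_conj_def
    by (intro ereal_real'[symmetric]) (auto simp: young_0)
qed

lemma young_inequality: "t \<ge> 0 \<Longrightarrow> s * t \<le> c t + young_conj c s"
proof -
  assume "t \<ge> 0"
  then have "ereal (s * t - c t) \<le> ereal (young_conj c s)"
    unfolding ereal_young_conj[symmetric] by (intro SUP_upper) simp
  then show ?thesis by simp
qed

lemma young_conj_le:
  assumes "\<And>t. t \<ge> 0 \<Longrightarrow> s * t - c t \<le> B" shows "young_conj c s \<le> B"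
proof -
  have "ereal (young_conj c s) \<le> ereal B"
    unfolding ereal_young_conj[symmetric] by (rule SUP_least) (use assms in auto)
  then show ?thesis by simp
qed

lemma young_conj_nonneg: "0 \<le> young_conj c s"
  using young_inequality[of 0 s] young_0 by simp

lemma young_conj_0: "young_conj c 0 = 0"
  using young_conj_le[of 0 0] young_conj_nonneg[of 0] young_nonneg by force

lemma young_conj_mono: "s \<le> s' \<Longrightarrow> young_conj c s \<le> young_conj c s'"
proof (rule young_conj_le)
  fix t :: real assume "s \<le> s'" "t \<ge> 0"
  then show "s * t - c t \<le> young_conj c s'"
    using young_inequality[of t s'] mult_right_mono[of s s' t] by linarith
qed

lemma young_conj_midpoint: "young_conj c ((s + s') / 2) \<le> (young_conj c s + young_conj c s') / 2"
proof (rule young_conj_le)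
  fix t :: real assume "t \<ge> 0"
  then show "(s + s') / 2 * t - c t \<le> (young_conj c s + young_conj c s') / 2"
    using young_inequality[of t s'] young_inequality[of t s] by (simp add: field_simps)
qed

lemma young_conj_le_dyadic:
  assumes "\<And>m. s * dyadic m - c (dyadic m) \<le> B" shows "young_conj c s \<le> B"
proof (rule young_conj_le)
  fix t :: real assume t: "t \<ge> 0"
  have "(\<lambda>n. s * dyadic_floor n t - c (dyadic_floor n t)) \<longlonglongrightarrow> s * t - c t"
    by (intro tendsto_intros dyadic_floor_tendsto young_tendsto t dyadic_floor_nonneg)
  moreover have "s * dyadic_floor n t - c (dyadic_floor n t) \<le> B" for n
    unfolding dyadic_floor_eq by (rule assms)
  ultimately show "s * t - c t \<le> B" using LIMSEQ_le_const2 by blast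
qed

lemma young_conj_eq_SUP_dyadic: "ereal (young_conj c s) = (SUP m. ereal (s * dyadic m - c (dyadic m)))"
proof (rule antisym)
  let ?S = "SUP m. ereal (s * dyadic m - c (dyadic m))"
  show upper: "?S \<le> ereal (young_conj c s)"
    by (rule SUP_least) (use young_inequality[OF dyadic_nonneg] in \<open>simp add: algebra_simps\<close>)
  have "ereal (s * dyadic 0 - c (dyadic 0)) \<le> ?S" by (rule SUP_upper) simp
  then obtain B where B: "?S = ereal B" using upper by (cases ?S) auto
  have "s * dyadic m - c (dyadic m) \<le> B" for m
    using SUP_upper[of m UNIV "\<lambda>m. ereal (s * dyadic m - c (dyadic m))"] by (simp add: B)
  then show "ereal (young_conj c s) \<le> ?S" by (simp add: B young_conj_le_dyadic)
qed

text \<open>The conjugate is a supremum of affine functions of s. Lower semicontinuity is the form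
  in which it enters Fatou's lemma.\<close>

lemma young_conj_lsc:
  assumes "s \<longlonglongrightarrow> s0" shows "ennreal (young_conj c s0) \<le> liminf (\<lambda>n. ennreal (young_conj c (s n)))"
proof (rule ccontr)
  assume "\<not> ?thesis"
  then have less: "liminf (\<lambda>n. ennreal (young_conj c (s n))) < ennreal (young_conj c s0)" by simp
  then obtain B where B: "B \<ge> 0" "liminf (\<lambda>n. ennreal (young_conj c (s n))) = ennreal B"
    by (cases "liminf (\<lambda>n. ennreal (young_conj c (s n)))") auto
  have "young_conj c s0 \<le> B"
  proof (rule young_conj_le)
    fix t :: real assume t: "t \<ge> 0"
    have "(\<lambda>n. ennreal (s n * t - c t)) \<longlonglongrightarrow> ennreal (s0 * t - c t)"
      by (intro tendsto_intros assms)
    then have "ennreal (s0 * t - c t) = liminf (\<lambda>n. ennreal (s n * t - c t))"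
      by (intro lim_imp_Liminf[symmetric]) auto
    also have "\<dots> \<le> liminf (\<lambda>n. ennreal (young_conj c (s n)))"
    proof (intro Liminf_mono always_eventually allI ennreal_leI)
      fix n
      show "s n * t - c t \<le> young_conj c (s n)" using young_inequality[OF t, of "s n"] by simp
    qed
    \<comment> \<open>\<open>ennreal\<close> cuts off negative values; since B is nonnegative the
      inequality still holds for them.\<close>
    finally show "s0 * t - c t \<le> B" using B by (simp add: ennreal_le_iff)
  qed
  then have "ennreal (young_conj c s0) \<le> ennreal B" by (rule ennreal_leI)
  with less B show False by simp
qed

end

text \<open>The \<open>n\<close>-th selector maximises \<open>t \<mapsto> s t - c t\<close> over \<open>0\<close> and the first \<open>n\<close> dyadic numbers.\<close>

primrec selector :: "(real \<Rightarrow> real) \<Rightarrow> real \<Rightarrow> nat \<Rightarrow> real" where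
  "selector c s 0 = 0"
| "selector c s (Suc n) =
    (if s * selector c s n - c (selector c s n) < s * dyadic n - c (dyadic n) then dyadic n else selector c s n)"

lemma selector_nonneg: "0 \<le> selector c s n"
  by (induction n) (auto simp: dyadic_nonneg)

text \<open>Crude, but independent of s and c: the fields built from the n-th selector are bounded
  uniformly in x.\<close>

lemma selector_le: "selector c s n \<le> (\<Sum>i<n. dyadic i)"
proof (induction n)
  case (Suc n)
  have "dyadic n \<le> (\<Sum>i<Suc n. dyadic i)" by (rule member_le_sum) (auto simp: dyadic_nonneg)
  moreover have "(\<Sum>i<n. dyadic i) \<le> (\<Sum>i<Suc n. dyadic i)" by (simp add: dyadic_nonneg)
  ultimately show ?case using Suc by auto
qed simp

lemma selector_incseq: "incseq (\<lambda>n. s * selector c s n - c (selector c s n))"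
  by (rule incseq_SucI) simp

lemma selector_ge: "s * dyadic n - c (dyadic n) \<le> s * selector c s (Suc n) - c (selector c s (Suc n))"
  by simp

lemma selector_SUP:
  assumes c: "young c"
  shows "(SUP n. ennreal (s * selector c s n - c (selector c s n))) = ennreal (young_conj c s)"
proof (rule antisym)
  show "(SUP n. ennreal (s * selector c s n - c (selector c s n))) \<le> ennreal (young_conj c s)"
    using young_inequality[OF c selector_nonneg, of s c s]
    by (intro SUP_least ennreal_leI) (simp add: algebra_simps)
  let ?S = "SUP n. ennreal (s * selector c s n - c (selector c s n))"
  show "ennreal (young_conj c s) \<le> ?S"
  proof (cases ?S)
    case (real B)
    have "young_conj c s \<le> B"
    proof (rule young_conj_le_dyadic[OF c])
      fix m
      have "ennreal (s * dyadic m - c (dyadic m)) \<le> ennreal (s * selector c s (Suc m) - c (selector c s (Suc m)))"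
        by (rule ennreal_leI) (rule selector_ge)
      also have "\<dots> \<le> ?S" by (rule SUP_upper) simp
      finally show "s * dyadic m - c (dyadic m) \<le> B" using real by (simp add: ennreal_le_iff)
    qed
    then show ?thesis unfolding real(2) by (rule ennreal_leI)
  qed (simp only: top_greatest)
qed

lemma selector_value_nonneg: "young c \<Longrightarrow> 0 \<le> s * selector c s n - c (selector c s n)"
  using incseqD[OF selector_incseq[of s c], of 0 n] by (simp add: young_0)

text \<open>A new candidate is taken only if it is strictly better, and for s = 0 none beats 0. This
  covers the points where \<open>p\<close> vanishes and gives no direction.\<close>

lemma selector_0: "young c \<Longrightarrow> selector c 0 n = 0"
  proof (induction n)
  case (Suc n)
  then show ?case using young_nonneg[OF Suc.prems dyadic_nonneg, of n] by (simp add: young_0)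
qed simp

subsection \<open>Musielak-Orlicz spaces\<close>

locale musielak_orlicz =
  fixes \<Omega> :: "'a::euclidean_space set" and \<phi> :: "'a \<Rightarrow> real \<Rightarrow> real"
  assumes open_\<Omega>: "open \<Omega>" and bounded_\<Omega>: "bounded \<Omega>"
    and standing: "standing_assumptions \<Omega> \<phi>"
begin

abbreviation M :: "'a measure" where "M \<equiv> lebesgue_on \<Omega>"
abbreviation X :: "('a \<Rightarrow> real) set" where "X \<equiv> X_space \<Omega> \<phi>"
abbreviation Y :: "('a \<Rightarrow> 'a) set" where "Y \<equiv> Y_space \<Omega> \<phi>"
abbreviation grad :: "('a \<Rightarrow> real) \<Rightarrow> 'a \<Rightarrow> 'a" where "grad \<equiv> weak_grad \<Omega>"
abbreviation Ystar :: "('a \<Rightarrow> 'a) set" where "Ystar \<equiv> MO_space \<Omega> (conj_fun \<phi>)"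

lemma sets_\<Omega>: "\<Omega> \<in> sets lebesgue" using open_\<Omega> by simp

sublocale finite_measure M
  using bounded_\<Omega> open_\<Omega> by (intro finite_measure_lebesgue_on) (simp add: bounded_set_imp_lmeasurable)

sublocale complete_measure M
  by (rule complete_measure_lebesgue_on[OF sets_\<Omega>])

text \<open>For each natural slope k the limit of the essential infima supplies one t that serves
  almost every x, so only countably many null sets are discarded.\<close>

lemma AE_young: "AE x in M. young (\<phi> x)"
proof -
  have lim: "((\<lambda>t. Liminf (ae_filter M) (\<lambda>x. ereal (\<phi> x t / t))) \<longlongrightarrow> \<infinity>) at_top"
    and ae: "AE x in M. convex_on {0..} (\<phi> x) \<and> mono_on {0..} (\<phi> x) \<and>
        continuous_on {0..} (\<phi> x) \<and> \<phi> x 0 = 0"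
    using standing by (auto simp: standing_assumptions_def)
  have "AE x in M. \<exists>t>0. real k * t \<le> \<phi> x t" for k
  proof -
    have "\<forall>\<^sub>F t in at_top. ereal (real k) < Liminf (ae_filter M) (\<lambda>x. ereal (\<phi> x t / t))"
      using lim by (rule order_tendstoD) simp
    moreover have "\<forall>\<^sub>F t in at_top. (t::real) > 0" by (rule eventually_gt_at_top)
    ultimately have "\<forall>\<^sub>F t in at_top. t > 0 \<and> ereal (real k) < Liminf (ae_filter M) (\<lambda>x. ereal (\<phi> x t / t))"
      by eventually_elim simp
    then obtain t where t: "t > 0" "ereal (real k) < Liminf (ae_filter M) (\<lambda>x. ereal (\<phi> x t / t))"
      using eventually_happens'[OF trivial_limit_at_top_linorder] by blast
    from less_LiminfD[OF t(2)] show ?thesis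
      by eventually_elim (use t(1) in \<open>auto simp: field_simps intro!: exI[of _ t]\<close>)
  qed
  then have "AE x in M. \<forall>k::nat. \<exists>t>0. real k * t \<le> \<phi> x t" by (simp add: AE_all_countable)
  with ae show ?thesis by eventually_elim (simp add: young_def)
qed

lemma AE_doubling:
  obtains D where "D \<ge> 1" "\<And>n. AE x in M. \<forall>t\<ge>0. \<phi> x (2 ^ n * t) \<le> D ^ n * \<phi> x t"
proof -
  obtain C where C: "AE x in M. \<forall>t\<ge>0. \<phi> x (2 * t) \<le> C * \<phi> x t"
    using standing by (auto simp: standing_assumptions_def)
  \<comment> \<open>A constant of at least 1 is nonnegative, as the iteration needs when it
    multiplies inequalities by it.\<close>
  define D where "D = max C 1"
  have "AE x in M. \<forall>t\<ge>0. \<phi> x (2 ^ n * t) \<le> D ^ n * \<phi> x t" for n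
    using C AE_young
  proof eventually_elim
    case (elim x)
    have step: "\<phi> x (2 * t) \<le> D * \<phi> x t" if t: "t \<ge> 0" for t
    proof -
      have "\<phi> x (2 * t) \<le> C * \<phi> x t" using elim(1) t by blast
      also have "\<dots> \<le> D * \<phi> x t"
        using young_nonneg[OF elim(2) t] by (intro mult_right_mono) (simp_all add: D_def)
      finally show ?thesis .
    qed
    show ?case
    proof (induction n)
      case (Suc n)
      show ?case
      proof (intro allI impI)
        fix t :: real assume t: "t \<ge> 0"
        have "\<phi> x (2 * (2 ^ n * t)) \<le> D * \<phi> x (2 ^ n * t)" using t by (intro step) simp
        also have "\<dots> \<le> D * (D ^ n * \<phi> x t)" using Suc t by (intro mult_left_mono) (auto simp: D_def)
        finally show "\<phi> x (2 ^ Suc n * t) \<le> D ^ Suc n * \<phi> x t" by (simp add: mult.assoc)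
      qed
    qed simp
  qed
  then show thesis by (rule that[of D, rotated]) (simp add: D_def)
qed

lemma measurable_\<phi>[measurable]: "t \<ge> 0 \<Longrightarrow> (\<lambda>x. \<phi> x t) \<in> borel_measurable M"
  and integrable_\<phi>: "t \<ge> 0 \<Longrightarrow> integrable M (\<lambda>x. \<phi> x t)"
  using standing by (auto simp: standing_assumptions_def)

text \<open>Rounding \<tau> down to multiples of \<open>1 / 2 ^ n\<close> leaves countably many
  values, where measurability of \<phi> at fixed t suffices. Continuity in t gives the limit for
  almost every x.\<close>

lemma measurable_\<phi>_compose:
  assumes [measurable]: "\<tau> \<in> borel_measurable M" and nn: "\<And>x. \<tau> x \<ge> 0"
  shows "(\<lambda>x. \<phi> x (\<tau> x)) \<in> borel_measurable M"
proof -
  have m: "(\<lambda>x. \<phi> x (dyadic_floor n (\<tau> x))) \<in> borel_measurable M" for n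
    unfolding dyadic_floor_def
  proof (rule measurable_compose_countable[where f="\<lambda>k x. \<phi> x (real k / 2 ^ n)" and g="\<lambda>x. nat \<lfloor>2 ^ n * \<tau> x\<rfloor>"])
    show "(\<lambda>x. nat \<lfloor>2 ^ n * \<tau> x\<rfloor>) \<in> measurable M (count_space UNIV)" by measurable
  qed (rule measurable_\<phi>, simp)
  have "(\<lambda>x. lim (\<lambda>n. \<phi> x (dyadic_floor n (\<tau> x)))) \<in> borel_measurable M"
    using m by measurable
  moreover have "AE x in M. lim (\<lambda>n. \<phi> x (dyadic_floor n (\<tau> x))) = \<phi> x (\<tau> x)"
    using AE_young
  proof eventually_elim
    case (elim x)
    show ?case
      by (rule limI, rule young_tendsto[OF elim dyadic_floor_tendsto[OF nn] dyadic_floor_nonneg nn])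
  qed
  ultimately show ?thesis by (rule borel_measurable_cong_AE)
qed

lemma measurable_\<phi>_norm[measurable]:
  "v \<in> borel_measurable M \<Longrightarrow> (\<lambda>x. \<phi> x (norm (v x))) \<in> borel_measurable M" for v :: "'a \<Rightarrow> 'a"
  by (rule measurable_\<phi>_compose) auto

lemma measurable_young_conj[measurable]:
  assumes [measurable]: "\<sigma> \<in> borel_measurable M"
  shows "(\<lambda>x. young_conj (\<phi> x) (\<sigma> x)) \<in> borel_measurable M"
proof -
  have [measurable]: "(\<lambda>x. \<phi> x (dyadic m)) \<in> borel_measurable M" for m
    by (rule measurable_\<phi>) (rule dyadic_nonneg)
  have "(\<lambda>x. real_of_ereal (SUP m. ereal (\<sigma> x * dyadic m - \<phi> x (dyadic m)))) \<in> borel_measurable M"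
    by measurable
  moreover have "AE x in M. real_of_ereal (SUP m. ereal (\<sigma> x * dyadic m - \<phi> x (dyadic m))) = young_conj (\<phi> x) (\<sigma> x)"
    using AE_young by eventually_elim (simp add: young_conj_eq_SUP_dyadic[symmetric])
  ultimately show ?thesis by (rule borel_measurable_cong_AE)
qed

text \<open>Real-valued modulars. A divergent integral would yield the default value 0, so
  integrability is always carried along separately.\<close>

definition rho :: "('a \<Rightarrow> 'a) \<Rightarrow> real" where "rho v = (LINT x|M. \<phi> x (norm (v x)))"
definition rho_conj :: "('a \<Rightarrow> 'a) \<Rightarrow> real" where "rho_conj p = (LINT x|M. young_conj (\<phi> x) (norm (p x)))"

lemma AE_\<phi>_norm_nonneg: "AE x in M. 0 \<le> \<phi> x (norm (v x))" for v :: "'a \<Rightarrow> 'a"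
  using AE_young by eventually_elim (simp add: young_nonneg)

lemma AE_young_conj_nonneg: "AE x in M. 0 \<le> young_conj (\<phi> x) (\<sigma> x)"
  using AE_young by eventually_elim (rule young_conj_nonneg)

lemma modular_\<phi>: "modular \<Omega> (\<lambda>x t. ereal (\<phi> x t)) v = (\<integral>\<^sup>+x. ennreal (\<phi> x (norm (v x))) \<partial>M)"
  by (simp add: modular_def)

lemma modular_conj: "modular \<Omega> (conj_fun \<phi>) p = (\<integral>\<^sup>+x. ennreal (young_conj (\<phi> x) (norm (p x))) \<partial>M)"
  unfolding modular_def
proof (rule nn_integral_cong_AE, use AE_young in eventually_elim)
  case (elim x)
  then show ?case by (simp add: conj_fun_def ereal_young_conj)
qed

lemma modular_\<phi>_integrable:
  assumes "integrable M (\<lambda>x. \<phi> x (norm (v x)))"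
  shows "modular \<Omega> (\<lambda>x t. ereal (\<phi> x t)) v = ennreal (rho v)"
  unfolding modular_\<phi> rho_def using assms AE_\<phi>_norm_nonneg by (rule nn_integral_eq_integral)

lemma modular_\<phi>_finite_iff:
  assumes [measurable]: "v \<in> borel_measurable M"
  shows "modular \<Omega> (\<lambda>x t. ereal (\<phi> x t)) v < \<infinity> \<longleftrightarrow> integrable M (\<lambda>x. \<phi> x (norm (v x)))"
proof
  assume "modular \<Omega> (\<lambda>x t. ereal (\<phi> x t)) v < \<infinity>"
  then show "integrable M (\<lambda>x. \<phi> x (norm (v x)))"
    unfolding modular_\<phi> by (intro integrableI_nonneg AE_\<phi>_norm_nonneg) auto
qed (simp add: modular_\<phi>_integrable)

lemma modular_conj_integrable:
  assumes "integrable M (\<lambda>x. young_conj (\<phi> x) (norm (p x)))"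
  shows "modular \<Omega> (conj_fun \<phi>) p = ennreal (rho_conj p)"
  unfolding modular_conj rho_conj_def using assms AE_young_conj_nonneg by (rule nn_integral_eq_integral)

lemma modular_conj_finite_iff:
  assumes [measurable]: "p \<in> borel_measurable M"
  shows "modular \<Omega> (conj_fun \<phi>) p < \<infinity> \<longleftrightarrow> integrable M (\<lambda>x. young_conj (\<phi> x) (norm (p x)))"
proof
  assume "modular \<Omega> (conj_fun \<phi>) p < \<infinity>"
  then show "integrable M (\<lambda>x. young_conj (\<phi> x) (norm (p x)))"
    unfolding modular_conj by (intro integrableI_nonneg AE_young_conj_nonneg) auto
qed (simp add: modular_conj_integrable)

lemma rho_nonneg: "0 \<le> rho v"
  unfolding rho_def by (rule integral_nonneg_AE) (rule AE_\<phi>_norm_nonneg)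

lemma rho_conj_nonneg: "0 \<le> rho_conj p"
  unfolding rho_conj_def by (rule integral_nonneg_AE) (rule AE_young_conj_nonneg)

text \<open>Doubling makes a modular that is finite at one scale finite at all scales, so
  \<open>Y\<close> is described by finiteness at scale one. The conjugate has no such property;
  elements of \<open>Ystar\<close> come with a scale of their own, as in
  \<open>YstarE\<close>.\<close>

lemma integrable_\<phi>_scale:
  fixes v :: "'a \<Rightarrow> 'a"
  assumes [measurable]: "v \<in> borel_measurable M" and int: "integrable M (\<lambda>x. \<phi> x (norm (v x)))"
  shows "integrable M (\<lambda>x. \<phi> x (norm (c *\<^sub>R v x)))"
proof -
  obtain D where D: "D \<ge> 1" "\<And>n. AE x in M. \<forall>t\<ge>0. \<phi> x (2 ^ n * t) \<le> D ^ n * \<phi> x t"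
    using AE_doubling by blast
  obtain n where n: "\<bar>c\<bar> < 2 ^ n" using real_arch_pow[of 2 "\<bar>c\<bar>"] by auto
  show ?thesis
  proof (rule Bochner_Integration.integrable_bound)
    show "integrable M (\<lambda>x. D ^ n * \<phi> x (norm (v x)))" using int by simp
    show "AE x in M. norm (\<phi> x (norm (c *\<^sub>R v x))) \<le> norm (D ^ n * \<phi> x (norm (v x)))"
      using D(2)[of n] AE_young
    proof eventually_elim
      case (elim x)
      have "\<phi> x (norm (c *\<^sub>R v x)) \<le> \<phi> x (2 ^ n * norm (v x))"
        using n by (intro young_mono[OF elim(2)]) (auto intro: mult_right_mono)
      also have "\<dots> \<le> D ^ n * \<phi> x (norm (v x))" using elim(1) by simp
      finally show ?case using young_nonneg[OF elim(2), of "norm (c *\<^sub>R v x)"] by simp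
    qed
  qed measurable
qed

lemma Y_iff: "v \<in> Y \<longleftrightarrow> v \<in> borel_measurable M \<and> integrable M (\<lambda>x. \<phi> x (norm (v x)))"
proof
  assume v: "v \<in> Y"
  then obtain l where l: "l > 0" "modular \<Omega> (\<lambda>x t. ereal (\<phi> x t)) (\<lambda>x. l *\<^sub>R v x) < \<infinity>"
    and [measurable]: "v \<in> borel_measurable M"
    by (auto simp: MO_space_def)
  have "integrable M (\<lambda>x. \<phi> x (norm (l *\<^sub>R v x)))"
    using l(2) by (subst (asm) modular_\<phi>_finite_iff) auto
  from integrable_\<phi>_scale[OF _ this, of "inverse l"] l(1)
  show "v \<in> borel_measurable M \<and> integrable M (\<lambda>x. \<phi> x (norm (v x)))" by simp
next
  assume "v \<in> borel_measurable M \<and> integrable M (\<lambda>x. \<phi> x (norm (v x)))"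
  then show "v \<in> Y"
    using modular_\<phi>_finite_iff[of v] by (auto simp: MO_space_def intro!: exI[of _ 1])
qed

lemma Y_measurable[measurable_dest]: "v \<in> Y \<Longrightarrow> v \<in> borel_measurable M"
  and Y_integrable: "v \<in> Y \<Longrightarrow> integrable M (\<lambda>x. \<phi> x (norm (v x)))"
  by (auto simp: Y_iff)

lemma Y_scale: "v \<in> Y \<Longrightarrow> (\<lambda>x. c *\<^sub>R v x) \<in> Y"
  using integrable_\<phi>_scale[of v c] by (auto simp: Y_iff simp del: norm_scaleR)

lemma Y_add:
  assumes v: "v \<in> Y" and w: "w \<in> Y" shows "(\<lambda>x. v x + w x) \<in> Y"
proof -
  have [measurable]: "v \<in> borel_measurable M" "w \<in> borel_measurable M"
    using v w by (auto dest: Y_measurable)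
  have "integrable M (\<lambda>x. \<phi> x (norm (v x + w x)))"
  proof (rule Bochner_Integration.integrable_bound)
    show "integrable M (\<lambda>x. \<phi> x (norm (2 *\<^sub>R v x)) + \<phi> x (norm (2 *\<^sub>R w x)))"
      using Y_scale[OF v, of 2] Y_scale[OF w, of 2] by (intro Bochner_Integration.integrable_add Y_integrable)
    show "AE x in M. norm (\<phi> x (norm (v x + w x))) \<le> norm (\<phi> x (norm (2 *\<^sub>R v x)) + \<phi> x (norm (2 *\<^sub>R w x)))"
      using AE_young
    proof eventually_elim
      case (elim x)
      have nn: "0 \<le> \<phi> x (norm z)" for z :: 'a by (rule young_nonneg[OF elim]) simp
      have tri: "norm (v x + w x) \<le> norm (v x) + norm (w x)" by (rule norm_triangle_ineq)
      have "\<phi> x (norm (v x + w x)) \<le> \<phi> x (norm (2 *\<^sub>R v x)) + \<phi> x (norm (2 *\<^sub>R w x))"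
      proof (cases "norm (v x) \<le> norm (w x)")
        case True
        then have "\<phi> x (norm (v x + w x)) \<le> \<phi> x (norm (2 *\<^sub>R w x))"
          using tri by (intro young_mono[OF elim]) auto
        then show ?thesis using nn[of "2 *\<^sub>R v x"] by linarith
      next
        case False
        then have "\<phi> x (norm (v x + w x)) \<le> \<phi> x (norm (2 *\<^sub>R v x))"
          using tri by (intro young_mono[OF elim]) auto
        then show ?thesis using nn[of "2 *\<^sub>R w x"] by linarith
      qed
      then show ?case using nn[of "v x + w x"] by simp
    qed
  qed measurable
  then show ?thesis by (simp add: Y_iff)
qed

lemma bounded_in_Y:
  assumes [measurable]: "v \<in> borel_measurable M" and B: "\<And>x. norm (v x) \<le> B"
  shows "v \<in> Y"
proof -
  have B0: "B \<ge> 0" using order_trans[OF norm_ge_zero B] .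
  have "integrable M (\<lambda>x. \<phi> x (norm (v x)))"
  proof (rule Bochner_Integration.integrable_bound[OF integrable_\<phi>[OF B0]])
    show "AE x in M. norm (\<phi> x (norm (v x))) \<le> norm (\<phi> x B)"
      using AE_young
    proof eventually_elim
      case (elim x)
      show ?case using young_nonneg[OF elim, of "norm (v x)"] young_mono[OF elim norm_ge_zero B, of x] by simp
    qed
  qed measurable
  then show ?thesis by (simp add: Y_iff)
qed

section \<open>The conjugate space, its pairing with \<open>Y\<close>, and the conjugate of
  \<open>G\<close>\<close>

lemma YstarE:
  assumes "p \<in> Ystar"
  obtains l where "l > 0" "p \<in> borel_measurable M" "integrable M (\<lambda>x. young_conj (\<phi> x) (norm (l *\<^sub>R p x)))"
proof -
  from assms obtain l where l: "l > 0" "modular \<Omega> (conj_fun \<phi>) (\<lambda>x. l *\<^sub>R p x) < \<infinity>"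
    and [measurable]: "p \<in> borel_measurable M"
    by (auto simp: MO_space_def)
  show thesis by (rule that[OF l(1)]) (use l(2) modular_conj_finite_iff[of "\<lambda>x. l *\<^sub>R p x"] in auto)
qed

lemma finite_modular_in_Ystar:
  "p \<in> borel_measurable M \<Longrightarrow> integrable M (\<lambda>x. young_conj (\<phi> x) (norm (p x))) \<Longrightarrow> p \<in> Ystar"
  using modular_conj_finite_iff[of p] by (auto simp: MO_space_def intro!: exI[of _ 1])

lemma Ystar_measurable[measurable_dest]: "p \<in> Ystar \<Longrightarrow> p \<in> borel_measurable M"
  by (simp add: MO_space_def)

lemma young_norm_bound:
  assumes "young (\<phi> x)"
  shows "norm (p x) * norm (v x) \<le> \<phi> x (norm (v x)) + young_conj (\<phi> x) (norm (p x))"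
  using young_inequality[OF assms, of "norm (v x)" "norm (p x)"] by simp

text \<open>Young's inequality is applied to \<open>l *\<^sub>R p x\<close>, at a scale l where the
  conjugate modular is finite, and then divided by l.\<close>

lemma integrable_norm_mult:
  assumes p: "p \<in> Ystar" and v: "v \<in> Y"
  shows "integrable M (\<lambda>x. norm (p x) * norm (v x))"
proof -
  obtain l where l: "l > 0" and [measurable]: "p \<in> borel_measurable M"
    and int: "integrable M (\<lambda>x. young_conj (\<phi> x) (norm (l *\<^sub>R p x)))"
    using YstarE[OF p] .
  have [measurable]: "v \<in> borel_measurable M" using v by (rule Y_measurable)
  show ?thesis
  proof (rule Bochner_Integration.integrable_bound)
    show "integrable M (\<lambda>x. (\<phi> x (norm (v x)) + young_conj (\<phi> x) (norm (l *\<^sub>R p x))) / l)"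
      using int Y_integrable[OF v] by (simp del: norm_scaleR)
    show "AE x in M. norm (norm (p x) * norm (v x)) \<le> norm ((\<phi> x (norm (v x)) + young_conj (\<phi> x) (norm (l *\<^sub>R p x))) / l)"
      using AE_young
    proof eventually_elim
      case (elim x)
      from young_norm_bound[OF elim, of "\<lambda>x. l *\<^sub>R p x" v]
      have "norm (p x) * norm (v x) \<le> (\<phi> x (norm (v x)) + young_conj (\<phi> x) (norm (l *\<^sub>R p x))) / l"
        using l by (simp add: field_simps)
      also have "\<dots> \<le> norm \<dots>" by (simp only: real_norm_def abs_ge_self)
      finally have "norm (p x) * norm (v x) \<le> norm ((\<phi> x (norm (v x)) + young_conj (\<phi> x) (norm (l *\<^sub>R p x))) / l)" .
      moreover have "norm (norm (p x) * norm (v x)) = norm (p x) * norm (v x)" by (simp add: abs_mult)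
      ultimately show ?case by (simp only:)
    qed
  qed measurable
qed

lemma integrable_inner:
  assumes p: "p \<in> Ystar" and v: "v \<in> Y"
  shows "integrable M (\<lambda>x. p x \<bullet> v x)"
proof -
  have [measurable]: "p \<in> borel_measurable M" "v \<in> borel_measurable M"
    using p v by (auto dest: Y_measurable Ystar_measurable)
  show ?thesis
    by (rule Bochner_Integration.integrable_bound[OF integrable_norm_mult[OF p v]])
      (auto simp: Cauchy_Schwarz_ineq2)
qed

text \<open>An infimum over the empty set would carry no information; lower bounds for the Luxemburg
  norm rest on this.\<close>

lemma luxemburg_set_nonempty:
  assumes v: "v \<in> Y"
  shows "\<exists>l>0. modular \<Omega> (\<lambda>x t. ereal (\<phi> x t)) (\<lambda>x. v x /\<^sub>R l) \<le> 1"
proof -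
  have [measurable]: "v \<in> borel_measurable M" using v by (rule Y_measurable)
  \<comment> \<open>By convexity and \<open>\<phi> x 0 = 0\<close> the modular of
    \<open>v / l\<close> is at most \<open>rho v / l\<close> when l is at least 1, and hence at most
    1 for this l.\<close>
  define l where "l = 1 + rho v"
  have l: "l \<ge> 1" "l > 0" using rho_nonneg[of v] by (auto simp: l_def)
  have Yl: "(\<lambda>x. v x /\<^sub>R l) \<in> Y" by (rule Y_scale[OF v])
  have "rho (\<lambda>x. v x /\<^sub>R l) \<le> (LINT x|M. inverse l * \<phi> x (norm (v x)))"
    unfolding rho_def
  proof (rule integral_mono_AE)
    show "AE x in M. \<phi> x (norm (v x /\<^sub>R l)) \<le> inverse l * \<phi> x (norm (v x))"
      using AE_young
    proof eventually_elim
      case (elim x)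
      show ?case using young_scale[OF elim, of "inverse l" "norm (v x)"] l by (simp add: inverse_le_1_iff)
    qed
  qed (use Y_integrable[OF Yl] Y_integrable[OF v] in auto)
  also have "\<dots> = rho v / l" by (simp add: rho_def divide_inverse mult.commute)
  also have "\<dots> \<le> 1" using l by (simp add: l_def)
  finally have "modular \<Omega> (\<lambda>x t. ereal (\<phi> x t)) (\<lambda>x. v x /\<^sub>R l) \<le> 1"
    unfolding modular_\<phi>_integrable[OF Y_integrable[OF Yl]] by simp
  then show ?thesis using l by blast
qed

text \<open>For each l admissible in the Luxemburg norm of \<open>v\<close>, Young's inequality for
  \<open>k p\<close> and \<open>v / l\<close>, multiplied by l/k, bounds the pairing by
  \<open>C * l\<close>. It remains to take the infimum over l.\<close>

theorem pairing_in_Y_dual: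
  assumes p: "p \<in> Ystar"
  shows "pairing \<Omega> p \<in> Y_dual \<Omega> \<phi>"
proof -
  obtain k where k: "k > 0" and [measurable]: "p \<in> borel_measurable M"
    and int: "integrable M (\<lambda>x. young_conj (\<phi> x) (norm (k *\<^sub>R p x)))"
    using YstarE[OF p] .
  define C where "C = (1 + rho_conj (\<lambda>x. k *\<^sub>R p x)) / k"
  have C: "C > 0" using k rho_conj_nonneg[of "\<lambda>x. k *\<^sub>R p x"] by (simp add: C_def add_pos_nonneg)
  have bound: "\<bar>pairing \<Omega> p v\<bar> \<le> C * luxemburg_norm \<Omega> (\<lambda>x t. ereal (\<phi> x t)) v" if v: "v \<in> Y" for v
  proof -
    have "\<bar>pairing \<Omega> p v\<bar> / C \<le> l"
      if l: "l > 0" "modular \<Omega> (\<lambda>x t. ereal (\<phi> x t)) (\<lambda>x. v x /\<^sub>R l) \<le> 1" for l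
    proof -
      have Yl: "(\<lambda>x. v x /\<^sub>R l) \<in> Y" by (rule Y_scale[OF v])
      have r1: "rho (\<lambda>x. v x /\<^sub>R l) \<le> 1"
        using l(2) unfolding modular_\<phi>_integrable[OF Y_integrable[OF Yl]] by simp
      have "\<bar>pairing \<Omega> p v\<bar> \<le> (LINT x|M. norm (p x) * norm (v x))"
        unfolding pairing_def
      proof (rule order_trans[OF integral_abs_bound integral_mono])
        show "\<bar>p x \<bullet> v x\<bar> \<le> norm (p x) * norm (v x)" for x by (rule Cauchy_Schwarz_ineq2)
      qed (use integrable_inner[OF p v] integrable_norm_mult[OF p v] in auto)
      also have "\<dots> \<le> (LINT x|M. (l / k) * (\<phi> x (norm (v x /\<^sub>R l)) + young_conj (\<phi> x) (norm (k *\<^sub>R p x))))"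
      proof (rule integral_mono_AE)
        show "AE x in M. norm (p x) * norm (v x) \<le> (l / k) * (\<phi> x (norm (v x /\<^sub>R l)) + young_conj (\<phi> x) (norm (k *\<^sub>R p x)))"
          using AE_young
        proof eventually_elim
          case (elim x)
          from young_norm_bound[OF elim, of "\<lambda>x. k *\<^sub>R p x" "\<lambda>x. v x /\<^sub>R l"]
          show ?case using k l(1) by (simp add: field_simps)
        qed
      qed (use integrable_norm_mult[OF p v] Y_integrable[OF Yl] int in \<open>auto simp del: norm_scaleR\<close>)
      also have "\<dots> = (l / k) * (rho (\<lambda>x. v x /\<^sub>R l) + rho_conj (\<lambda>x. k *\<^sub>R p x))"
        unfolding rho_def rho_conj_def using Y_integrable[OF Yl] int by (simp del: norm_scaleR)
      also have "\<dots> \<le> (l / k) * (1 + rho_conj (\<lambda>x. k *\<^sub>R p x))"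
        using r1 l(1) k by (intro mult_left_mono add_right_mono) auto
      finally have "\<bar>pairing \<Omega> p v\<bar> \<le> l * C" by (simp add: C_def)
      then show ?thesis using C by (simp add: field_simps)
    qed
    then have "\<bar>pairing \<Omega> p v\<bar> / C \<le> luxemburg_norm \<Omega> (\<lambda>x t. ereal (\<phi> x t)) v"
      unfolding luxemburg_norm_def using luxemburg_set_nonempty[OF v] by (intro cInf_greatest) auto
    then show ?thesis using C by (simp add: field_simps)
  qed
  have "pairing \<Omega> p (\<lambda>x. v x + w x) = pairing \<Omega> p v + pairing \<Omega> p w" if "v \<in> Y" "w \<in> Y" for v w
    using that integrable_inner[OF p] by (simp add: pairing_def inner_add_right)
  moreover have "pairing \<Omega> p (\<lambda>x. c *\<^sub>R v x) = c * pairing \<Omega> p v" if "v \<in> Y" for c v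
    using that integrable_inner[OF p] by (simp add: pairing_def)
  ultimately show ?thesis unfolding Y_dual_def using bound by blast
qed

lemma G_fun_Y: "v \<in> Y \<Longrightarrow> G_fun \<Omega> \<phi> v = ereal (rho v)"
  by (simp add: G_fun_def modular_\<phi>_integrable[OF Y_integrable] rho_nonneg enn2ereal_ennreal)

theorem fenchel_conj_modular:
  assumes p: "p \<in> Ystar"
  shows "fenchel_conj Y (G_fun \<Omega> \<phi>) (pairing \<Omega> p) = enn2ereal (modular \<Omega> (conj_fun \<phi>) p)"
proof (rule antisym)
  have pm[measurable]: "p \<in> borel_measurable M" using p by (rule Ystar_measurable)
  show "fenchel_conj Y (G_fun \<Omega> \<phi>) (pairing \<Omega> p) \<le> enn2ereal (modular \<Omega> (conj_fun \<phi>) p)"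
    unfolding fenchel_conj_def
  proof (rule SUP_least)
    fix v assume v: "v \<in> Y"
    show "ereal (pairing \<Omega> p v) - G_fun \<Omega> \<phi> v \<le> enn2ereal (modular \<Omega> (conj_fun \<phi>) p)"
    proof (cases "modular \<Omega> (conj_fun \<phi>) p < \<infinity>")
      case True
      then have int: "integrable M (\<lambda>x. young_conj (\<phi> x) (norm (p x)))"
        using modular_conj_finite_iff[OF pm] by blast
      have "pairing \<Omega> p v \<le> (LINT x|M. \<phi> x (norm (v x)) + young_conj (\<phi> x) (norm (p x)))"
        unfolding pairing_def
      proof (rule integral_mono_AE)
        show "AE x in M. p x \<bullet> v x \<le> \<phi> x (norm (v x)) + young_conj (\<phi> x) (norm (p x))"
          using AE_young
        proof eventually_elim
          case (elim x)
          show ?case using young_norm_bound[OF elim, of p v] norm_cauchy_schwarz[of "p x" "v x"] by linarith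
        qed
      qed (use integrable_inner[OF p v] Y_integrable[OF v] int in auto)
      also have "\<dots> = rho v + rho_conj p"
        unfolding rho_def rho_conj_def using Y_integrable[OF v] int by simp
      finally show ?thesis
        by (simp add: G_fun_Y[OF v] modular_conj_integrable[OF int] rho_conj_nonneg enn2ereal_ennreal)
    qed (auto simp: less_top[symmetric])
  qed
next
  have pm[measurable]: "p \<in> borel_measurable M" using p by (rule Ystar_measurable)
  let ?S = "fenchel_conj Y (G_fun \<Omega> \<phi>) (pairing \<Omega> p)"
  define \<tau> where "\<tau> n x = selector (\<phi> x) (norm (p x)) n" for n x
  have \<tau>nn: "\<tau> n x \<ge> 0" for n x by (simp add: \<tau>_def selector_nonneg)
  have \<tau>m[measurable]: "\<tau> n \<in> borel_measurable M" for n
  proof (induction n)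
    case 0
    then show ?case by (simp add: \<tau>_def[abs_def])
  next
    case (Suc n)
    note [measurable] = Suc
    have [measurable]: "(\<lambda>x. \<phi> x (\<tau> n x)) \<in> borel_measurable M"
      by (rule measurable_\<phi>_compose[OF Suc \<tau>nn])
    have [measurable]: "(\<lambda>x. \<phi> x (dyadic n)) \<in> borel_measurable M"
      by (rule measurable_\<phi>) (rule dyadic_nonneg)
    have eq: "\<tau> (Suc n) = (\<lambda>x. if norm (p x) * \<tau> n x - \<phi> x (\<tau> n x) < norm (p x) * dyadic n - \<phi> x (dyadic n)
        then dyadic n else \<tau> n x)"
      by (rule ext) (simp add: \<tau>_def)
    show ?case unfolding eq by measurable
  qed
  define val where "val n x = norm (p x) * \<tau> n x - \<phi> x (\<tau> n x)" for n x
  have [measurable]: "val n \<in> borel_measurable M" for n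
  proof -
    have [measurable]: "(\<lambda>x. \<phi> x (\<tau> n x)) \<in> borel_measurable M"
      by (rule measurable_\<phi>_compose[OF \<tau>m \<tau>nn])
    show ?thesis unfolding val_def[abs_def] by measurable
  qed
  \<comment> \<open>Parallel to \<open>p\<close> with length \<tau>, so that Cauchy-Schwarz is an
    equality. Division by zero makes the field vanish where \<open>p\<close> does.\<close>
  define v where "v n x = (\<tau> n x / norm (p x)) *\<^sub>R p x" for n x
  have vm[measurable]: "v n \<in> borel_measurable M" for n unfolding v_def[abs_def] by measurable
  \<comment> \<open>The fields are bounded, so pairing and modular are finite for each n, even when
    the conjugate modular of \<open>p\<close> is infinite and the integrals of \<open>val n\<close>
    are unbounded.\<close>
  have vY: "v n \<in> Y" for n
  proof (rule bounded_in_Y[OF vm])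
    show "norm (v n x) \<le> (\<Sum>i<n. dyadic i)" for x
      using selector_le[of "\<phi> x" "norm (p x)" n] \<tau>nn[of n x] order_trans[OF \<tau>nn]
      by (cases "p x = 0") (auto simp: v_def \<tau>_def intro: sum_nonneg dyadic_nonneg)
  qed
  have val_eq: "AE x in M. val n x = p x \<bullet> v n x - \<phi> x (norm (v n x)) \<and> 0 \<le> val n x" for n
    using AE_young
  proof eventually_elim
    case (elim x)
    have "val n x = p x \<bullet> v n x - \<phi> x (norm (v n x))"
    proof (cases "p x = 0")
      case True
      then show ?thesis using selector_0[OF elim, of n] by (simp add: val_def v_def \<tau>_def)
    next
      case False
      have "p x \<bullet> v n x = norm (p x) * \<tau> n x"
        using False by (simp add: v_def power2_norm_eq_inner[symmetric] power2_eq_square)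
      moreover have "norm (v n x) = \<tau> n x" using False \<tau>nn[of n x] by (simp add: v_def)
      ultimately show ?thesis by (simp add: val_def)
    qed
    moreover have "0 \<le> val n x" using selector_value_nonneg[OF elim] by (simp add: val_def \<tau>_def)
    ultimately show ?case by simp
  qed
  have le: "(\<integral>\<^sup>+x. ennreal (val n x) \<partial>M) \<le> e2ennreal ?S" for n
  proof -
    have i: "integrable M (\<lambda>x. p x \<bullet> v n x - \<phi> x (norm (v n x)))"
      by (intro Bochner_Integration.integrable_diff integrable_inner p vY Y_integrable)
    then have "integrable M (val n)"
      by (subst integrable_cong_AE) (use val_eq[of n] in auto)
    then have "(\<integral>\<^sup>+x. ennreal (val n x) \<partial>M) = ennreal (LINT x|M. val n x)"
      using val_eq[of n] by (intro nn_integral_eq_integral) auto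
    also have "(LINT x|M. val n x) = (LINT x|M. p x \<bullet> v n x - \<phi> x (norm (v n x)))"
      by (rule integral_cong_AE) (use val_eq[of n] in auto)
    also have "\<dots> = pairing \<Omega> p (v n) - rho (v n)"
      unfolding pairing_def rho_def
      by (intro Bochner_Integration.integral_diff integrable_inner p vY Y_integrable)
    also have "ennreal \<dots> = e2ennreal (ereal (pairing \<Omega> p (v n) - rho (v n)))" by simp
    also have "\<dots> \<le> e2ennreal ?S"
    proof (rule e2ennreal_mono)
      have "ereal (pairing \<Omega> p (v n)) - G_fun \<Omega> \<phi> (v n) \<le> ?S"
        unfolding fenchel_conj_def by (rule SUP_upper[OF vY])
      then show "ereal (pairing \<Omega> p (v n) - rho (v n)) \<le> ?S" by (simp add: G_fun_Y[OF vY])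
    qed
    finally show ?thesis .
  qed
  have "modular \<Omega> (conj_fun \<phi>) p = (\<integral>\<^sup>+x. (SUP n. ennreal (val n x)) \<partial>M)"
    unfolding modular_conj
  proof (rule nn_integral_cong_AE, use AE_young in eventually_elim)
    case (elim x)
    from selector_SUP[OF elim, of "norm (p x)"] show ?case by (simp add: val_def \<tau>_def)
  qed
  also have "\<dots> = (SUP n. \<integral>\<^sup>+x. ennreal (val n x) \<partial>M)"
  proof (rule nn_integral_monotone_convergence_SUP)
    show "incseq (\<lambda>n x. ennreal (val n x))"
      unfolding incseq_def le_fun_def val_def \<tau>_def
      using incseqD[OF selector_incseq] by (auto intro!: ennreal_leI)
  qed measurable
  also have "\<dots> \<le> e2ennreal ?S" by (rule SUP_least) (rule le)
  finally have "enn2ereal (modular \<Omega> (conj_fun \<phi>) p) \<le> enn2ereal (e2ennreal ?S)"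
    by (simp add: less_eq_ennreal.rep_eq)
  \<comment> \<open>\<open>e2ennreal\<close> would cut off a negative value; the competitor v = 0
    shows that \<open>?S\<close> is nonnegative.\<close>
  also have "\<dots> = ?S"
  proof -
    have zY: "(\<lambda>_. 0) \<in> Y" by (rule bounded_in_Y[where B=0]) auto
    have "rho (\<lambda>_. 0) = 0"
    proof -
      have "rho (\<lambda>_. 0) = (LINT x|M. 0)"
        unfolding rho_def using Y_measurable[OF zY]
        by (intro integral_cong_AE measurable_\<phi>_norm) (use AE_young in \<open>auto elim: eventually_mono simp: young_0\<close>)
      then show ?thesis by simp
    qed
    moreover have "ereal (pairing \<Omega> p (\<lambda>_. 0)) - G_fun \<Omega> \<phi> (\<lambda>_. 0) \<le> ?S"
      unfolding fenchel_conj_def by (rule SUP_upper[OF zY])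
    ultimately have "0 \<le> ?S" by (simp add: G_fun_Y[OF zY] pairing_def zero_ereal_def)
    then show ?thesis by (rule enn2ereal_e2ennreal)
  qed
  finally show "enn2ereal (modular \<Omega> (conj_fun \<phi>) p) \<le> ?S" .
qed

end

subsection \<open>The space \<open>X\<close>\<close>

context musielak_orlicz
begin

lemma test_mult_integrable:
  assumes h: "integrable M h" and \<zeta>: "\<zeta> \<in> test_functions \<Omega>"
  shows "integrable M (\<lambda>x. h x * \<zeta> x)"
    and "e \<in> Basis \<Longrightarrow> integrable M (\<lambda>x. h x * pderivative e \<zeta> x)"
proof -
  have *: "integrable M (\<lambda>x. h x * g x)"
    if c: "continuous_on UNIV g" and z: "\<And>x. x \<notin> \<Omega> \<Longrightarrow> g x = 0" for g :: "'a \<Rightarrow> real"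
  proof -
    obtain B where B: "\<And>x. \<bar>g x\<bar> \<le> B"
      using bounded_range_continuous_vanishing_outside[OF c bounded_\<Omega> z] by blast
    have B0: "0 \<le> B" using order_trans[OF abs_ge_zero B] .
    have [measurable]: "h \<in> borel_measurable M" "g \<in> borel_measurable M"
      using h continuous_imp_borel_measurable_lebesgue_on[OF c] by auto
    show ?thesis
    proof (rule Bochner_Integration.integrable_bound)
      show "integrable M (\<lambda>x. \<bar>h x\<bar> * B)" using h by simp
      show "AE x in M. norm (h x * g x) \<le> norm (\<bar>h x\<bar> * B)"
        using B B0 by (auto intro!: AE_I2 mult_left_mono simp: abs_mult)
    qed measurable
  qed
  show "integrable M (\<lambda>x. h x * \<zeta> x)" by (rule *[OF test_functionD(2,5)[OF \<zeta>]])
  show "e \<in> Basis \<Longrightarrow> integrable M (\<lambda>x. h x * pderivative e \<zeta> x)"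
    by (rule *[OF test_functionD(4,6)[OF \<zeta>]])
qed

lemma integrable_inner_Basis: "integrable M g \<Longrightarrow> integrable M (\<lambda>x. g x \<bullet> e)"
  for g :: "'a \<Rightarrow> 'a"
  by (rule integrable_inner_left)

text \<open>\<open>weak_grad\<close> is an arbitrary choice; uniqueness off a null set lets it be
  computed from any candidate. The fundamental lemma is applied to each component.\<close>

lemma weak_gradient_unique:
  assumes g: "has_weak_gradient \<Omega> u g" and g': "has_weak_gradient \<Omega> u g'"
  shows "AE x in M. g x = g' x"
proof -
  have int: "integrable M g" "integrable M g'" using g g' by (auto simp: has_weak_gradient_def)
  have "AE x in M. g x \<bullet> e - g' x \<bullet> e = 0" if e: "e \<in> Basis" for e
  proof (rule AE_zero_if_test_integrals_zero[OF open_\<Omega>])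
    show "integrable M (\<lambda>x. g x \<bullet> e - g' x \<bullet> e)"
      by (intro Bochner_Integration.integrable_diff integrable_inner_Basis int)
    fix \<zeta> assume \<zeta>: "\<zeta> \<in> test_functions \<Omega>"
    have i: "integrable M (\<lambda>x. (g x \<bullet> e) * \<zeta> x)" "integrable M (\<lambda>x. (g' x \<bullet> e) * \<zeta> x)"
      by (intro test_mult_integrable(1)[OF _ \<zeta>] integrable_inner_Basis int)+
    have "(LINT x|M. (g x \<bullet> e - g' x \<bullet> e) * \<zeta> x) = (LINT x|M. (g x \<bullet> e) * \<zeta> x) - (LINT x|M. (g' x \<bullet> e) * \<zeta> x)"
      using Bochner_Integration.integral_diff[OF i] by (simp add: left_diff_distrib)
    also have "\<dots> = 0"
    proof -
      have "(LINT x|M. u x * pderivative e \<zeta> x) = - (LINT x|M. (g x \<bullet> e) * \<zeta> x)"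
        "(LINT x|M. u x * pderivative e \<zeta> x) = - (LINT x|M. (g' x \<bullet> e) * \<zeta> x)"
        using g g' \<zeta> e unfolding has_weak_gradient_def by blast+
      then show ?thesis by linarith
    qed
    finally show "(LINT x|M. (g x \<bullet> e - g' x \<bullet> e) * \<zeta> x) = 0" .
  qed
  then have "AE x in M. \<forall>e\<in>Basis. g x \<bullet> e - g' x \<bullet> e = 0"
    by (intro AE_ball_countable' countable_finite finite_Basis)
  then show ?thesis by eventually_elim (auto intro: euclidean_eqI)
qed

lemma X_D:
  assumes "u \<in> X"
  shows "has_weak_gradient \<Omega> u (grad u)" "u \<in> sqint M" "grad u \<in> Y"
proof -
  have "\<exists>g. has_weak_gradient \<Omega> u g" using assms by (auto simp: X_space_def W11_def)
  then show w: "has_weak_gradient \<Omega> u (grad u)" unfolding weak_grad_def by (rule someI_ex)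
  show "u \<in> sqint M" using assms by (simp add: X_space_def L2_eq_sqint)
  have [measurable]: "grad u \<in> borel_measurable M" using w by (auto simp: has_weak_gradient_def)
  have "modular \<Omega> (\<lambda>x t. ereal (\<phi> x t)) (grad u) < \<infinity>" using assms by (simp add: X_space_def)
  then show "grad u \<in> Y" using modular_\<phi>_finite_iff[of "grad u"] by (simp add: Y_iff)
qed

lemma X_I:
  assumes w: "has_weak_gradient \<Omega> u g" and u: "u \<in> sqint M" and g: "g \<in> Y"
  shows "u \<in> X" "AE x in M. grad u x = g x"
proof -
  have "has_weak_gradient \<Omega> u (grad u)" using w unfolding weak_grad_def by (rule someI[where P="has_weak_gradient \<Omega> u"])
  then show ae: "AE x in M. grad u x = g x" using w by (rule weak_gradient_unique)
  have "modular \<Omega> (\<lambda>x t. ereal (\<phi> x t)) (grad u) = modular \<Omega> (\<lambda>x t. ereal (\<phi> x t)) g"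
    unfolding modular_\<phi> by (rule nn_integral_cong_AE) (use ae in \<open>eventually_elim, simp\<close>)
  also have "\<dots> < \<infinity>" using modular_\<phi>_finite_iff[of g] g by (simp add: Y_iff)
  finally show "u \<in> X" using u w by (auto simp: X_space_def L2_eq_sqint W11_def)
qed

lemma has_weak_gradient_add_scale:
  assumes u: "has_weak_gradient \<Omega> u g" and v: "has_weak_gradient \<Omega> v h"
  shows "has_weak_gradient \<Omega> (\<lambda>x. u x + c * v x) (\<lambda>x. g x + c *\<^sub>R h x)"
proof -
  have int: "integrable M u" "integrable M v" "integrable M g" "integrable M h"
    using u v by (auto simp: has_weak_gradient_def)
  have "(LINT x|M. (u x + c * v x) * pderivative e \<zeta> x) = - (LINT x|M. ((g x + c *\<^sub>R h x) \<bullet> e) * \<zeta> x)"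
    if \<zeta>: "\<zeta> \<in> test_functions \<Omega>" and e: "e \<in> Basis" for \<zeta> e
  proof -
    have "(LINT x|M. (u x + c * v x) * pderivative e \<zeta> x) =
        (LINT x|M. u x * pderivative e \<zeta> x + c * (v x * pderivative e \<zeta> x))"
      by (simp add: algebra_simps)
    also have "\<dots> = (LINT x|M. u x * pderivative e \<zeta> x) + c * (LINT x|M. v x * pderivative e \<zeta> x)"
      using test_mult_integrable(2)[OF int(1) \<zeta> e] test_mult_integrable(2)[OF int(2) \<zeta> e] by simp
    also have "\<dots> = - ((LINT x|M. (g x \<bullet> e) * \<zeta> x) + c * (LINT x|M. (h x \<bullet> e) * \<zeta> x))"
      using u v \<zeta> e by (simp add: has_weak_gradient_def)
    also have "(LINT x|M. (g x \<bullet> e) * \<zeta> x) + c * (LINT x|M. (h x \<bullet> e) * \<zeta> x) =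
        (LINT x|M. (g x \<bullet> e) * \<zeta> x + c * ((h x \<bullet> e) * \<zeta> x))"
      using test_mult_integrable(1)[OF integrable_inner_Basis[OF int(3)] \<zeta>]
        test_mult_integrable(1)[OF integrable_inner_Basis[OF int(4)] \<zeta>] by simp
    also have "\<dots> = (LINT x|M. ((g x + c *\<^sub>R h x) \<bullet> e) * \<zeta> x)"
      by (simp add: inner_add_left algebra_simps)
    finally show ?thesis .
  qed
  then show ?thesis using int by (simp add: has_weak_gradient_def)
qed

lemma X_add_scale:
  assumes u: "u \<in> X" and v: "v \<in> X"
  shows "(\<lambda>x. u x + c * v x) \<in> X" "AE x in M. grad (\<lambda>x. u x + c * v x) x = grad u x + c *\<^sub>R grad v x"
  by (rule X_I[OF has_weak_gradient_add_scale[OF X_D(1)[OF u] X_D(1)[OF v]]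
      sqint_add_scale[OF X_D(2)[OF u] X_D(2)[OF v]] Y_add[OF X_D(3)[OF u] Y_scale[OF X_D(3)[OF v]]]])+

text \<open>This makes \<open>X\<close> rich enough to separate square integrable functions, and it
  turns identities tested against \<open>X\<close> into distributional ones.\<close>

lemma test_function_in_X:
  assumes \<zeta>: "\<zeta> \<in> test_functions \<Omega>"
  shows "\<zeta> \<in> X" "AE x in M. grad \<zeta> x = gradient \<zeta> x"
proof -
  have gc: "continuous_on UNIV (gradient \<zeta>)"
    unfolding gradient_def[abs_def] using test_functionD(4)[OF \<zeta>] by (intro continuous_intros) auto
  have [measurable]: "\<zeta> \<in> borel_measurable M" "gradient \<zeta> \<in> borel_measurable M"
    by (intro continuous_imp_borel_measurable_lebesgue_on gc test_functionD(2)[OF \<zeta>])+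
  obtain B where B: "\<And>x. \<bar>\<zeta> x\<bar> \<le> B"
    using bounded_range_continuous_vanishing_outside[OF test_functionD(2)[OF \<zeta>] bounded_\<Omega> test_functionD(5)[OF \<zeta>]] by blast
  obtain B' where B': "\<And>x. \<bar>norm (gradient \<zeta> x)\<bar> \<le> B'"
    using bounded_range_continuous_vanishing_outside[OF continuous_on_norm[OF gc] bounded_\<Omega>]
      test_functionD(6)[OF \<zeta>] by (auto simp: gradient_def)
  have B': "norm (gradient \<zeta> x) \<le> B'" for x using B'[of x] by simp
  have sq: "\<zeta> \<in> sqint M"
    unfolding sqint_def
  proof (intro CollectI conjI integrable_const_bound[where B="B\<^sup>2"])
    show "AE x in M. norm ((\<zeta> x)\<^sup>2) \<le> B\<^sup>2"
      using B by (auto intro!: AE_I2 abs_le_square_iff[THEN iffD1] order_trans[OF B abs_ge_self])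
  qed auto
  have w: "has_weak_gradient \<Omega> \<zeta> (gradient \<zeta>)"
    unfolding has_weak_gradient_def
  proof (intro conjI ballI)
    show "integrable M \<zeta>" by (rule sqint_imp_integrable[OF finite_measure_axioms sq])
    show "integrable M (gradient \<zeta>)" by (rule integrable_const_bound[where B=B']) (auto simp: B')
    fix \<eta> and e :: 'a assume "\<eta> \<in> test_functions \<Omega>" "e \<in> Basis"
    then show "(LINT x|M. \<zeta> x * pderivative e \<eta> x) = - (LINT x|M. (gradient \<zeta> x \<bullet> e) * \<eta> x)"
      using integral_by_parts_test_functions[OF open_\<Omega> bounded_\<Omega> \<zeta>] by (simp add: gradient_inner_Basis)
  qed
  have gY: "gradient \<zeta> \<in> Y" by (rule bounded_in_Y[OF _ B']) measurable
  show "\<zeta> \<in> X" "AE x in M. grad \<zeta> x = gradient \<zeta> x" by (rule X_I[OF w sq gY])+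
qed

lemma X_nonempty: "X \<noteq> {}"
proof -
  have "(\<lambda>_. 0) \<in> test_functions \<Omega>" by (auto simp: test_functions_def C_k_const)
  then show ?thesis using test_function_in_X(1) by blast
qed

lemma sqint_AE_eq:
  assumes g: "g \<in> sqint M" and h: "h \<in> sqint M"
    and eq: "\<And>u. u \<in> X \<Longrightarrow> (LINT x|M. g x * u x) = (LINT x|M. h x * u x)"
  shows "AE x in M. g x = h x"
proof -
  have "AE x in M. g x - h x = 0"
  proof (rule AE_zero_if_test_integrals_zero[OF open_\<Omega>])
    show "integrable M (\<lambda>x. g x - h x)"
      by (rule sqint_imp_integrable[OF finite_measure_axioms sqint_diff[OF g h]])
    fix \<zeta> assume "\<zeta> \<in> test_functions \<Omega>"
    then have \<zeta>: "\<zeta> \<in> X" by (rule test_function_in_X)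
    have i: "integrable M (\<lambda>x. g x * \<zeta> x)" "integrable M (\<lambda>x. h x * \<zeta> x)"
      using g h X_D(2)[OF \<zeta>] by (auto intro: sqint_mult_integrable)
    show "(LINT x|M. (g x - h x) * \<zeta> x) = 0"
      using eq[OF \<zeta>] Bochner_Integration.integral_diff[OF i] by (simp add: left_diff_distrib)
  qed
  then show ?thesis by eventually_elim simp
qed

lemma X_subset_sqint: "X \<subseteq> sqint M"
  using X_D(2) by blast

text \<open>The Riesz construction is applied to the functional given by \<open>g\<close> itself. It
  yields a limit \<open>h\<close> of elements of \<open>X\<close> that acts on \<open>X\<close> as
  \<open>g\<close> does; as \<open>X\<close> separates square integrable functions, \<open>h\<close>
  is \<open>g\<close>.\<close>

lemma X_dense:
  assumes g: "g \<in> sqint M"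
  obtains u where "\<And>n::nat. u n \<in> X" "(\<lambda>n. LINT x|M. (u n x - g x)\<^sup>2) \<longlonglongrightarrow> 0"
proof -
  have lin: "(LINT x|M. g x * (u x + c * v x)) = (LINT x|M. g x * u x) + c * (LINT x|M. g x * v x)"
    if "u \<in> X" "v \<in> X" for u v c
  proof -
    have i: "integrable M (\<lambda>x. g x * u x)" "integrable M (\<lambda>x. g x * v x)"
      using g X_D(2) that by (auto intro: sqint_mult_integrable)
    have "(LINT x|M. g x * (u x + c * v x)) = (LINT x|M. g x * u x + c * (g x * v x))"
      by (simp add: algebra_simps)
    then show ?thesis using i by simp
  qed
  have bdd: "(LINT x|M. g x * u x) - 1/2 * (LINT x|M. (u x)\<^sup>2) \<le> 1/2 * (LINT x|M. (g x)\<^sup>2)"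
    if "u \<in> X" for u
  proof -
    have "0 \<le> (LINT x|M. (g x + (-1) * u x)\<^sup>2)" by simp
    also have "\<dots> = (LINT x|M. (g x)\<^sup>2) - 2 * (LINT x|M. g x * u x) + (LINT x|M. (u x)\<^sup>2)"
      using integral_square_add_scale[OF g X_D(2)[OF that], of "-1"] by simp
    finally show ?thesis by simp
  qed
  obtain h u where h: "h \<in> sqint M" and u: "\<And>n. u n \<in> X"
    and lim: "(\<lambda>n. LINT x|M. (u n x - h x)\<^sup>2) \<longlonglongrightarrow> 0"
    and eq: "\<And>v. v \<in> X \<Longrightarrow> (LINT x|M. g x * v x) = (LINT x|M. h x * v x)"
    by (rule riesz_on_subspace[where L="\<lambda>u. LINT x|M. g x * u x", OF finite_measure_axioms X_subset_sqint X_nonempty X_add_scale(1) lin bdd]) (assumption | rule that)+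
  have ae: "AE x in M. g x = h x" by (rule sqint_AE_eq[OF g h eq])
  have "(LINT x|M. (u n x - h x)\<^sup>2) = (LINT x|M. (u n x - g x)\<^sup>2)" for n
  proof (rule integral_cong_AE)
    show "(\<lambda>x. (u n x - h x)\<^sup>2) \<in> borel_measurable M" "(\<lambda>x. (u n x - g x)\<^sup>2) \<in> borel_measurable M"
      using sqint_diff[OF X_D(2)[OF u[of n]] h] sqint_diff[OF X_D(2)[OF u[of n]] g] by (auto simp: sqint_def)
    show "AE x in M. (u n x - h x)\<^sup>2 = (u n x - g x)\<^sup>2" using ae by eventually_elim simp
  qed
  with lim u show thesis by (auto intro: that)
qed

lemma pairing_cong_AE:
  assumes "p \<in> borel_measurable M" "v \<in> borel_measurable M" "w \<in> borel_measurable M" "AE x in M. v x = w x"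
  shows "pairing \<Omega> p v = pairing \<Omega> p w"
  unfolding pairing_def
proof (rule integral_cong_AE)
  note assms(1-3)[measurable]
  show "(\<lambda>x. p x \<bullet> v x) \<in> borel_measurable M" "(\<lambda>x. p x \<bullet> w x) \<in> borel_measurable M" by measurable
  show "AE x in M. p x \<bullet> v x = p x \<bullet> w x" using assms(4) by eventually_elim simp
qed

lemma pairing_grad_add_scale:
  assumes p: "p \<in> Ystar" and u: "u \<in> X" and v: "v \<in> X"
  shows "pairing \<Omega> p (grad (\<lambda>x. u x + c * v x)) = pairing \<Omega> p (grad u) + c * pairing \<Omega> p (grad v)"
proof -
  have "pairing \<Omega> p (grad (\<lambda>x. u x + c * v x)) = pairing \<Omega> p (\<lambda>x. grad u x + c *\<^sub>R grad v x)"
  proof (rule pairing_cong_AE[OF Ystar_measurable[OF p] _ _ X_add_scale(2)[OF u v]])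
    show "grad (\<lambda>x. u x + c * v x) \<in> borel_measurable M"
      by (rule Y_measurable[OF X_D(3)[OF X_add_scale(1)[OF u v]]])
    show "(\<lambda>x. grad u x + c *\<^sub>R grad v x) \<in> borel_measurable M"
      by (rule Y_measurable[OF Y_add[OF X_D(3)[OF u] Y_scale[OF X_D(3)[OF v]]]])
  qed
  then show ?thesis
    using integrable_inner[OF p X_D(3)[OF u]] integrable_inner[OF p X_D(3)[OF v]]
    by (simp add: pairing_def inner_add_right)
qed

subsection \<open>The divergence\<close>

text \<open>Testing with all of \<open>X\<close> encodes both the distributional divergence (through
  test functions) and the vanishing normal component on the boundary. Having \<open>d\<close> as an
  argument avoids the choice hidden in \<open>divergence\<close>.\<close>

definition weak_div :: "('a \<Rightarrow> 'a) \<Rightarrow> ('a \<Rightarrow> real) \<Rightarrow> bool" where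
  "weak_div p d \<longleftrightarrow> d \<in> sqint M \<and> (\<forall>u\<in>X. pairing \<Omega> p (grad u) = - (LINT x|M. d x * u x))"

lemma weak_div_imp_has_L2_divergence:
  assumes p: "p \<in> Ystar" and d: "weak_div p d"
  shows "has_L2_divergence \<Omega> p d"
  unfolding has_L2_divergence_def L2_eq_sqint
proof (intro conjI ballI)
  show "d \<in> sqint M" using d by (simp add: weak_div_def)
  fix \<zeta> assume \<zeta>: "\<zeta> \<in> test_functions \<Omega>"
  note X = test_function_in_X[OF \<zeta>]
  have gc: "continuous_on UNIV (gradient \<zeta>)"
    unfolding gradient_def[abs_def] using test_functionD(4)[OF \<zeta>] by (intro continuous_intros) auto
  have "pairing \<Omega> p (gradient \<zeta>) = pairing \<Omega> p (grad \<zeta>)"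
    by (rule pairing_cong_AE[symmetric, OF Ystar_measurable[OF p] Y_measurable[OF X_D(3)[OF X(1)]]
        continuous_imp_borel_measurable_lebesgue_on[OF gc] X(2)])
  then show "(LINT x|M. p x \<bullet> gradient \<zeta> x) = - (LINT x|M. d x * \<zeta> x)"
    using d X(1) by (simp add: weak_div_def pairing_def)
qed

lemma has_L2_divergence_unique:
  assumes d: "has_L2_divergence \<Omega> p d" and d': "has_L2_divergence \<Omega> p d'"
  shows "AE x in M. d x = d' x"
proof -
  have s: "d \<in> sqint M" "d' \<in> sqint M" using d d' by (auto simp: has_L2_divergence_def L2_eq_sqint)
  have "AE x in M. d x - d' x = 0"
  proof (rule AE_zero_if_test_integrals_zero[OF open_\<Omega>])
    show "integrable M (\<lambda>x. d x - d' x)"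
      by (rule sqint_imp_integrable[OF finite_measure_axioms sqint_diff[OF s]])
    fix \<zeta> assume \<zeta>: "\<zeta> \<in> test_functions \<Omega>"
    have i: "integrable M (\<lambda>x. d x * \<zeta> x)" "integrable M (\<lambda>x. d' x * \<zeta> x)"
      using s X_D(2)[OF test_function_in_X(1)[OF \<zeta>]] by (auto intro: sqint_mult_integrable)
    have "(LINT x|M. d x * \<zeta> x) = (LINT x|M. d' x * \<zeta> x)"
    proof -
      have "(LINT x|M. p x \<bullet> gradient \<zeta> x) = - (LINT x|M. d x * \<zeta> x)"
        "(LINT x|M. p x \<bullet> gradient \<zeta> x) = - (LINT x|M. d' x * \<zeta> x)"
        using d d' \<zeta> by (auto simp: has_L2_divergence_def)
      then show ?thesis by linarith
    qed
    then show "(LINT x|M. (d x - d' x) * \<zeta> x) = 0"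
      using Bochner_Integration.integral_diff[OF i] by (simp add: left_diff_distrib)
  qed
  then show ?thesis by eventually_elim simp
qed

lemma weak_div_cong_AE:
  assumes d: "weak_div p d" and d': "d' \<in> sqint M" and ae: "AE x in M. d x = d' x"
  shows "weak_div p d'"
  unfolding weak_div_def
proof (intro conjI ballI d')
  fix u assume u: "u \<in> X"
  have ds: "d \<in> sqint M" using d by (simp add: weak_div_def)
  have "(LINT x|M. d x * u x) = (LINT x|M. d' x * u x)"
    by (rule integral_cong_AE)
      (use ae sqint_mult_integrable[OF ds X_D(2)[OF u]] sqint_mult_integrable[OF d' X_D(2)[OF u]] in auto)
  then show "pairing \<Omega> p (grad u) = - (LINT x|M. d' x * u x)"
    using d u by (simp add: weak_div_def)
qed

lemma K_setD:
  assumes "p \<in> K_set \<Omega> \<phi>"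
  shows "p \<in> Ystar" "weak_div p (divergence \<Omega> p)"
proof -
  show "p \<in> Ystar" using assms by (simp add: K_set_def)
  have "\<exists>h. has_L2_divergence \<Omega> p h" using assms by (simp add: K_set_def)
  then have "has_L2_divergence \<Omega> p (divergence \<Omega> p)" unfolding divergence_def by (rule someI_ex)
  then show "weak_div p (divergence \<Omega> p)"
    using assms by (simp add: weak_div_def K_set_def has_L2_divergence_def L2_eq_sqint pairing_def)
qed

text \<open>Passes from an explicit divergence to the chosen representative, with which it agrees
  only off a null set.\<close>

lemma K_setI:
  assumes p: "p \<in> Ystar" and d: "weak_div p d"
  shows "p \<in> K_set \<Omega> \<phi>" "AE x in M. d x = divergence \<Omega> p x"
proof -
  have h: "has_L2_divergence \<Omega> p d" by (rule weak_div_imp_has_L2_divergence[OF p d])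
  then have h': "has_L2_divergence \<Omega> p (divergence \<Omega> p)" unfolding divergence_def by (rule someI[where P="has_L2_divergence \<Omega> p"])
  with h show ae: "AE x in M. d x = divergence \<Omega> p x" by (rule has_L2_divergence_unique)
  have "weak_div p (divergence \<Omega> p)"
    using h' by (intro weak_div_cong_AE[OF d _ ae]) (simp add: has_L2_divergence_def L2_eq_sqint)
  then show "p \<in> K_set \<Omega> \<phi>"
    using p h by (auto simp: K_set_def weak_div_def pairing_def)
qed

subsection \<open>The conjugate of the fidelity term\<close>

lemma F0_eq: "F0 \<Omega> f u = ereal (1/2 * (LINT x|M. (u x - f x)\<^sup>2))"
  by (simp add: F0_def L2_norm_def)

text \<open>Completing the square turns the objective into a constant minus half the squared
  distance of \<open>u\<close> from \<open>f + d\<close>. That point need not lie in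
  \<open>X\<close>, but density makes the supremum equal to the constant.\<close>

lemma fenchel_conj_F0:
  assumes f: "f \<in> sqint M" and d: "weak_div p d"
  shows "fenchel_conj X (F0 \<Omega> f) (\<lambda>u. - pairing \<Omega> p (grad u)) =
    ereal (1/2 * (LINT x|M. (d x)\<^sup>2) + (LINT x|M. f x * d x))"
proof -
  have ds: "d \<in> sqint M" using d by (simp add: weak_div_def)
  define C where "C = 1/2 * (LINT x|M. (d x)\<^sup>2) + (LINT x|M. f x * d x)"
  have fd: "(\<lambda>x. f x + d x) \<in> sqint M" using f ds by (rule sqint_add)
  have eq: "ereal (- pairing \<Omega> p (grad u)) - F0 \<Omega> f u = ereal (C - 1/2 * (LINT x|M. (u x - (f x + d x))\<^sup>2))"
    if u: "u \<in> X" for u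
  proof -
    have us: "u \<in> sqint M" by (rule X_D(2)[OF u])
    have "(LINT x|M. (u x - (f x + d x))\<^sup>2) = (LINT x|M. ((u x - f x) + (-1) * d x)\<^sup>2)"
      by (simp add: algebra_simps)
    also have "\<dots> = (LINT x|M. (u x - f x)\<^sup>2) - 2 * (LINT x|M. (u x - f x) * d x) + (LINT x|M. (d x)\<^sup>2)"
      using integral_square_add_scale[OF sqint_diff[OF us f] ds, of "-1"] by simp
    also have "(LINT x|M. (u x - f x) * d x) = (LINT x|M. d x * u x) - (LINT x|M. f x * d x)"
      using Bochner_Integration.integral_diff[OF sqint_mult_integrable[OF ds us] sqint_mult_integrable[OF f ds]]
      by (simp add: left_diff_distrib mult.commute[of "d _" "u _"])
    moreover have "pairing \<Omega> p (grad u) = - (LINT x|M. d x * u x)" using d u by (simp add: weak_div_def)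
    ultimately have "- pairing \<Omega> p (grad u) - 1/2 * (LINT x|M. (u x - f x)\<^sup>2) =
        C - 1/2 * (LINT x|M. (u x - (f x + d x))\<^sup>2)"
      unfolding C_def by argo
    then show ?thesis by (simp add: F0_eq)
  qed
  have "fenchel_conj X (F0 \<Omega> f) (\<lambda>u. - pairing \<Omega> p (grad u)) = ereal C"
  proof (rule antisym)
    show "fenchel_conj X (F0 \<Omega> f) (\<lambda>u. - pairing \<Omega> p (grad u)) \<le> ereal C"
      unfolding fenchel_conj_def by (rule SUP_least) (simp add: eq)
    obtain u where u: "\<And>n::nat. u n \<in> X" and lim: "(\<lambda>n. LINT x|M. (u n x - (f x + d x))\<^sup>2) \<longlonglongrightarrow> 0"
      using X_dense[OF fd] by blast
    have "(\<lambda>n. ereal (C - 1/2 * (LINT x|M. (u n x - (f x + d x))\<^sup>2))) \<longlonglongrightarrow> ereal (C - 1/2 * 0)"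
      by (intro tendsto_intros lim)
    moreover have "ereal (C - 1/2 * (LINT x|M. (u n x - (f x + d x))\<^sup>2)) \<le>
        fenchel_conj X (F0 \<Omega> f) (\<lambda>u. - pairing \<Omega> p (grad u))" for n
      unfolding fenchel_conj_def eq[OF u, symmetric] by (rule SUP_upper[OF u])
    ultimately show "ereal C \<le> fenchel_conj X (F0 \<Omega> f) (\<lambda>u. - pairing \<Omega> p (grad u))"
      by (auto intro: LIMSEQ_le_const2)
  qed
  then show ?thesis by (simp add: C_def)
qed

text \<open>A finite conjugate says that \<open>- pairing \<Omega> p (grad u)\<close> is bounded
  above by a quadratic in \<open>u\<close>, which is exactly the hypothesis \<open>bdd\<close> of
  the Riesz lemma.\<close>

lemma fenchel_conj_F0_finite_imp_weak_div:
  assumes f: "f \<in> sqint M" and p: "p \<in> Ystar"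
    and fin: "fenchel_conj X (F0 \<Omega> f) (\<lambda>u. - pairing \<Omega> p (grad u)) \<noteq> \<infinity>"
  obtains d where "weak_div p d"
proof -
  let ?S = "fenchel_conj X (F0 \<Omega> f) (\<lambda>u. - pairing \<Omega> p (grad u))"
  have up: "ereal (- pairing \<Omega> p (grad u) - 1/2 * (LINT x|M. (u x - f x)\<^sup>2)) \<le> ?S" if u: "u \<in> X" for u
  proof -
    have "ereal (- pairing \<Omega> p (grad u)) - F0 \<Omega> f u \<le> ?S"
      unfolding fenchel_conj_def by (rule SUP_upper[OF u])
    then show ?thesis by (simp add: F0_eq)
  qed
  obtain B where B: "\<And>u. u \<in> X \<Longrightarrow> - pairing \<Omega> p (grad u) - 1/2 * (LINT x|M. (u x - f x)\<^sup>2) \<le> B"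
    using up fin by (cases ?S) auto
  \<comment> \<open>The linear term of the square of \<open>u - f\<close> is absorbed here, leaving
    a pure square; it is removed again by subtracting \<open>f\<close> from the representative
    \<open>h\<close>.\<close>
  define L where "L u = - pairing \<Omega> p (grad u) + (LINT x|M. f x * u x)" for u
  have fint: "integrable M (\<lambda>x. f x * u x)" if "u \<in> X" for u
    by (rule sqint_mult_integrable[OF f X_D(2)[OF that]])
  have lin: "L (\<lambda>x. u x + c * v x) = L u + c * L v" if "u \<in> X" "v \<in> X" for u v c
  proof -
    have "(LINT x|M. f x * (u x + c * v x)) = (LINT x|M. f x * u x + c * (f x * v x))"
      by (simp add: algebra_simps)
    also have "\<dots> = (LINT x|M. f x * u x) + c * (LINT x|M. f x * v x)"
      using fint[OF that(1)] fint[OF that(2)] by simp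
    finally show ?thesis
      using pairing_grad_add_scale[OF p that] by (simp add: L_def algebra_simps)
  qed
  have bdd: "L u - 1/2 * (LINT x|M. (u x)\<^sup>2) \<le> B + 1/2 * (LINT x|M. (f x)\<^sup>2)" if u: "u \<in> X" for u
  proof -
    have "(LINT x|M. (u x - f x)\<^sup>2) = (LINT x|M. (u x)\<^sup>2) - 2 * (LINT x|M. f x * u x) + (LINT x|M. (f x)\<^sup>2)"
      using integral_square_add_scale[OF X_D(2)[OF u] f, of "-1"] by (simp add: mult.commute)
    then show ?thesis using B[OF u] unfolding L_def by argo
  qed
  obtain h where h: "h \<in> sqint M" and eq: "\<And>v. v \<in> X \<Longrightarrow> L v = (LINT x|M. h x * v x)"
    by (rule riesz_on_subspace[where L=L, OF finite_measure_axioms X_subset_sqint X_nonempty X_add_scale(1) lin bdd]) (assumption | rule that)+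
  have "weak_div p (\<lambda>x. h x - f x)"
    unfolding weak_div_def
  proof (intro conjI ballI sqint_diff[OF h f])
    fix u assume u: "u \<in> X"
    show "pairing \<Omega> p (grad u) = - (LINT x|M. (h x - f x) * u x)"
      using eq[OF u] Bochner_Integration.integral_diff[OF sqint_mult_integrable[OF h X_D(2)[OF u]] fint[OF u]]
      by (simp add: L_def left_diff_distrib)
  qed
  then show thesis by (rule that)
qed

theorem fenchel_dual_objective_eq:
  assumes f: "f \<in> sqint M" and p: "p \<in> Ystar"
  shows "fenchel_dual_objective X Y grad (F0 \<Omega> f) (G_fun \<Omega> \<phi>) (pairing \<Omega> p) =
    (if p \<in> K_set \<Omega> \<phi> then dual_functional \<Omega> \<phi> f p else - \<infinity>)"
proof (cases "p \<in> K_set \<Omega> \<phi>")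
  case True
  have "fenchel_conj X (F0 \<Omega> f) (\<lambda>u. - pairing \<Omega> p (grad u)) =
    ereal (1/2 * (LINT x|M. (divergence \<Omega> p x)\<^sup>2) + (LINT x|M. f x * divergence \<Omega> p x))"
    by (rule fenchel_conj_F0[OF f K_setD(2)[OF True]])
  then show ?thesis
    using True by (simp add: fenchel_dual_objective_def fenchel_conj_modular[OF p] dual_functional_def L2_norm_def)
next
  case False
  have "fenchel_conj X (F0 \<Omega> f) (\<lambda>u. - pairing \<Omega> p (grad u)) = \<infinity>"
    using fenchel_conj_F0_finite_imp_weak_div[OF f p] K_setI(1)[OF p] False by metis
  \<comment> \<open>The modular is nonnegative, so the subtraction meets no opposite
    infinities.\<close>
  moreover have "- \<infinity> - enn2ereal a = - \<infinity>" for a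
    by (cases a) (auto simp: top_ennreal.rep_eq enn2ereal_ennreal)
  ultimately show ?thesis
    using False by (simp add: fenchel_dual_objective_def fenchel_conj_modular[OF p])
qed

end

subsection \<open>Existence of a maximizer\<close>

text \<open>The norm is affine along rays, hence not strictly convex. The 1 under the root repairs
  this and keeps the linear growth.\<close>

definition bracket :: "'b::real_inner \<Rightarrow> real" where
  "bracket a = sqrt (1 + (norm a)\<^sup>2)"

lemma bracket_ge_1: "1 \<le> bracket a"
  by (simp add: bracket_def)

lemma bracket_le: "bracket a \<le> 1 + norm a"
  unfolding bracket_def by (rule real_le_lsqrt) (auto simp: power2_eq_square algebra_simps)

lemma bracket_square: "(bracket a)\<^sup>2 = 1 + a \<bullet> a"
  by (simp add: bracket_def power2_norm_eq_inner)

text \<open>A quantitative form of the strict convexity of \<open>bracket\<close>, from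
  \<open>(1 + |a|\<^sup>2) (1 + |b|\<^sup>2) - (1 + a \<bullet> b)\<^sup>2 \<ge> |a - b|\<^sup>2\<close>.\<close>

lemma bracket_gap:
  fixes a b :: "'b::real_inner"
  shows "(norm (a - b))\<^sup>2 \<le>
    4 * (bracket a + bracket b) ^ 3 * ((bracket a + bracket b) / 2 - bracket ((1/2) *\<^sub>R (a + b)))"
proof -
  define A B N where "A = bracket a" and "B = bracket b" and "N = bracket ((1/2) *\<^sub>R (a + b))"
  have A: "A \<ge> 1" and B: "B \<ge> 1" and N: "N \<ge> 1" by (auto simp: A_def B_def N_def bracket_ge_1)
  have A2: "A\<^sup>2 = 1 + a \<bullet> a" and B2: "B\<^sup>2 = 1 + b \<bullet> b"
    and N2: "4 * N\<^sup>2 = 4 + a \<bullet> a + 2 * (a \<bullet> b) + b \<bullet> b"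
    by (auto simp: A_def B_def N_def bracket_square inner_add_left inner_add_right inner_commute)
  define c where "c = a \<bullet> b"
  have dd: "(norm (a - b))\<^sup>2 = a \<bullet> a + b \<bullet> b - 2 * c"
    by (simp add: power2_norm_eq_inner inner_diff_left inner_diff_right inner_commute c_def)
  have CS: "c\<^sup>2 \<le> (a \<bullet> a) * (b \<bullet> b)" unfolding c_def by (rule Cauchy_Schwarz_ineq)
  have prod: "(A * B)\<^sup>2 = (1 + a \<bullet> a) * (1 + b \<bullet> b)" by (simp add: power_mult_distrib A2 B2)
  have sq: "(norm (a - b))\<^sup>2 \<le> (A * B)\<^sup>2 - (1 + c)\<^sup>2"
    unfolding dd prod using CS by (simp add: power2_eq_square algebra_simps)
  have "(1 + c)\<^sup>2 \<le> (A * B)\<^sup>2" using sq zero_le_power2[of "norm (a - b)"] by linarith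
  moreover have AB: "0 \<le> A * B" using A B by simp
  ultimately have cAB: "1 + c \<le> A * B" by (rule power2_le_imp_le)
  have "A * B + (1 + c) \<le> 2 * (A * B)" using cAB by simp
  then have "(A * B - (1 + c)) * (A * B + (1 + c)) \<le> (A * B - (1 + c)) * (2 * (A * B))"
    using cAB by (intro mult_left_mono) auto
  then have s1: "(norm (a - b))\<^sup>2 \<le> 2 * (A * B) * (A * B - (1 + c))"
    using sq by (simp add: power2_eq_square algebra_simps)
  \<comment> \<open>As a difference of squares the left side is
    \<open>(A + B - 2 * N) * (A + B + 2 * N)\<close>. Thus a bound in terms of
    \<open>A * B - (1 + c)\<close> becomes one in terms of the convexity gap, at the price of a
    factor linear in \<open>A + B\<close>.\<close>
  have diff: "(A + B)\<^sup>2 - 4 * N\<^sup>2 = 2 * (A * B - (1 + c))"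
    using A2 B2 N2 by (simp add: power2_eq_square algebra_simps c_def)
  then have "(2 * N)\<^sup>2 \<le> (A + B)\<^sup>2" using cAB by (simp add: power_mult_distrib)
  then have NAB: "2 * N \<le> A + B" by (rule power2_le_imp_le) (use A B in auto)
  have "2 * (A * B - (1 + c)) = (A + B - 2 * N) * (A + B + 2 * N)"
    using diff by (simp add: power2_eq_square algebra_simps)
  also have "\<dots> \<le> (A + B - 2 * N) * (2 * (A + B))"
    using NAB by (intro mult_left_mono) auto
  also have "\<dots> = 2 * (2 * (A + B) * ((A + B) / 2 - N))" by (simp add: field_simps)
  finally have s2: "A * B - (1 + c) \<le> 2 * (A + B) * ((A + B) / 2 - N)"
    by (rule mult_left_le_imp_le) simp
  have s3: "A * B \<le> (A + B)\<^sup>2" using A B by (simp add: power2_eq_square algebra_simps)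
  have g: "0 \<le> (A + B) / 2 - N" using NAB by simp
  have "(norm (a - b))\<^sup>2 \<le> 2 * (A * B) * (2 * (A + B) * ((A + B) / 2 - N))"
    using s1 s2 AB by (meson mult_left_mono mult_nonneg_nonneg order_trans zero_le_numeral)
  also have "\<dots> \<le> 2 * (A + B)\<^sup>2 * (2 * (A + B) * ((A + B) / 2 - N))"
    using s3 g A B by (intro mult_right_mono) auto
  also have "\<dots> = 4 * (A + B) ^ 3 * ((A + B) / 2 - N)"
    by (simp add: power2_eq_square power3_eq_cube)
  finally show ?thesis by (simp add: A_def B_def N_def)
qed

lemma bracket_gap_nonneg: "0 \<le> (bracket a + bracket b) / 2 - bracket ((1/2) *\<^sub>R (a + b))"
proof -
  have "0 \<le> 4 * (bracket a + bracket b) ^ 3 * ((bracket a + bracket b) / 2 - bracket ((1/2) *\<^sub>R (a + b)))"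
    using bracket_gap[of a b] zero_le_power2[of "norm (a - b)"] by linarith
  moreover have "0 < 4 * (bracket a + bracket b) ^ 3"
    using bracket_ge_1[of a] bracket_ge_1[of b] by simp
  ultimately show ?thesis by (simp add: zero_le_mult_iff)
qed

text \<open>The factor in \<open>bracket_gap\<close> is unbounded, so three cases are separated:
  large brackets are paid for by the last term, close points by \<delta>, and in the remaining case
  the squared distance is at most \<open>4 * K ^ 3\<close> times the gap while the distance exceeds
  \<delta>. Each term can be integrated.\<close>

lemma min_1_norm_diff_le:
  fixes a b :: "'b::real_inner"
  assumes \<delta>: "\<delta> > 0" and K: "K > 0"
  shows "min 1 (norm (a - b)) \<le> \<delta> + 4 * K ^ 3 / \<delta> * ((bracket a + bracket b) / 2 - bracket ((1/2) *\<^sub>R (a + b)))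
    + (bracket a + bracket b) / K"
proof -
  define g where "g = (bracket a + bracket b) / 2 - bracket ((1/2) *\<^sub>R (a + b))"
  define S where "S = bracket a + bracket b"
  have g: "0 \<le> g" unfolding g_def by (rule bracket_gap_nonneg)
  have S: "0 \<le> S" using bracket_ge_1[of a] bracket_ge_1[of b] by (simp add: S_def)
  have gap: "(norm (a - b))\<^sup>2 \<le> 4 * S ^ 3 * g" unfolding S_def g_def by (rule bracket_gap)
  have t2: "0 \<le> 4 * K ^ 3 / \<delta> * g" and t3: "0 \<le> S / K" using g S \<delta> K by auto
  have "min 1 (norm (a - b)) \<le> \<delta> + 4 * K ^ 3 / \<delta> * g + S / K"
  proof (cases "K \<le> S")
    case True
    then have "1 \<le> S / K" using K by simp
    moreover have "min 1 (norm (a - b)) \<le> 1" by simp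
    ultimately show ?thesis using \<delta> t2 by linarith
  next
    case False
    show ?thesis
    proof (cases "norm (a - b) \<le> \<delta>")
      case True
      then have "min 1 (norm (a - b)) \<le> \<delta>" by simp
      then show ?thesis using t2 t3 by linarith
    next
      case big: False
      have "S ^ 3 \<le> K ^ 3" using False S by (intro power_mono) auto
      then have "4 * S ^ 3 * g \<le> 4 * K ^ 3 * g" using g by (intro mult_right_mono) auto
      with gap have "norm (a - b) * norm (a - b) \<le> 4 * K ^ 3 * g" by (simp add: power2_eq_square)
      moreover have "\<delta> * norm (a - b) \<le> norm (a - b) * norm (a - b)"
        using big by (intro mult_right_mono) auto
      ultimately have "norm (a - b) \<le> 4 * K ^ 3 / \<delta> * g"
        using \<delta> by (simp add: field_simps)
      then have "min 1 (norm (a - b)) \<le> 4 * K ^ 3 / \<delta> * g" by simp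
      then show ?thesis using \<delta> t3 by linarith
    qed
  qed
  then show ?thesis by (simp add: g_def S_def)
qed

section \<open>Admissible fields: limits and midpoints\<close>

context musielak_orlicz
begin

text \<open>No fixed integrable function dominates the integrands. Up to \<epsilon> times a function
  of bounded integral they are, however, dominated by \<Psi>, and the part below \<Psi> tends to 0
  by dominated convergence.\<close>

lemma pairing_tendsto:
  assumes pm: "\<And>n::nat. p n \<in> borel_measurable M"
    and pi: "\<And>n. integrable M (\<lambda>x. young_conj (\<phi> x) (norm (p n x)))"
    and wm: "w \<in> borel_measurable M" and wi: "integrable M (\<lambda>x. young_conj (\<phi> x) (norm (w x)))"
    and R: "\<And>n. rho_conj (p n) \<le> R"
    and lim: "AE x in M. (\<lambda>n. p n x) \<longlonglongrightarrow> w x" and v: "v \<in> Y"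
  shows "(\<lambda>n. pairing \<Omega> (p n) v) \<longlonglongrightarrow> pairing \<Omega> w v"
proof -
  note pm[measurable] wm[measurable]
  have vm[measurable]: "v \<in> borel_measurable M" by (rule Y_measurable[OF v])
  have pY: "p n \<in> Ystar" for n by (rule finite_modular_in_Ystar[OF pm pi])
  have wY: "w \<in> Ystar" by (rule finite_modular_in_Ystar[OF wm wi])
  define g where "g n x = norm (p n x - w x) * norm (v x)" for n x
  have gm[measurable]: "g n \<in> borel_measurable M" for n unfolding g_def[abs_def] by measurable
  have gi: "integrable M (g n)" for n
  proof (rule Bochner_Integration.integrable_bound)
    show "integrable M (\<lambda>x. norm (p n x) * norm (v x) + norm (w x) * norm (v x))"
      using integrable_norm_mult[OF pY v] integrable_norm_mult[OF wY v] by simp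
    show "AE x in M. norm (g n x) \<le> norm (norm (p n x) * norm (v x) + norm (w x) * norm (v x))"
    proof (rule AE_I2)
      fix x
      have "norm (p n x - w x) * norm (v x) \<le> (norm (p n x) + norm (w x)) * norm (v x)"
        by (intro mult_right_mono norm_triangle_ineq4) simp
      then show "norm (g n x) \<le> norm (norm (p n x) * norm (v x) + norm (w x) * norm (v x))"
        by (simp add: g_def distrib_right)
    qed
  qed (rule gm)
  have diff: "\<bar>pairing \<Omega> (p n) v - pairing \<Omega> w v\<bar> \<le> (LINT x|M. g n x)" for n
  proof -
    have "pairing \<Omega> (p n) v - pairing \<Omega> w v = (LINT x|M. (p n x - w x) \<bullet> v x)"
      unfolding pairing_def using integrable_inner[OF pY v] integrable_inner[OF wY v]
      by (simp add: inner_diff_left)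
    also have "\<bar>\<dots>\<bar> \<le> (LINT x|M. \<bar>(p n x - w x) \<bullet> v x\<bar>)" by (rule integral_abs_bound)
    also have "\<dots> \<le> (LINT x|M. g n x)"
    proof (rule integral_mono)
      show "integrable M (\<lambda>x. \<bar>(p n x - w x) \<bullet> v x\<bar>)"
        using integrable_inner[OF pY v] integrable_inner[OF wY v] by (simp add: inner_diff_left)
    qed (auto simp: g_def Cauchy_Schwarz_ineq2 gi[unfolded g_def])
    finally show ?thesis .
  qed
  have "(\<lambda>n. LINT x|M. g n x) \<longlonglongrightarrow> 0"
  proof (rule LIMSEQ_I)
    fix e :: real assume e: "e > 0"
    define R' where "R' = \<bar>R\<bar> + rho_conj w"
    have R': "R' \<ge> 0" using rho_conj_nonneg[of w] by (simp add: R'_def)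
    \<comment> \<open>Chosen so that the error \<open>\<epsilon> * (R' + 1)\<close> is half of
      e.\<close>
    define \<epsilon> where "\<epsilon> = e / (2 * (R' + 1))"
    have \<epsilon>: "\<epsilon> > 0" using e R' by (simp add: \<epsilon>_def)
    \<comment> \<open>Integrable for every \<epsilon> because \<open>Y\<close> is closed under
      scaling, which is where doubling enters.\<close>
    define \<Psi> where "\<Psi> x = 2 * \<epsilon> * \<phi> x (norm (v x /\<^sub>R \<epsilon>))" for x
    have \<Psi>i: "integrable M \<Psi>"
      unfolding \<Psi>_def[abs_def] by (intro integrable_mult_right Y_integrable Y_scale v)
    have \<Psi>m[measurable]: "\<Psi> \<in> borel_measurable M" using \<Psi>i by simp
    have mi: "integrable M (\<lambda>x. min (g n x) (\<Psi> x))" for n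
      using gi \<Psi>i by (rule integrable_min)
    have "(\<lambda>n. LINT x|M. min (g n x) (\<Psi> x)) \<longlonglongrightarrow> (LINT x|M. 0)"
    proof (rule integral_dominated_convergence[OF _ _ \<Psi>i])
      show "AE x in M. (\<lambda>n. min (g n x) (\<Psi> x)) \<longlonglongrightarrow> 0"
        using lim AE_young
      proof eventually_elim
        case (elim x)
        have "(\<lambda>n. min (g n x) (\<Psi> x)) \<longlonglongrightarrow> min (norm (w x - w x) * norm (v x)) (\<Psi> x)"
          unfolding g_def using elim(1) by (intro tendsto_intros)
        moreover have "0 \<le> \<Psi> x" using young_nonneg[OF elim(2)] \<epsilon> by (simp add: \<Psi>_def)
        ultimately show ?case by (simp add: min_def)
      qed
      show "AE x in M. norm (min (g n x) (\<Psi> x)) \<le> \<Psi> x" for n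
        using AE_young
      proof eventually_elim
        case (elim x)
        have "0 \<le> \<Psi> x" using young_nonneg[OF elim] \<epsilon> by (simp add: \<Psi>_def)
        moreover have "0 \<le> g n x" by (simp add: g_def)
        ultimately show ?case by simp
      qed
    qed measurable
    from LIMSEQ_D[OF this, of "e/2"] e obtain N where
      N: "\<And>n. n \<ge> N \<Longrightarrow> \<bar>LINT x|M. min (g n x) (\<Psi> x)\<bar> < e / 2" by auto
    show "\<exists>N. \<forall>n\<ge>N. norm ((LINT x|M. g n x) - 0) < e"
    proof (intro exI allI impI)
      fix n assume n: "n \<ge> N"
      have "(LINT x|M. g n x) \<le> (LINT x|M. min (g n x) (\<Psi> x) +
          \<epsilon> * (young_conj (\<phi> x) (norm (p n x)) + young_conj (\<phi> x) (norm (w x))))"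
      proof (rule integral_mono_AE[OF gi])
        show "integrable M (\<lambda>x. min (g n x) (\<Psi> x) +
          \<epsilon> * (young_conj (\<phi> x) (norm (p n x)) + young_conj (\<phi> x) (norm (w x))))"
          using mi pi wi by simp
        show "AE x in M. g n x \<le> min (g n x) (\<Psi> x) +
          \<epsilon> * (young_conj (\<phi> x) (norm (p n x)) + young_conj (\<phi> x) (norm (w x)))"
          using AE_young
        proof eventually_elim
          case (elim x)
          let ?a = "young_conj (\<phi> x) (norm (p n x))" and ?b = "young_conj (\<phi> x) (norm (w x))"
          \<comment> \<open>Halving the difference makes it a midpoint, so convexity of the
            conjugate replaces the doubling that it may lack; the factor 2 in \<Psi>
            compensates.\<close>
          have "young_conj (\<phi> x) (norm (p n x - w x) / 2) \<le> young_conj (\<phi> x) ((norm (p n x) + norm (w x)) / 2)"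
            by (rule young_conj_mono[OF elim]) (simp add: norm_triangle_ineq4)
          also have "\<dots> \<le> (?a + ?b) / 2" by (rule young_conj_midpoint[OF elim])
          finally have "norm (p n x - w x) / 2 * norm (v x /\<^sub>R \<epsilon>) \<le> \<phi> x (norm (v x /\<^sub>R \<epsilon>)) + (?a + ?b) / 2"
            using young_inequality[OF elim norm_ge_zero, of "norm (p n x - w x) / 2" "v x /\<^sub>R \<epsilon>"] by linarith
          then have "2 * \<epsilon> * (norm (p n x - w x) / 2 * norm (v x /\<^sub>R \<epsilon>)) \<le>
              2 * \<epsilon> * (\<phi> x (norm (v x /\<^sub>R \<epsilon>)) + (?a + ?b) / 2)"
            using \<epsilon> by (intro mult_left_mono) auto
          moreover have "2 * \<epsilon> * (norm (p n x - w x) / 2 * norm (v x /\<^sub>R \<epsilon>)) = g n x"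
            using \<epsilon> by (simp add: g_def)
          moreover have "2 * \<epsilon> * (F + s / 2) = 2 * \<epsilon> * F + \<epsilon> * s" for F s
            by (simp add: distrib_left)
          ultimately have "g n x \<le> \<Psi> x + \<epsilon> * (?a + ?b)"
            by (simp only: \<Psi>_def)
          moreover have "0 \<le> \<epsilon> * (?a + ?b)"
            using \<epsilon> young_conj_nonneg[OF elim] by simp
          ultimately show ?case by (simp add: min_def)
        qed
      qed
      also have "\<dots> = (LINT x|M. min (g n x) (\<Psi> x)) + \<epsilon> * (rho_conj (p n) + rho_conj w)"
        unfolding rho_conj_def using mi pi wi by simp
      also have "\<dots> < e / 2 + \<epsilon> * (R' + 1)"
      proof (rule add_less_le_mono)
        show "(LINT x|M. min (g n x) (\<Psi> x)) < e / 2" using N[OF n] by simp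
        show "\<epsilon> * (rho_conj (p n) + rho_conj w) \<le> \<epsilon> * (R' + 1)"
          using R[of n] \<epsilon> by (intro mult_left_mono) (auto simp: R'_def)
      qed
      also have "\<epsilon> * (R' + 1) = e / 2" using R' by (simp add: \<epsilon>_def divide_simps)
      finally have "(LINT x|M. g n x) < e" by simp
      moreover have "0 \<le> (LINT x|M. g n x)" by (simp add: g_def)
      ultimately show "norm ((LINT x|M. g n x) - 0) < e" by simp
    qed
  qed
  then have "(\<lambda>n. pairing \<Omega> (p n) v - pairing \<Omega> w v) \<longlonglongrightarrow> 0"
    by (rule Lim_null_comparison[rotated]) (simp add: diff)
  then show ?thesis by (simp add: LIM_zero_iff)
qed

text \<open>The fields with finite dual value, each with an explicit divergence. Finiteness at scale
  one is required, because elements of \<open>Ystar\<close> may have infinite modular and then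
  contribute the value \<open>- \<infinity>\<close>.\<close>

definition adm :: "('a \<Rightarrow> 'a) \<Rightarrow> ('a \<Rightarrow> real) \<Rightarrow> bool" where
  "adm p d \<longleftrightarrow> p \<in> borel_measurable M \<and> integrable M (\<lambda>x. young_conj (\<phi> x) (norm (p x))) \<and> weak_div p d"

text \<open>The negative of the dual functional on admissible pairs, so that the maximization
  becomes a convex minimization in real numbers.\<close>

definition energy :: "('a \<Rightarrow> real) \<Rightarrow> ('a \<Rightarrow> 'a) \<Rightarrow> ('a \<Rightarrow> real) \<Rightarrow> real" where
  "energy f p d = 1/2 * (LINT x|M. (d x)\<^sup>2) + (LINT x|M. f x * d x) + rho_conj p"

lemma admD:
  assumes "adm p d"
  shows "p \<in> borel_measurable M" "integrable M (\<lambda>x. young_conj (\<phi> x) (norm (p x)))" "weak_div p d"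
    "d \<in> sqint M" "p \<in> Ystar"
  using assms by (auto simp: adm_def weak_div_def intro: finite_modular_in_Ystar)

lemma dual_functional_adm:
  assumes f: "f \<in> sqint M" and a: "adm p d"
  shows "dual_functional \<Omega> \<phi> f p = ereal (- energy f p d)"
proof -
  note A = admD[OF a]
  note K = K_setI[OF A(5,3)]
  have ds: "divergence \<Omega> p \<in> sqint M" using K_setD(2)[OF K(1)] by (simp add: weak_div_def)
  have "(LINT x|M. (divergence \<Omega> p x)\<^sup>2) = (LINT x|M. (d x)\<^sup>2)"
    using K(2) sqint_integrable[OF ds] sqint_integrable[OF A(4)]
    by (intro integral_cong_AE) (auto elim: eventually_mono)
  moreover have "(LINT x|M. f x * divergence \<Omega> p x) = (LINT x|M. f x * d x)"
    using K(2) sqint_mult_integrable[OF f ds] sqint_mult_integrable[OF f A(4)]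
    by (intro integral_cong_AE) (auto elim: eventually_mono)
  ultimately show ?thesis
    by (simp add: dual_functional_def L2_norm_def modular_conj_integrable[OF A(2)] rho_conj_nonneg
        enn2ereal_ennreal energy_def)
qed

text \<open>The quadratic and linear terms are half the square of \<open>f + d\<close> minus half
  the square of \<open>f\<close>. Besides bounding the energy below, this controls the conjugate
  modular along minimising sequences.\<close>

lemma energy_bound:
  assumes f: "f \<in> sqint M" and a: "adm p d"
  shows "rho_conj p - 1/2 * (LINT x|M. (f x)\<^sup>2) \<le> energy f p d"
proof -
  have "0 \<le> (LINT x|M. (f x + 1 * d x)\<^sup>2)" by simp
  also have "\<dots> = (LINT x|M. (f x)\<^sup>2) + 2 * (LINT x|M. f x * d x) + (LINT x|M. (d x)\<^sup>2)"
    using integral_square_add_scale[OF f admD(4)[OF a], of 1] by simp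
  finally show ?thesis by (simp add: energy_def)
qed

lemma adm_0: "adm (\<lambda>_. 0) (\<lambda>_. 0)"
proof -
  have "integrable M (\<lambda>x. young_conj (\<phi> x) (norm (0::'a)))"
    by (subst integrable_cong_AE[where g="\<lambda>_. 0"])
      (use AE_young in \<open>auto elim!: eventually_mono simp: young_conj_0\<close>)
  then show ?thesis by (simp add: adm_def weak_div_def sqint_0 pairing_def)
qed

text \<open>The parallelogram law gains 1/4 of the squared distance of the divergences, halved in
  the energy; the linear term is affine and the modular is convex.\<close>

lemma adm_midpoint:
  assumes f: "f \<in> sqint M" and p: "adm p d" and q: "adm q e"
  shows "adm (\<lambda>x. (1/2) *\<^sub>R (p x + q x)) (\<lambda>x. (d x + e x) / 2)"
    and "energy f (\<lambda>x. (1/2) *\<^sub>R (p x + q x)) (\<lambda>x. (d x + e x) / 2) \<le>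
      (energy f p d + energy f q e) / 2 - 1/8 * (LINT x|M. (d x - e x)\<^sup>2)"
proof -
  note P = admD[OF p] and Q = admD[OF q]
  note P(1)[measurable] Q(1)[measurable]
  let ?m = "\<lambda>x. (1/2) *\<^sub>R (p x + q x)" and ?d = "\<lambda>x. (d x + e x) / 2"
  have le: "AE x in M. 0 \<le> young_conj (\<phi> x) (norm (?m x)) \<and> young_conj (\<phi> x) (norm (?m x)) \<le>
      (young_conj (\<phi> x) (norm (p x)) + young_conj (\<phi> x) (norm (q x))) / 2"
    using AE_young
  proof eventually_elim
    case (elim x)
    have "young_conj (\<phi> x) (norm (?m x)) \<le> young_conj (\<phi> x) ((norm (p x) + norm (q x)) / 2)"
      using norm_triangle_ineq[of "p x" "q x"] by (intro young_conj_mono[OF elim]) simp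
    also have "\<dots> \<le> (young_conj (\<phi> x) (norm (p x)) + young_conj (\<phi> x) (norm (q x))) / 2"
      by (rule young_conj_midpoint[OF elim])
    finally show ?case using young_conj_nonneg[OF elim] by blast
  qed
  have int: "integrable M (\<lambda>x. (young_conj (\<phi> x) (norm (p x)) + young_conj (\<phi> x) (norm (q x))) / 2)"
    using P Q by simp
  have mi: "integrable M (\<lambda>x. young_conj (\<phi> x) (norm (?m x)))"
  proof (rule Bochner_Integration.integrable_bound[OF int])
    show "(\<lambda>x. young_conj (\<phi> x) (norm (?m x))) \<in> borel_measurable M" by measurable
    show "AE x in M. norm (young_conj (\<phi> x) (norm (?m x))) \<le>
        norm ((young_conj (\<phi> x) (norm (p x)) + young_conj (\<phi> x) (norm (q x))) / 2)"
      using le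
    proof eventually_elim
      case (elim x)
      then have "0 \<le> young_conj (\<phi> x) (norm (?m x))"
        "young_conj (\<phi> x) (norm (?m x)) \<le> (young_conj (\<phi> x) (norm (p x)) + young_conj (\<phi> x) (norm (q x))) / 2"
        by blast+
      moreover from this have "0 \<le> (young_conj (\<phi> x) (norm (p x)) + young_conj (\<phi> x) (norm (q x))) / 2"
        by (rule order_trans)
      ultimately show ?case by (simp only: real_norm_def abs_of_nonneg)
    qed
  qed
  have rm: "rho_conj ?m \<le> (rho_conj p + rho_conj q) / 2"
  proof -
    have "rho_conj ?m \<le> (LINT x|M. (young_conj (\<phi> x) (norm (p x)) + young_conj (\<phi> x) (norm (q x))) / 2)"
      unfolding rho_conj_def by (rule integral_mono_AE[OF mi int]) (use le in \<open>auto elim: eventually_mono\<close>)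
    also have "\<dots> = (rho_conj p + rho_conj q) / 2" unfolding rho_conj_def using P Q by simp
    finally show ?thesis .
  qed
  have ds: "?d \<in> sqint M"
    using sqint_scale[OF sqint_add[OF P(4) Q(4)], of "1/2"] by simp
  have "weak_div ?m ?d"
    unfolding weak_div_def
  proof (intro conjI ballI ds)
    fix u assume u: "u \<in> X"
    have "pairing \<Omega> ?m (grad u) = (pairing \<Omega> p (grad u) + pairing \<Omega> q (grad u)) / 2"
      using integrable_inner[OF P(5) X_D(3)[OF u]] integrable_inner[OF Q(5) X_D(3)[OF u]]
      by (simp add: pairing_def inner_add_left add_divide_distrib)
    also have "\<dots> = - (((LINT x|M. d x * u x) + (LINT x|M. e x * u x)) / 2)"
      using P(3) Q(3) u by (simp add: weak_div_def add_divide_distrib)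
    also have "((LINT x|M. d x * u x) + (LINT x|M. e x * u x)) / 2 = (LINT x|M. (d x * u x + e x * u x) / 2)"
      using sqint_mult_integrable[OF P(4) X_D(2)[OF u]] sqint_mult_integrable[OF Q(4) X_D(2)[OF u]] by simp
    also have "\<dots> = (LINT x|M. ?d x * u x)" by (simp add: distrib_right)
    finally show "pairing \<Omega> ?m (grad u) = - (LINT x|M. ?d x * u x)" .
  qed
  with mi show "adm ?m ?d" by (simp add: adm_def)
  have "(LINT x|M. (?d x)\<^sup>2) = (LINT x|M. (1/2 * (d x)\<^sup>2 + 1/2 * (e x)\<^sup>2) - 1/4 * (d x - e x)\<^sup>2)"
    by (rule Bochner_Integration.integral_cong) (auto simp: power2_eq_square field_simps)
  also have "\<dots> = 1/2 * (LINT x|M. (d x)\<^sup>2) + 1/2 * (LINT x|M. (e x)\<^sup>2) - 1/4 * (LINT x|M. (d x - e x)\<^sup>2)"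
    using sqint_integrable[OF P(4)] sqint_integrable[OF Q(4)] sqint_integrable[OF sqint_diff[OF P(4) Q(4)]]
    by simp
  finally have sq: "(LINT x|M. (?d x)\<^sup>2) =
    1/2 * (LINT x|M. (d x)\<^sup>2) + 1/2 * (LINT x|M. (e x)\<^sup>2) - 1/4 * (LINT x|M. (d x - e x)\<^sup>2)" .
  have "(LINT x|M. f x * ?d x) = (LINT x|M. 1/2 * (f x * d x) + 1/2 * (f x * e x))"
    by (simp add: field_simps)
  also have "\<dots> = 1/2 * (LINT x|M. f x * d x) + 1/2 * (LINT x|M. f x * e x)"
    using sqint_mult_integrable[OF f P(4)] sqint_mult_integrable[OF f Q(4)] by simp
  finally have "(LINT x|M. f x * ?d x) = 1/2 * (LINT x|M. f x * d x) + 1/2 * (LINT x|M. f x * e x)" .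
  then show "energy f ?m ?d \<le> (energy f p d + energy f q e) / 2 - 1/8 * (LINT x|M. (d x - e x)\<^sup>2)"
    using sq rm unfolding energy_def by argo
qed

section \<open>The strictly convex selection functional and the minimization\<close>

definition bracket_integral :: "('a \<Rightarrow> 'a) \<Rightarrow> real" where
  "bracket_integral p = (LINT x|M. bracket (p x))"

lemma measurable_bracket[measurable]: "p \<in> borel_measurable M \<Longrightarrow> (\<lambda>x. bracket (p x)) \<in> borel_measurable M"
  for p :: "'a \<Rightarrow> 'a"
  unfolding bracket_def by measurable

text \<open>Young's inequality at t = 1 bounds \<open>norm (p x)\<close> by
  \<open>\<phi> x 1\<close>, which is integrable, plus the conjugate.\<close>

lemma bracket_integrable:
  assumes a: "adm p d"
  shows "integrable M (\<lambda>x. bracket (p x))"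
    and "bracket_integral p \<le> measure M (space M) + (LINT x|M. \<phi> x 1) + rho_conj p"
proof -
  note A = admD[OF a]
  note A(1)[measurable]
  have le: "AE x in M. bracket (p x) \<le> 1 + (\<phi> x 1 + young_conj (\<phi> x) (norm (p x)))"
    using AE_young
  proof eventually_elim
    case (elim x)
    show ?case using young_inequality[OF elim, of 1 "norm (p x)"] bracket_le[of "p x"] by simp
  qed
  have int: "integrable M (\<lambda>x. 1 + (\<phi> x 1 + young_conj (\<phi> x) (norm (p x))))"
    using A(2) integrable_\<phi>[of 1] by simp
  show i: "integrable M (\<lambda>x. bracket (p x))"
  proof (rule Bochner_Integration.integrable_bound[OF int])
    show "AE x in M. norm (bracket (p x)) \<le> norm (1 + (\<phi> x 1 + young_conj (\<phi> x) (norm (p x))))"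
      using le
    proof eventually_elim
      case (elim x)
      then show ?case using bracket_ge_1[of "p x"] by simp
    qed
  qed measurable
  have "bracket_integral p \<le> (LINT x|M. 1 + (\<phi> x 1 + young_conj (\<phi> x) (norm (p x))))"
    unfolding bracket_integral_def by (rule integral_mono_AE[OF i int le])
  also have "\<dots> = measure M (space M) + (LINT x|M. \<phi> x 1) + rho_conj p"
    unfolding rho_conj_def using A(2) integrable_\<phi>[of 1] by simp
  finally show "bracket_integral p \<le> measure M (space M) + (LINT x|M. \<phi> x 1) + rho_conj p" .
qed

lemma integral_min_1_le:
  assumes f: "f \<in> sqint M" and p: "adm p d" and q: "adm q e" and \<delta>: "\<delta> > 0" and K: "K > 0"
  shows "(LINT x|M. min 1 (norm (p x - q x))) \<le> \<delta> * measure M (space M)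
    + 4 * K ^ 3 / \<delta> * ((bracket_integral p + bracket_integral q) / 2
        - bracket_integral (\<lambda>x. (1/2) *\<^sub>R (p x + q x)))
    + (bracket_integral p + bracket_integral q) / K"
proof -
  note i = bracket_integrable(1)[OF p] bracket_integrable(1)[OF q] bracket_integrable(1)[OF adm_midpoint(1)[OF f p q]]
  note admD(1)[OF p, measurable] admD(1)[OF q, measurable]
  have "(LINT x|M. min 1 (norm (p x - q x))) \<le> (LINT x|M. \<delta>
    + 4 * K ^ 3 / \<delta> * ((bracket (p x) + bracket (q x)) / 2 - bracket ((1/2) *\<^sub>R (p x + q x)))
    + (bracket (p x) + bracket (q x)) / K)"
  proof (rule integral_mono)
    show "integrable M (\<lambda>x. min 1 (norm (p x - q x)))"
      by (rule integrable_min_1_norm[OF finite_measure_axioms]) measurable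
    show "min 1 (norm (p x - q x)) \<le> \<delta>
      + 4 * K ^ 3 / \<delta> * ((bracket (p x) + bracket (q x)) / 2 - bracket ((1/2) *\<^sub>R (p x + q x)))
      + (bracket (p x) + bracket (q x)) / K" for x
      by (rule min_1_norm_diff_le[OF \<delta> K])
  qed (use i in simp)
  also have "\<dots> = \<delta> * measure M (space M)
    + 4 * K ^ 3 / \<delta> * ((bracket_integral p + bracket_integral q) / 2
        - bracket_integral (\<lambda>x. (1/2) *\<^sub>R (p x + q x)))
    + (bracket_integral p + bracket_integral q) / K"
    unfolding bracket_integral_def using i by simp
  finally show ?thesis .
qed

theorem exists_minimizer:
  assumes f: "f \<in> sqint M"
  obtains w D where "adm w D" "\<And>p d. adm p d \<Longrightarrow> energy f w D \<le> energy f p d"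
proof -
  define m where "m = Inf {energy f p d |p d. adm p d}"
  have below: "bdd_below {energy f p d |p d. adm p d}"
  proof (rule bdd_belowI)
    fix y assume "y \<in> {energy f p d |p d. adm p d}"
    then obtain p d where "adm p d" "y = energy f p d" by blast
    then show "- (1/2 * (LINT x|M. (f x)\<^sup>2)) \<le> y"
      using energy_bound[OF f, of p d] rho_conj_nonneg[of p] by linarith
  qed
  have m: "m \<le> energy f p d" if "adm p d" for p d
    unfolding m_def using that by (intro cInf_lower below) auto
  \<comment> \<open>\<open>C n\<close> is the set of near-minimisers with tolerance 1/(n+1). These
    sets decrease in n, are closed under midpoints, and have uniformly bounded conjugate
    modulars.\<close>
  define C where "C n p \<longleftrightarrow> (\<exists>d. adm p d \<and> energy f p d \<le> m + inverse (real (Suc n)))" for n p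
  have ne: "\<exists>p. C n p" for n
  proof -
    have "Inf {energy f p d |p d. adm p d} < m + inverse (real (Suc n))" by (simp add: m_def)
    then obtain y where "y \<in> {energy f p d |p d. adm p d}" "y < m + inverse (real (Suc n))"
      using cInf_lessD[of "{energy f p d |p d. adm p d}"] adm_0 by blast
    then show ?thesis unfolding C_def by (auto intro: less_imp_le)
  qed
  have C_anti: "C k p \<Longrightarrow> C n p" if "n \<le> k" for n k p
  proof -
    have "inverse (real (Suc k)) \<le> inverse (real (Suc n))" using that by (intro le_imp_inverse_le) auto
    then show "C k p \<Longrightarrow> C n p" unfolding C_def by (meson add_left_mono order_trans)
  qed
  have C_mid: "C n (\<lambda>x. (1/2) *\<^sub>R (p x + q x))" if pq: "C n p" "C n q" for n p q
  proof -
    obtain d e where d: "adm p d" "energy f p d \<le> m + inverse (real (Suc n))"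
      and e: "adm q e" "energy f q e \<le> m + inverse (real (Suc n))"
      using pq unfolding C_def by blast
    have "0 \<le> (LINT x|M. (d x - e x)\<^sup>2)" by simp
    then have "energy f (\<lambda>x. (1/2) *\<^sub>R (p x + q x)) (\<lambda>x. (d x + e x) / 2) \<le> m + inverse (real (Suc n))"
      using adm_midpoint(2)[OF f d(1) e(1)] d(2) e(2) by argo
    then show ?thesis unfolding C_def using adm_midpoint(1)[OF f d(1) e(1)] by blast
  qed
  define R where "R = m + 1 + 1/2 * (LINT x|M. (f x)\<^sup>2)"
  have rhoR: "rho_conj p \<le> R" if "C n p" for n p
  proof -
    obtain d where d: "adm p d" "energy f p d \<le> m + inverse (real (Suc n))"
      using \<open>C n p\<close> unfolding C_def by blast
    have "inverse (real (Suc n)) \<le> 1" by (simp add: inverse_le_1_iff)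
    then show ?thesis using energy_bound[OF f d(1)] d(2) unfolding R_def by linarith
  qed
  define B where "B = measure M (space M) + (LINT x|M. \<phi> x 1) + R"
  have biB: "bracket_integral p \<le> B" if "C n p" for n p
  proof -
    obtain d where d: "adm p d" using \<open>C n p\<close> unfolding C_def by blast
    show ?thesis using bracket_integrable(2)[OF d] rhoR[OF that] unfolding B_def by linarith
  qed
  have bi0: "0 \<le> bracket_integral p" for p
    unfolding bracket_integral_def by (rule Bochner_Integration.integral_nonneg) (use bracket_ge_1 order_trans zero_le_one in blast)
  \<comment> \<open>The sets \<open>C n\<close> shrink, so these infima increase; being bounded by
    \<open>B\<close> they converge. This is what replaces a minimiser of the selection
    functional.\<close>
  define I where "I n = Inf (bracket_integral ` Collect (C n))" for n
  have bdd: "bdd_below (bracket_integral ` Collect (C n))" for n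
    by (rule bdd_belowI2[of _ 0]) (rule bi0)
  have I_le: "I n \<le> bracket_integral p" if "C n p" for n p
    unfolding I_def using that by (intro cINF_lower bdd) simp
  have "\<exists>p. C n p \<and> bracket_integral p < I n + inverse (real (Suc n))" for n
  proof -
    have "Inf (bracket_integral ` Collect (C n)) < I n + inverse (real (Suc n))" by (simp add: I_def)
    from cInf_lessD[OF _ this] ne[of n] show ?thesis by blast
  qed
  then obtain p where p: "\<And>n. C n (p n)" and pI: "\<And>n. bracket_integral (p n) < I n + inverse (real (Suc n))"
    by metis
  from p obtain d where d: "\<And>n. adm (p n) (d n)" and dE: "\<And>n. energy f (p n) (d n) \<le> m + inverse (real (Suc n))"
    unfolding C_def by metis
  have "incseq I"
  proof (rule incseq_SucI)
    fix n show "I n \<le> I (Suc n)"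
      unfolding I_def[of "Suc n"] using ne[of "Suc n"] by (intro cINF_greatest) (auto intro!: I_le C_anti[of n "Suc n"])
  qed
  moreover have "I n \<le> B" for n using I_le[OF p] biB[OF p] by (rule order_trans)
  ultimately obtain L where L: "I \<longlonglongrightarrow> L" using incseq_convergent by blast
  \<comment> \<open>The midpoint of \<open>p n\<close> and \<open>p k\<close> belongs to the larger
    of the two sets, that of index \<open>min n k\<close>, so its bracket integral is at least
    \<open>I (min n k)\<close>.\<close>
  have gap: "(bracket_integral (p n) + bracket_integral (p k)) / 2 - bracket_integral (\<lambda>x. (1/2) *\<^sub>R (p n x + p k x))
      \<le> (I n + I k) / 2 - I (min n k) + (inverse (real (Suc n)) + inverse (real (Suc k))) / 2" for n k
  proof -
    have "C (min n k) (p n)" "C (min n k) (p k)" using p C_anti by (meson min.cobounded1 min.cobounded2)+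
    from I_le[OF C_mid[OF this]] show ?thesis using pI[of n] pI[of k] by argo
  qed
  have gap0: "\<exists>N. \<forall>n\<ge>N. \<forall>k\<ge>N. (bracket_integral (p n) + bracket_integral (p k)) / 2
      - bracket_integral (\<lambda>x. (1/2) *\<^sub>R (p n x + p k x)) < e" if e: "e > 0" for e
  proof -
    obtain N1 where N1: "\<And>n. n \<ge> N1 \<Longrightarrow> \<bar>I n - L\<bar> < e / 4"
      using LIMSEQ_D[OF L, of "e/4"] e by auto
    obtain N2 where N2: "\<And>n. n \<ge> N2 \<Longrightarrow> \<bar>inverse (real (Suc n))\<bar> < e / 4"
      using LIMSEQ_D[OF LIMSEQ_inverse_real_of_nat, of "e/4"] e by auto
    show ?thesis
    proof (intro exI allI impI)
      fix n k assume nk: "n \<ge> max N1 N2" "k \<ge> max N1 N2"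
      then have "\<bar>I n - L\<bar> < e / 4" "\<bar>I k - L\<bar> < e / 4" "\<bar>I (min n k) - L\<bar> < e / 4"
        "inverse (real (Suc n)) < e / 4" "inverse (real (Suc k)) < e / 4"
        using N1[of n] N1[of k] N1[of "min n k"] N2[of n] N2[of k] by auto
      then show "(bracket_integral (p n) + bracket_integral (p k)) / 2
          - bracket_integral (\<lambda>x. (1/2) *\<^sub>R (p n x + p k x)) < e"
        using gap[of n k] by argo
    qed
  qed
  have B0: "0 \<le> B" using bi0[of "p 0"] biB[OF p, of 0] by linarith
  have cau: "\<exists>N. \<forall>n\<ge>N. \<forall>k\<ge>N. (LINT x|M. min 1 (norm (p n x - p k x))) < e" if e: "e > 0" for e
  proof -
    define \<mu> where "\<mu> = measure M (space M)"
    have \<mu>: "\<mu> \<ge> 0" by (simp add: \<mu>_def)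
    \<comment> \<open>The constants make each of the three terms of \<open>integral_min_1_le\<close>
      at most e/3; the summands 1 keep \<delta> well defined and K positive when \<mu> or
      \<open>B\<close> is 0.\<close>
    define \<delta> where "\<delta> = e / (3 * (\<mu> + 1))"
    define K where "K = 6 * (B + 1) / e"
    have \<delta>: "\<delta> > 0" and K: "K > 0" using e \<mu> B0 by (auto simp: \<delta>_def K_def)
    have e3: "e * \<delta> / (12 * K ^ 3) > 0" using e \<delta> K by simp
    obtain N where N: "\<And>n k. n \<ge> N \<Longrightarrow> k \<ge> N \<Longrightarrow> (bracket_integral (p n) + bracket_integral (p k)) / 2
      - bracket_integral (\<lambda>x. (1/2) *\<^sub>R (p n x + p k x)) < e * \<delta> / (12 * K ^ 3)"
      using gap0[OF e3] by blast
    show ?thesis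
    proof (intro exI allI impI)
      fix n k assume nk: "n \<ge> N" "k \<ge> N"
      define g where "g = (bracket_integral (p n) + bracket_integral (p k)) / 2
        - bracket_integral (\<lambda>x. (1/2) *\<^sub>R (p n x + p k x))"
      have "(LINT x|M. min 1 (norm (p n x - p k x))) \<le> \<delta> * \<mu> + 4 * K ^ 3 / \<delta> * g
          + (bracket_integral (p n) + bracket_integral (p k)) / K"
        unfolding g_def \<mu>_def by (rule integral_min_1_le[OF f d d \<delta> K])
      moreover have "\<delta> * \<mu> \<le> e / 3"
      proof -
        have "\<delta> * \<mu> \<le> \<delta> * (\<mu> + 1)" using \<delta> by (intro mult_left_mono) auto
        also have "\<dots> = e / 3" using \<mu> by (simp add: \<delta>_def divide_simps)
        finally show ?thesis .
      qed
      moreover have "4 * K ^ 3 / \<delta> * g < e / 3"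
      proof -
        have "4 * K ^ 3 / \<delta> * g < 4 * K ^ 3 / \<delta> * (e * \<delta> / (12 * K ^ 3))"
          using N[OF nk] \<delta> K unfolding g_def by (intro mult_strict_left_mono) auto
        also have "\<dots> = e / 3" using \<delta> K by (simp add: field_simps)
        finally show ?thesis .
      qed
      moreover have "(bracket_integral (p n) + bracket_integral (p k)) / K \<le> e / 3"
      proof -
        have "(bracket_integral (p n) + bracket_integral (p k)) / K \<le> (2 * (B + 1)) / K"
          using biB[OF p, of n] biB[OF p, of k] K by (intro divide_right_mono) auto
        also have "\<dots> = e / 3" using e B0 by (simp add: K_def field_simps)
        finally show ?thesis .
      qed
      ultimately show "(LINT x|M. min 1 (norm (p n x - p k x))) < e" by linarith
    qed
  qed
  obtain r w where r: "strict_mono r" and w[measurable]: "w \<in> borel_measurable M"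
    and lim: "AE x in M. (\<lambda>n. p (r n) x) \<longlonglongrightarrow> w x"
    by (rule AE_convergent_subsequence[where u=p, OF finite_measure_axioms admD(1)[OF d] cau]) (assumption | rule that)+
  have ds: "d n \<in> sqint M" for n by (rule admD(4)[OF d])
  \<comment> \<open>The midpoint has energy at least \<open>m\<close>, so 1/8 of the squared
    distance is at most the average of the two tolerances.\<close>
  have dgap: "(LINT x|M. (d n x - d k x)\<^sup>2) \<le> 4 * inverse (real (Suc n)) + 4 * inverse (real (Suc k))" for n k
    using adm_midpoint(2)[OF f d[of n] d[of k]] m[OF adm_midpoint(1)[OF f d[of n] d[of k]]] dE[of n] dE[of k]
    by argo
  have dcau: "\<exists>N. \<forall>n\<ge>N. \<forall>k\<ge>N. (LINT x|M. (d n x - d k x)\<^sup>2) < e" if e: "e > 0" for e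
  proof -
    obtain N where N: "\<And>n. n \<ge> N \<Longrightarrow> \<bar>inverse (real (Suc n))\<bar> < e / 8"
      using LIMSEQ_D[OF LIMSEQ_inverse_real_of_nat, of "e/8"] e by auto
    show ?thesis
    proof (intro exI allI impI)
      fix n k assume "n \<ge> N" "k \<ge> N"
      from N[OF this(1)] N[OF this(2)] dgap[of n k] show "(LINT x|M. (d n x - d k x)\<^sup>2) < e" by argo
    qed
  qed
  obtain D where D: "D \<in> sqint M" and dlim: "(\<lambda>n. LINT x|M. (d n x - D x)\<^sup>2) \<longlonglongrightarrow> 0"
    by (rule sqint_complete[OF finite_measure_axioms ds dcau]) (assumption | rule that)+
  have dlim: "(\<lambda>n. LINT x|M. (d (r n) x - D x)\<^sup>2) \<longlonglongrightarrow> 0"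
    using LIMSEQ_subseq_LIMSEQ[OF dlim r] by (simp add: o_def)
  \<comment> \<open>\<open>Q n\<close> is what near-minimality leaves for the conjugate modular of
    \<open>p (r n)\<close>. Its limit \<open>q\<close> depends on the strong limit \<open>D\<close>
    alone, so bounding the modular of \<open>w\<close> by \<open>q\<close> is precisely
    optimality.\<close>
  define Q where "Q n = m + inverse (real (Suc (r n))) - 1/2 * (LINT x|M. (d (r n) x)\<^sup>2) - (LINT x|M. f x * d (r n) x)" for n
  define q where "q = m - 1/2 * (LINT x|M. (D x)\<^sup>2) - (LINT x|M. f x * D x)"
  have Qlim: "Q \<longlonglongrightarrow> q"
  proof -
    have "(\<lambda>n. inverse (real (Suc (r n)))) \<longlonglongrightarrow> 0"
      using LIMSEQ_subseq_LIMSEQ[OF LIMSEQ_inverse_real_of_nat r] by (simp add: o_def)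
    moreover have "(\<lambda>n. LINT x|M. f x * d (r n) x) \<longlonglongrightarrow> (LINT x|M. f x * D x)"
      using tendsto_integral_mult_sqint[OF ds D f dlim] by (simp add: mult.commute)
    ultimately have "Q \<longlonglongrightarrow> m + 0 - 1/2 * (LINT x|M. (D x)\<^sup>2) - (LINT x|M. f x * D x)"
      unfolding Q_def[abs_def] by (intro tendsto_intros tendsto_integral_square[OF ds D dlim])
    then show ?thesis by (simp add: q_def)
  qed
  have rQ: "rho_conj (p (r n)) \<le> Q n" for n
    using dE[of "r n"] unfolding Q_def energy_def by linarith
  have q0: "0 \<le> q"
    using Qlim by (rule LIMSEQ_le_const) (use rQ rho_conj_nonneg order_trans in blast)
  \<comment> \<open>Lower semicontinuity of the conjugate and Fatou's lemma: the limit has finite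
    modular at scale one, so it is again admissible once its divergence is known.\<close>
  note [measurable] = admD(1)[OF d]
  have fatou: "(\<integral>\<^sup>+x. ennreal (young_conj (\<phi> x) (norm (w x))) \<partial>M) \<le> ennreal q"
  proof -
    have "(\<integral>\<^sup>+x. ennreal (young_conj (\<phi> x) (norm (w x))) \<partial>M) \<le>
        (\<integral>\<^sup>+x. liminf (\<lambda>n. ennreal (young_conj (\<phi> x) (norm (p (r n) x)))) \<partial>M)"
      by (rule nn_integral_mono_AE, use lim AE_young in eventually_elim) (intro young_conj_lsc tendsto_norm)
    also have "\<dots> \<le> liminf (\<lambda>n. \<integral>\<^sup>+x. ennreal (young_conj (\<phi> x) (norm (p (r n) x))) \<partial>M)"
      by (rule nn_integral_liminf) measurable
    also have "\<dots> = liminf (\<lambda>n. ennreal (rho_conj (p (r n))))"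
      using modular_conj_integrable[OF admD(2)[OF d]] by (simp add: modular_conj)
    also have "\<dots> \<le> liminf (\<lambda>n. ennreal (Q n))"
      by (intro Liminf_mono always_eventually allI ennreal_leI rQ)
    also have "\<dots> = ennreal q"
      by (intro lim_imp_Liminf tendsto_ennrealI Qlim) simp
    finally show ?thesis .
  qed
  have wi: "integrable M (\<lambda>x. young_conj (\<phi> x) (norm (w x)))"
  proof -
    have "modular \<Omega> (conj_fun \<phi>) w < \<infinity>"
      unfolding modular_conj using fatou by (rule le_less_trans) simp
    then show ?thesis using modular_conj_finite_iff[OF w] by blast
  qed
  have rw: "rho_conj w \<le> q"
    using fatou q0 modular_conj_integrable[OF wi] by (simp add: modular_conj ennreal_le_iff)
  have "weak_div w D"
    unfolding weak_div_def
  proof (intro conjI ballI D)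
    fix u assume u: "u \<in> X"
    have "(\<lambda>n. pairing \<Omega> (p (r n)) (grad u)) \<longlonglongrightarrow> pairing \<Omega> w (grad u)"
      by (rule pairing_tendsto[OF admD(1)[OF d] admD(2)[OF d] w wi rhoR[OF p] lim X_D(3)[OF u]])
    moreover have "pairing \<Omega> (p (r n)) (grad u) = - (LINT x|M. d (r n) x * u x)" for n
      using admD(3)[OF d] u by (simp add: weak_div_def)
    moreover have "(\<lambda>n. - (LINT x|M. d (r n) x * u x)) \<longlonglongrightarrow> - (LINT x|M. D x * u x)"
      by (intro tendsto_minus tendsto_integral_mult_sqint[OF ds D X_D(2)[OF u] dlim])
    ultimately show "pairing \<Omega> w (grad u) = - (LINT x|M. D x * u x)"
      using LIMSEQ_unique by fastforce
  qed
  then have adm: "adm w D" using wi w by (simp add: adm_def)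
  show thesis
  proof (rule that[OF adm])
    fix p' d' assume "adm p' d'"
    from m[OF this] rw show "energy f w D \<le> energy f p' d'"
      unfolding q_def energy_def by linarith
  qed
qed

theorem exists_maximizer:
  assumes f: "f \<in> sqint M"
  shows "\<exists>p\<in>K_set \<Omega> \<phi>. \<forall>q\<in>K_set \<Omega> \<phi>. dual_functional \<Omega> \<phi> f q \<le> dual_functional \<Omega> \<phi> f p"
proof -
  obtain w D where w: "adm w D" and min: "\<And>p d. adm p d \<Longrightarrow> energy f w D \<le> energy f p d"
    using exists_minimizer[OF f] by blast
  have "dual_functional \<Omega> \<phi> f q \<le> dual_functional \<Omega> \<phi> f w" if q: "q \<in> K_set \<Omega> \<phi>" for q
  proof (cases "modular \<Omega> (conj_fun \<phi>) q < \<infinity>")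
    case True
    note K = K_setD[OF q]
    have "adm q (divergence \<Omega> q)"
      unfolding adm_def using K True modular_conj_finite_iff[OF Ystar_measurable[OF K(1)]]
        Ystar_measurable[OF K(1)] by blast
    then show ?thesis using min by (simp add: dual_functional_adm[OF f] w dual_functional_adm[OF f w])
  next
    \<comment> \<open>Membership in \<open>K_set\<close> gives a finite modular only after scaling;
      with infinite modular at scale one the value is \<open>- \<infinity>\<close>.\<close>
    case False
    then have "modular \<Omega> (conj_fun \<phi>) q = \<infinity>" by (simp add: less_top[symmetric])
    then show ?thesis by (simp add: dual_functional_def)
  qed
  then show ?thesis using K_setI(1)[OF admD(5,3)[OF w]] by blast
qed

end

theorem lemma3p9:
  fixes \<Omega> :: "'a::euclidean_space set"
    and \<phi> :: "'a \<Rightarrow> real \<Rightarrow> real"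
    and f :: "'a \<Rightarrow> real"
  assumes "bounded_lipschitz_domain \<Omega>"
    and "standing_assumptions \<Omega> \<phi>"
    and "f \<in> L2 \<Omega>"
  shows "(\<forall>p\<in>MO_space \<Omega> (conj_fun \<phi>).
            pairing \<Omega> p \<in> Y_dual \<Omega> \<phi> \<and>
            fenchel_dual_objective (X_space \<Omega> \<phi>) (Y_space \<Omega> \<phi>) (weak_grad \<Omega>)
              (F0 \<Omega> f) (G_fun \<Omega> \<phi>) (pairing \<Omega> p) =
            (if p \<in> K_set \<Omega> \<phi> then dual_functional \<Omega> \<phi> f p else - \<infinity>)) \<and>
         (\<exists>p\<in>K_set \<Omega> \<phi>. \<forall>q\<in>K_set \<Omega> \<phi>. dual_functional \<Omega> \<phi> f q \<le> dual_functional \<Omega> \<phi> f p)"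
proof -
  interpret musielak_orlicz \<Omega> \<phi>
    using assms by unfold_locales (auto simp: bounded_lipschitz_domain_def)
  have f: "f \<in> sqint M" using assms(3) by (simp add: L2_eq_sqint)
  show ?thesis
    using pairing_in_Y_dual fenchel_dual_objective_eq[OF f] exists_maximizer[OF f] by blast
qed

end
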